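(* Let $C>1$ be a constant such that for every real $Z>0$ and every cubic field $K$ with $|\Delta(K)|\le Z$, the set $S_K(CZ^{1/4})$ is nonempty. Let $X,Y>0$ be real numbers with $Y\geq CX^{1/4}$. Then for every $\epsilon>0$, \[ \sum_{\substack{[K:\mathbb{Q}]=3\\ |\Delta(K)|\leq X}}|S_K(Y)|\ll_\epsilon X^{1/2+\epsilon}Y^2, \] where the sum is over cubic fields up to isomorphism and the implied constant depends only on $C$ (and $\epsilon$).
   Context: For a cubic field $K$ with ring of integers $\mathcal{O}_K$ and discriminant $\Delta(K)$, an element $\alpha\in\mathcal{O}_K$ is reduced if its trace lies in $\{-1,0,1\}$; $|\alpha|_\infty=\max_{v\mid\infty}|\alpha|_v$ (maximum of $|\tau(\alpha)|$ over complex embeddings $\tau$); for $Y>0$, $S_K(Y)$ is the set of reduced $\alpha\in\mathcal{O}_K\setminus\mathbb{Z}$ with $|\alpha|_\infty<Y$. *)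

theory Defs
  imports Complex_Main "HOL-Computational_Algebra.Computational_Algebra"
begin

text \<open>Cubic fields are represented as subfields of the complex numbers of the form
  Q(theta), theta a root of an irreducible rational cubic. Every cubic field is isomorphic
  to such a subfield, and "up to isomorphism" is handled by a quotient.\<close>

definition cubic_field :: "complex set \<Rightarrow> bool" where
  "cubic_field K \<longleftrightarrow> (\<exists>\<theta> (q :: rat poly). degree q = 3 \<and> irreducible q \<and>
      poly (map_poly of_rat q) \<theta> = 0 \<and>
      K = {poly (map_poly of_rat p) \<theta> | p :: rat poly. True})"

definition embeddings :: "complex set \<Rightarrow> (complex \<Rightarrow> complex) set" where
  "embeddings K = {\<tau>. (\<forall>x\<in>K. \<forall>y\<in>K. \<tau> (x + y) = \<tau> x + \<tau> y \<and> \<tau> (x * y) = \<tau> x * \<tau> y)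
      \<and> \<tau> 1 = 1 \<and> (\<forall>x. x \<notin> K \<longrightarrow> \<tau> x = 0)}"

definition algebraic_integer :: "complex \<Rightarrow> bool" where
  "algebraic_integer x \<longleftrightarrow> (\<exists>p :: int poly. lead_coeff p = 1 \<and> poly (map_poly of_int p) x = 0)"

definition ring_of_integers :: "complex set \<Rightarrow> complex set" where
  "ring_of_integers K = {x \<in> K. algebraic_integer x}"

definition trace :: "complex set \<Rightarrow> complex \<Rightarrow> complex" where
  "trace K \<alpha> = (\<Sum>\<tau>\<in>embeddings K. \<tau> \<alpha>)"

definition abs_inf :: "complex set \<Rightarrow> complex \<Rightarrow> real" where
  "abs_inf K \<alpha> = Max ((\<lambda>\<tau>. cmod (\<tau> \<alpha>)) ` embeddings K)"

definition integral_basis :: "complex set \<Rightarrow> complex \<Rightarrow> complex \<Rightarrow> complex \<Rightarrow> bool" where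
  "integral_basis K w1 w2 w3 \<longleftrightarrow> {w1, w2, w3} \<subseteq> ring_of_integers K \<and>
     (\<forall>x\<in>ring_of_integers K. \<exists>!(a :: int \<times> int \<times> int).
        x = of_int (fst a) * w1 + of_int (fst (snd a)) * w2 + of_int (snd (snd a)) * w3)"

definition det3 :: "complex \<Rightarrow> complex \<Rightarrow> complex \<Rightarrow> complex \<Rightarrow> complex \<Rightarrow> complex \<Rightarrow>
                    complex \<Rightarrow> complex \<Rightarrow> complex \<Rightarrow> complex" where
  "det3 a11 a12 a13 a21 a22 a23 a31 a32 a33 =
     a11 * (a22 * a33 - a23 * a32) - a12 * (a21 * a33 - a23 * a31) + a13 * (a21 * a32 - a22 * a31)"

definition discriminant :: "complex set \<Rightarrow> complex" where
  "discriminant K = (THE d. \<exists>w1 w2 w3 t1 t2 t3. integral_basis K w1 w2 w3 \<and>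
      embeddings K = {t1, t2, t3} \<and> distinct [t1, t2, t3] \<and>
      d = (det3 (t1 w1) (t1 w2) (t1 w3) (t2 w1) (t2 w2) (t2 w3) (t3 w1) (t3 w2) (t3 w3))^2)"

definition reduced :: "complex set \<Rightarrow> complex \<Rightarrow> bool" where
  "reduced K \<alpha> \<longleftrightarrow> \<alpha> \<in> ring_of_integers K \<and> trace K \<alpha> \<in> {-1, 0, 1}"

definition S_set :: "complex set \<Rightarrow> real \<Rightarrow> complex set" where
  "S_set K Y = {\<alpha> \<in> ring_of_integers K - \<int>. reduced K \<alpha> \<and> abs_inf K \<alpha> < Y}"

definition field_iso :: "complex set \<Rightarrow> complex set \<Rightarrow> bool" where
  "field_iso K L \<longleftrightarrow> (\<exists>f. bij_betw f K L \<and>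
      (\<forall>x\<in>K. \<forall>y\<in>K. f (x + y) = f x + f y \<and> f (x * y) = f x * f y) \<and> f 1 = 1)"

definition cubic_iso_classes :: "real \<Rightarrow> complex set set set" where
  "cubic_iso_classes X = {K. cubic_field K \<and> cmod (discriminant K) \<le> X}
      // {(K, L). cubic_field K \<and> cubic_field L \<and> field_iso K L}"

end

theory Submission
  imports "Jordan_Normal_Form.Char_Poly" "HOL-Computational_Algebra.Field_as_Ring" Defs
begin

text \<open>Modulo \<open>\<int>\<close> the ring of integers of a cubic field is a lattice of rank 2, and every
  class has exactly one reduced representative. Counting modulo \<open>N\<close> times this lattice, with
  \<open>N\<close> about \<open>Y / (C Z\<^sup>1\<^sup>/\<^sup>4)\<close>, bounds the number of reduced elements of size \<open>Y\<close> by \<open>N\<^sup>2\<close> times the number of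
  those of size about \<open>C Z\<^sup>1\<^sup>/\<^sup>4\<close>; the hypothesis on \<open>C\<close> makes the latter number positive, which absorbs the
  error term. It remains to count elements of size about \<open>Z\<^sup>1\<^sup>/\<^sup>4\<close> in all fields with discriminant
  between \<open>Z / 2\<close> and \<open>Z\<close> together. Up to a multiple \<open>d\<close>, such an element \<open>\<beta>\<close> is part of an integral basis
  \<open>1, \<beta>, (\<beta>\<^sup>2 + u \<beta> + v) / n\<close>. Its characteristic polynomial \<open>f\<close> has discriminant \<open>n\<^sup>2 \<Delta>\<close>, and for
  some integer \<open>s\<close> one has \<open>f'(s) \<equiv> 0\<close> modulo \<open>n\<close> and \<open>f(s) \<equiv> 0\<close> modulo \<open>n\<^sup>2\<close>. For given \<open>n\<close>, \<open>s\<close> and trace this fixes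
  the linear coefficient modulo \<open>n\<close> and the constant coefficient modulo \<open>n\<^sup>2\<close>, while the size of the
  discriminant confines the latter to two intervals of length at most \<open>n Z\<^sup>1\<^sup>/\<^sup>2\<close>. Summing over \<open>s\<close>, \<open>n\<close> and \<open>d\<close>
  gives \<open>O(Z log Z)\<close> elements, and summing over dyadic \<open>Z \<le> 2 X\<close> costs another logarithm.\<close>

section \<open>Algebraic integers\<close>

text \<open>Bounding the elements of each field separately would leave the number of fields to be
  bounded. All fields are counted at once instead: an integral element outside \<open>\<int>\<close>
  determines its field as a subset of the complex numbers, so counting elements counts pairs of
  field and element. The obstacle is the index \<open>n\<close>: it enlarges the discriminant of the
  polynomial and with it the range of the constant coefficient. The congruences repay this. With
  differences of conjugates bounded by \<open>U\<close>, there are \<open>n\<close> choices of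
  \<open>s\<close> modulo \<open>n\<close>, about \<open>U^2 / n\<close> linear and
  \<open>Z^(1/2) / n\<close> constant coefficients, hence \<open>U^2 Z^(1/2) / n\<close> polynomials
  for each \<open>n\<close>, and the sum over \<open>n\<close> is harmonic. Since \<open>n^2\<close>
  times the discriminant of the field is at most \<open>U^6\<close>, a lower bound for that
  discriminant is what bounds \<open>n\<close>; this forces the dyadic ranges. For \<open>U\<close>
  of order at most \<open>Z^(1/4)\<close> the rounding errors of both counts are admissible. A
  multiple \<open>d\<close> lowers \<open>U\<close> to \<open>V / d\<close>, so the sum over
  \<open>d\<close> converges like that of \<open>1 / d^2\<close>.\<close>

lemma algebraic_integer_iff: "algebraic_integer x \<longleftrightarrow> algebraic_int x"
  unfolding algebraic_integer_def algebraic_int_altdef_ipoly by blast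

text \<open>The relations say that the vector \<open>v\<close> is an eigenvector of the integer
  matrix \<open>A\<close> with eigenvalue \<open>x\<close>, and the characteristic polynomial of
  \<open>A\<close> is monic with integer coefficients.\<close>

lemma algebraic_int_eigen_nat:
  fixes x :: complex and v :: "nat \<Rightarrow> complex" and A :: "nat \<Rightarrow> nat \<Rightarrow> int"
  assumes eq: "\<And>i. i < n \<Longrightarrow> x * v i = (\<Sum>j<n. of_int (A i j) * v j)"
    and nz: "i0 < n" "v i0 \<noteq> 0"
  shows "algebraic_int x"
proof -
  define M where "M = mat n n (\<lambda>(i,j). A i j)"
  define Mc where "Mc = (map_mat of_int M :: complex mat)"
  have M: "M \<in> carrier_mat n n" by (simp add: M_def)
  have Mc: "Mc \<in> carrier_mat n n" by (simp add: Mc_def M)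
  have "Mc *\<^sub>v vec n v = x \<cdot>\<^sub>v vec n v"
  proof (rule eq_vecI)
    fix i assume "i < dim_vec (x \<cdot>\<^sub>v vec n v)"
    then have i: "i < n" by simp
    have "vec_index (Mc *\<^sub>v vec n v) i = (\<Sum>j<n. of_int (A i j) * v j)"
      using i by (simp add: Mc_def M_def scalar_prod_def atLeast0LessThan)
    then show "vec_index (Mc *\<^sub>v vec n v) i = vec_index (x \<cdot>\<^sub>v vec n v) i"
      using eq[OF i] i by simp
  qed (simp add: Mc_def M_def)
  moreover have "vec n v \<noteq> 0\<^sub>v n"
    using nz by (metis index_vec index_zero_vec(1))
  ultimately have "eigenvector Mc (vec n v) x"
    using Mc by (simp add: eigenvector_def)
  then have "eigenvalue Mc x" by (auto simp: eigenvalue_def)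
  then have "poly (char_poly Mc) x = 0"
    using eigenvalue_root_char_poly[OF Mc] by simp
  moreover have "char_poly Mc = map_poly of_int (char_poly M)"
    unfolding Mc_def by (rule of_int_hom.char_poly_hom[OF M])
  moreover have "monic (char_poly M)"
    using degree_monic_char_poly[OF M] by simp
  ultimately show ?thesis
    unfolding algebraic_int_altdef_ipoly by metis
qed

lemma algebraic_int_eigen:
  fixes x :: complex and v :: "'i \<Rightarrow> complex" and A :: "'i \<Rightarrow> 'i \<Rightarrow> int"
  assumes "finite I"
    and eq: "\<And>i. i \<in> I \<Longrightarrow> x * v i = (\<Sum>j\<in>I. of_int (A i j) * v j)"
    and nz: "i0 \<in> I" "v i0 \<noteq> 0"
  shows "algebraic_int x"
proof -
  from ex_bij_betw_nat_finite[OF \<open>finite I\<close>]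
  obtain h where h: "bij_betw h {0..<card I} I" by blast
  obtain k where k: "k < card I" "h k = i0"
    using h nz(1) unfolding bij_betw_def by force
  show ?thesis
  proof (rule algebraic_int_eigen_nat[of "card I" x "v \<circ> h" "\<lambda>i j. A (h i) (h j)"])
    fix i assume "i < card I"
    then have "h i \<in> I" using h by (auto simp: bij_betw_def)
    have "(\<Sum>j\<in>I. of_int (A (h i) j) * v j) = (\<Sum>j<card I. of_int (A (h i) (h j)) * v (h j))"
      using sum.reindex_bij_betw[OF h, of "\<lambda>j. of_int (A (h i) j) * v j"]
      by (simp add: atLeast0LessThan)
    then show "x * (v \<circ> h) i = (\<Sum>j<card I. of_int (A (h i) (h j)) * (v \<circ> h) j)"
      using eq[OF \<open>h i \<in> I\<close>] by simp
  qed (use k nz in auto)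
qed

lemma algebraic_int_power_relation:
  fixes x :: complex
  assumes "algebraic_int x"
  obtains m and c :: "nat \<Rightarrow> nat \<Rightarrow> int"
  where "m > 0" "\<And>i. i < m \<Longrightarrow> x * x ^ i = (\<Sum>j<m. of_int (c i j) * x ^ j)"
proof -
  obtain p :: "int poly" where p: "poly (map_poly of_int p) x = 0" "lead_coeff p = 1"
    using assms unfolding algebraic_int_altdef_ipoly by blast
  define m where "m = degree p"
  have "m > 0"
  proof (rule ccontr)
    assume "\<not> m > 0"
    then have "p = 1"
      using p(2) by (metis m_def monic_degree_0 not_gr_zero)
    then show False using p(1) by simp
  qed
  have "poly (map_poly of_int p) x = (\<Sum>i\<le>m. of_int (coeff p i) * x ^ i)"
    unfolding poly_altdef m_def by (simp add: coeff_map_poly)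
  also have "\<dots> = (\<Sum>i<m. of_int (coeff p i) * x ^ i) + x ^ m"
    using p(2) by (simp add: m_def lessThan_Suc_atMost[symmetric])
  finally have top: "x ^ m = (\<Sum>i<m. of_int (- coeff p i) * x ^ i)"
    using p(1) by (simp add: sum_negf add_eq_0_iff)
  \<comment> \<open>\<open>c\<close> is the companion matrix of \<open>p\<close>: multiplication by
    \<open>x\<close> shifts the powers, and only the last row uses the equation.\<close>
  define c where "c = (\<lambda>i j. if i + 1 < m then (if j = i + 1 then 1 else 0) else - coeff p j)"
  show ?thesis
  proof (rule that[of m c])
    fix i assume "i < m"
    show "x * x ^ i = (\<Sum>j<m. of_int (c i j) * x ^ j)"
    proof (cases "i + 1 < m")
      case True
      have "(\<Sum>j<m. of_int (c i j) * x ^ j) = (\<Sum>j<m. if j = i + 1 then x ^ j else 0)"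
        using True by (intro sum.cong) (simp_all add: c_def)
      then show ?thesis using True by simp
    next
      case False
      then have m: "m = Suc i" using \<open>i < m\<close> by simp
      have "x * x ^ i = x ^ m" by (simp only: m power_Suc)
      also have "\<dots> = (\<Sum>j<m. of_int (c i j) * x ^ j)"
        unfolding top c_def using False by (intro sum.cong) simp_all
      finally show ?thesis .
    qed
  qed (fact \<open>m > 0\<close>)
qed

text \<open>The products \<open>x^i * y^j\<close> span a finitely generated module that
  multiplication by \<open>x\<close> and by \<open>y\<close> preserves, hence also multiplication by
  \<open>x + y\<close> and by \<open>x * y\<close>; one module serves for both closure
  properties.\<close>

lemma algebraic_int_common_module:
  fixes x y :: complex
  assumes "algebraic_int x" "algebraic_int y"
  shows "\<exists>(I :: (nat \<times> nat) set) v A B i0. finite I \<and>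
    (\<forall>i\<in>I. x * v i = (\<Sum>j\<in>I. of_int (A i j) * v j)) \<and>
    (\<forall>i\<in>I. y * v i = (\<Sum>j\<in>I. of_int (B i j) * v j)) \<and>
    i0 \<in> I \<and> v i0 \<noteq> 0"
proof -
  obtain m c where m: "m > 0"
    and c: "\<And>i. i < m \<Longrightarrow> x * x ^ i = (\<Sum>j<m. of_int (c i j) * x ^ j)"
    using algebraic_int_power_relation[OF assms(1)] by blast
  obtain n d where n: "n > 0"
    and d: "\<And>i. i < n \<Longrightarrow> y * y ^ i = (\<Sum>j<n. of_int (d i j) * y ^ j)"
    using algebraic_int_power_relation[OF assms(2)] by blast
  define I where "I = {..<m} \<times> {..<n}"
  define v where "v = (\<lambda>(i,j). x ^ i * y ^ j)"
  \<comment> \<open>As matrices on pairs of indices, \<open>A\<close> and \<open>B\<close> are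
    Kronecker products: \<open>c\<close> acts on the first index, \<open>d\<close> on the
    second.\<close>
  define A where "A = (\<lambda>(i::nat,j::nat) (i',j'). if j' = j then c i i' else 0)"
  define B where "B = (\<lambda>(i::nat,j::nat) (i',j'). if i' = i then d j j' else 0)"
  have x: "x * v k = (\<Sum>l\<in>I. of_int (A k l) * v l)"
    and y: "y * v k = (\<Sum>l\<in>I. of_int (B k l) * v l)" if "k \<in> I" for k
  proof -
    from that obtain i j where k: "k = (i, j)" and ij: "i < m" "j < n" by (auto simp: I_def)
    have "(\<Sum>l\<in>I. of_int (A k l) * v l)
        = (\<Sum>i'<m. \<Sum>j'<n. if j' = j then of_int (c i i') * (x ^ i' * y ^ j') else 0)"
      unfolding I_def sum.cartesian_product'
      by (intro sum.cong refl) (simp add: A_def v_def k)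
    also have "\<dots> = (\<Sum>i'<m. of_int (c i i') * x ^ i') * y ^ j"
      using ij by (simp add: sum_distrib_right mult.assoc)
    finally show "x * v k = (\<Sum>l\<in>I. of_int (A k l) * v l)"
      using c[OF ij(1)] by (simp add: v_def k mult.assoc[symmetric])
    have "(\<Sum>l\<in>I. of_int (B k l) * v l)
        = (\<Sum>i'<m. if i' = i then (\<Sum>j'<n. of_int (d j j') * (x ^ i' * y ^ j')) else 0)"
      unfolding I_def sum.cartesian_product'
      by (intro sum.cong refl) (simp add: B_def v_def k)
    also have "\<dots> = (\<Sum>j'<n. of_int (d j j') * y ^ j') * x ^ i"
      using ij by (simp add: sum_distrib_left sum_distrib_right mult_ac)
    finally show "y * v k = (\<Sum>l\<in>I. of_int (B k l) * v l)"
      using d[OF ij(2)] by (simp add: v_def k mult_ac)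
  qed
  have "finite I" "(0,0) \<in> I" "v (0,0) \<noteq> 0" using m n by (auto simp: I_def v_def)
  with x y show ?thesis by blast
qed

lemma algebraic_int_add:
  fixes x y :: complex
  assumes "algebraic_int x" "algebraic_int y"
  shows "algebraic_int (x + y)"
  using algebraic_int_common_module[OF assms]
proof (elim exE conjE)
  fix I :: "(nat \<times> nat) set" and v A B i0
  assume I: "finite I"
    and A: "\<forall>i\<in>I. x * v i = (\<Sum>j\<in>I. of_int (A i j) * v j)"
    and B: "\<forall>i\<in>I. y * v i = (\<Sum>j\<in>I. of_int (B i j) * v j)"
    and i0: "i0 \<in> I" "v i0 \<noteq> 0"
  have "(x + y) * v i = (\<Sum>j\<in>I. of_int (A i j + B i j) * v j)" if "i \<in> I" for i
    using that A B by (simp add: distrib_right sum.distrib)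
  from algebraic_int_eigen[OF I this i0] show ?thesis .
qed

lemma algebraic_int_mult:
  fixes x y :: complex
  assumes "algebraic_int x" "algebraic_int y"
  shows "algebraic_int (x * y)"
  using algebraic_int_common_module[OF assms]
proof (elim exE conjE)
  fix I :: "(nat \<times> nat) set" and v A B i0
  assume I: "finite I"
    and A: "\<forall>i\<in>I. x * v i = (\<Sum>j\<in>I. of_int (A i j) * v j)"
    and B: "\<forall>i\<in>I. y * v i = (\<Sum>j\<in>I. of_int (B i j) * v j)"
    and i0: "i0 \<in> I" "v i0 \<noteq> 0"
  have "x * y * v i = (\<Sum>k\<in>I. of_int (\<Sum>j\<in>I. B i j * A j k) * v k)" if i: "i \<in> I" for i
  proof -
    have "x * y * v i = (\<Sum>j\<in>I. of_int (B i j) * (x * v j))"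
      using B i by (simp add: mult.assoc sum_distrib_left mult.left_commute)
    also have "\<dots> = (\<Sum>j\<in>I. \<Sum>k\<in>I. of_int (B i j * A j k) * v k)"
      using A by (intro sum.cong refl) (simp add: sum_distrib_left mult.assoc)
    also have "\<dots> = (\<Sum>k\<in>I. of_int (\<Sum>j\<in>I. B i j * A j k) * v k)"
      by (subst sum.swap) (simp add: sum_distrib_right)
    finally show ?thesis .
  qed
  from algebraic_int_eigen[OF I this i0] show ?thesis .
qed

lemma algebraic_int_diff:
  fixes x y :: complex
  assumes "algebraic_int x" "algebraic_int y"
  shows "algebraic_int (x - y)"
  using algebraic_int_add[of x "- y"] assms by auto

lemma algebraic_int_power:
  fixes x :: complex
  assumes "algebraic_int x"
  shows "algebraic_int (x ^ k)"
  by (induction k) (auto intro: algebraic_int_mult assms)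

section \<open>Embeddings of a cubic field\<close>

abbreviation rpoly :: "rat poly \<Rightarrow> complex \<Rightarrow> complex" where
  "rpoly p z \<equiv> poly (map_poly of_rat p) z"

lemma rpoly_pCons [simp]: "rpoly (pCons a p) z = of_rat a + z * rpoly p z"
  by (simp add: of_rat_hom.map_poly_pCons_hom)

lemma rpoly_add: "rpoly (p + q) z = rpoly p z + rpoly q z"
  by (induction p q rule: poly_induct2) (simp_all add: of_rat_add algebra_simps)

lemma rpoly_smult: "rpoly (Polynomial.smult a p) z = of_rat a * rpoly p z"
  by (induction p) (simp_all add: of_rat_mult algebra_simps)

lemma rpoly_mult: "rpoly (p * q) z = rpoly p z * rpoly q z"
  by (induction p) (simp_all add: rpoly_add rpoly_smult algebra_simps)

lemma rpoly_diff: "rpoly (p - q) z = rpoly p z - rpoly q z"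
  using rpoly_add[of "p - q" q z] by simp

text \<open>A common root excludes a Bezout relation \<open>u * q + v * h = 1\<close>.\<close>

lemma irreducible_rpoly_dvd:
  assumes "irreducible q" "rpoly q z = 0" "rpoly h z = 0"
  shows "q dvd h"
proof (rule ccontr)
  assume "\<not> q dvd h"
  then have "coprime q h"
    using prime_elem_imp_coprime[OF irreducible_imp_prime_elem[OF assms(1)]] by simp
  then obtain u v where "u * q + v * h = 1"
    using bezout_coefficients_fst_snd[of q h] coprime_iff_gcd_eq_1[of q h] by auto
  then have "rpoly (u * q + v * h) z = 1" by simp
  then show False using assms(2,3) by (simp add: rpoly_add rpoly_mult)
qed

text \<open>Irreducible polynomials are separable in characteristic 0: at a multiple root
  \<open>q\<close> would divide its derivative, which is nonzero and of smaller degree.\<close>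

lemma irreducible_rat_poly_roots:
  assumes "irreducible q" "rpoly q \<theta> = 0"
  shows "finite {z. rpoly q z = 0}" "card {z. rpoly q z = 0} = degree q"
proof -
  have "q \<noteq> 0" using assms(1) by (simp add: irreducible_def)
  have "degree q > 0"
  proof (rule ccontr)
    assume "\<not> degree q > 0"
    then have "degree q = 0" by simp
    then obtain a where "q = [:a:]" by (rule degree_eq_zeroE)
    then show False using assms(2) \<open>q \<noteq> 0\<close> by simp
  qed
  let ?Q = "map_poly of_rat q :: complex poly"
  have deg: "degree ?Q = degree q" by simp
  have "?Q \<noteq> 0" using \<open>q \<noteq> 0\<close> by simp
  then show fin: "finite {z. rpoly q z = 0}" by (rule poly_roots_finite)
  have "rsquarefree ?Q"
    unfolding rsquarefree_roots
  proof (intro allI notI, elim conjE)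
    fix z assume z: "poly ?Q z = 0" "poly (pderiv ?Q) z = 0"
    have "rpoly (pderiv q) z = 0" using z(2) by (simp add: of_rat_hom.map_poly_pderiv)
    then have "q dvd pderiv q" using irreducible_rpoly_dvd assms(1) z(1) by blast
    moreover have "pderiv q \<noteq> 0" using \<open>degree q > 0\<close> by (simp add: pderiv_eq_0_iff)
    ultimately have "degree q \<le> degree (pderiv q)" by (rule dvd_imp_degree_le)
    then show False using \<open>degree q > 0\<close> by (simp add: degree_pderiv)
  qed
  from complex_poly_decompose_rsquarefree[OF this]
  have "?Q = Polynomial.smult (lead_coeff ?Q) (\<Prod>z | poly ?Q z = 0. [:- z, 1:])" by simp
  then have "degree ?Q = degree (\<Prod>z | poly ?Q z = 0. [:- z, 1:])"
    using \<open>?Q \<noteq> 0\<close> by (metis degree_smult_eq leading_coeff_0_iff)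
  also have "\<dots> = card {z. poly ?Q z = 0}"
    by (subst degree_prod_eq_sum_degree) auto
  finally show "card {z. rpoly q z = 0} = degree q" using deg by simp
qed

text \<open>Once these facts are established, the generator and its minimal polynomial can be
  forgotten. The last assumption expresses that a field of prime degree 3 has no proper intermediate
  field: an irrational element generates \<open>K\<close>, so its three conjugates differ.\<close>

locale cubic_embeddings =
  fixes K :: "complex set" and t1 t2 t3 :: "complex \<Rightarrow> complex"
  assumes embeddings_eq: "embeddings K = {t1, t2, t3}"
    and distinct_embeddings: "distinct [t1, t2, t3]"
    and Rats_subset: "x \<in> \<rat> \<Longrightarrow> x \<in> K"
    and add_closed: "x \<in> K \<Longrightarrow> y \<in> K \<Longrightarrow> x + y \<in> K"
    and mult_closed: "x \<in> K \<Longrightarrow> y \<in> K \<Longrightarrow> x * y \<in> K"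
    and trace_rational: "x \<in> K \<Longrightarrow> t1 x + t2 x + t3 x \<in> \<rat>"
    and conjugates_distinct:
      "x \<in> K \<Longrightarrow> x \<notin> \<rat> \<Longrightarrow> t1 x \<noteq> t2 x \<and> t1 x \<noteq> t3 x \<and> t2 x \<noteq> t3 x"

lemma in_embeddingsD:
  assumes "\<tau> \<in> embeddings K"
  shows "x \<in> K \<Longrightarrow> y \<in> K \<Longrightarrow> \<tau> (x + y) = \<tau> x + \<tau> y"
    and "x \<in> K \<Longrightarrow> y \<in> K \<Longrightarrow> \<tau> (x * y) = \<tau> x * \<tau> y"
    and "\<tau> 1 = 1" and "x \<notin> K \<Longrightarrow> \<tau> x = 0"
  using assms by (auto simp: embeddings_def)

lemma embedding_of_rat:
  assumes \<tau>: "\<tau> \<in> embeddings K" and K: "\<rat> \<subseteq> K"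
  shows "\<tau> (of_rat r) = of_rat r"
proof -
  have inK: "of_rat s \<in> K" for s using K by auto
  have one: "\<tau> 1 = 1" by (rule in_embeddingsD(3)[OF \<tau>])
  have add: "\<tau> (of_rat s + of_rat t) = \<tau> (of_rat s) + \<tau> (of_rat t)" for s t
    by (rule in_embeddingsD(1)[OF \<tau> inK inK])
  have mult: "\<tau> (of_rat s * of_rat t) = \<tau> (of_rat s) * \<tau> (of_rat t)" for s t
    by (rule in_embeddingsD(2)[OF \<tau> inK inK])
  have zero: "\<tau> 0 = 0" using add[of 0 0] by simp
  have nat: "\<tau> (of_nat n) = of_nat n" for n
  proof (induction n)
    case (Suc n)
    then show ?case using add[of 1 "of_nat n"] one by simp
  qed (simp add: zero)
  have int: "\<tau> (of_int k) = of_int k" for k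
  proof (cases k rule: int_cases2)
    case (nonneg n)
    then show ?thesis using nat[of n] by simp
  next
    case (nonpos n)
    have "\<tau> (of_int k) + \<tau> (of_nat n) = \<tau> 0"
      using add[of "of_int k" "of_nat n"] nonpos by (simp add: of_rat_minus)
    then show ?thesis using nat[of n] zero nonpos by (simp add: add_eq_0_iff2)
  qed
  obtain a b where ab: "quotient_of r = (a, b)" by (cases "quotient_of r")
  then have b: "b \<noteq> 0" and r: "r = of_int a / of_int b"
    using quotient_of_denom_pos[OF ab] quotient_of_div[OF ab] by auto
  have "of_rat r * of_int b = (of_int a :: complex)" using b by (simp add: r of_rat_divide)
  moreover have "\<tau> (of_rat r * of_int b) = \<tau> (of_rat r) * of_int b"
    using mult[of r "of_int b"] int[of b] by simp
  ultimately have "\<tau> (of_rat r) * of_int b = of_rat r * of_int b" using int[of a] by auto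
  then show ?thesis using b by auto
qed

text \<open>Vieta's formulas by divided differences: the first-order divided differences of the
  monic cubic vanish at any two of the roots, and subtracting two of them leaves the sum of the
  roots plus \<open>a\<close>.\<close>

lemma cubic_root_sums:
  fixes z1 z2 z3 :: complex
  assumes z: "rpoly q z1 = 0" "rpoly q z2 = 0" "rpoly q z3 = 0"
    and d: "z1 \<noteq> z2" "z1 \<noteq> z3" "z2 \<noteq> z3" and q: "degree q = 3"
  shows "z1 + z2 + z3 \<in> \<rat>" "z1 * z2 + z1 * z3 + z2 * z3 \<in> \<rat>"
proof -
  define a b c where "a = (of_rat (coeff q 2 / coeff q 3) :: complex)"
    and "b = (of_rat (coeff q 1 / coeff q 3) :: complex)"
    and "c = (of_rat (coeff q 0 / coeff q 3) :: complex)"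
  have lc: "coeff q 3 \<noteq> 0" using q by (metis degree_0 leading_coeff_0_iff zero_neq_numeral)
  have eq: "z ^ 3 + a * z ^ 2 + b * z + c = 0" if "rpoly q z = 0" for z
  proof -
    have "rpoly q z = (\<Sum>i\<le>3. of_rat (coeff q i) * z ^ i)"
      unfolding poly_altdef using q by (simp add: coeff_map_poly)
    also have "\<dots> = of_rat (coeff q 3) * (z ^ 3 + a * z ^ 2 + b * z + c)"
      using lc by (simp add: eval_nat_numeral a_def b_def c_def of_rat_divide field_simps)
    finally show ?thesis using that lc by simp
  qed
  have diff: "x^2 + x * y + y^2 + a * (x + y) + b = 0"
    if "rpoly q x = 0" "rpoly q y = 0" "x \<noteq> y" for x y
  proof -
    have "(x - y) * (x^2 + x * y + y^2 + a * (x + y) + b)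
        = (x ^ 3 + a * x ^ 2 + b * x + c) - (y ^ 3 + a * y ^ 2 + b * y + c)"
      by (simp add: algebra_simps power2_eq_square power3_eq_cube)
    then show ?thesis using eq that by simp
  qed
  have "(z2 - z3) * (z1 + z2 + z3 + a)
      = (z1^2 + z1 * z2 + z2^2 + a * (z1 + z2) + b) - (z1^2 + z1 * z3 + z3^2 + a * (z1 + z3) + b)"
    by (simp add: algebra_simps power2_eq_square)
  also have "\<dots> = 0" using diff z d by simp
  finally have e1: "z1 + z2 + z3 = - a" using d by (simp add: add_eq_0_iff2)
  then have a: "a = - (z1 + z2 + z3)" by simp
  have "z1 * z2 + z1 * z3 + z2 * z3 = b - (z1^2 + z1 * z2 + z2^2 + a * (z1 + z2) + b)"
    unfolding a by (simp add: algebra_simps power2_eq_square)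
  then have e2: "z1 * z2 + z1 * z3 + z2 * z3 = b" using diff z d by simp
  show "z1 + z2 + z3 \<in> \<rat>" unfolding e1 a_def by simp
  show "z1 * z2 + z1 * z3 + z2 * z3 \<in> \<rat>" unfolding e2 b_def by simp
qed

text \<open>Reduction modulo \<open>q\<close> gives one triple of coefficients for all roots of
  \<open>q\<close> simultaneously, so that conjugation only replaces the root.\<close>

lemma rpoly_quadratic_rep:
  assumes "degree q = 3" "rpoly q z = 0"
  obtains u v w where "\<And>z. rpoly q z = 0 \<Longrightarrow> rpoly p z = of_rat u + of_rat v * z + of_rat w * z^2"
proof -
  define r where "r = p mod q"
  have "q \<noteq> 0" using assms(1) by auto
  then have "degree r \<le> 2"
    using degree_mod_less[of q p] assms(1) unfolding r_def by auto
  then have "rpoly r z = (\<Sum>i\<le>2. of_rat (coeff r i) * z ^ i)" for z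
  proof -
    have "rpoly r z = (\<Sum>i\<le>degree r. of_rat (coeff r i) * z ^ i)"
      unfolding poly_altdef by (simp add: coeff_map_poly)
    also have "\<dots> = (\<Sum>i\<le>2. of_rat (coeff r i) * z ^ i)"
      using \<open>degree r \<le> 2\<close> by (intro sum.mono_neutral_left) (auto simp: coeff_eq_0)
    finally show ?thesis .
  qed
  then have r: "rpoly r z = of_rat (coeff r 0) + of_rat (coeff r 1) * z + of_rat (coeff r 2) * z^2" for z
    by (simp add: eval_nat_numeral)
  have "rpoly p z = rpoly r z" if "rpoly q z = 0" for z
  proof -
    have "p = p div q * q + r" by (simp add: r_def)
    then have "rpoly p z = rpoly (p div q * q + r) z" by simp
    then show ?thesis using that by (simp add: rpoly_add rpoly_mult)
  qed
  with r show ?thesis using that by metis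
qed

lemma cubic_field_embeddings:
  assumes "cubic_field K"
  obtains t1 t2 t3 where "cubic_embeddings K t1 t2 t3"
proof -
  obtain \<theta> and q :: "rat poly" where q: "degree q = 3" "irreducible q" and \<theta>: "rpoly q \<theta> = 0"
    and K: "K = {rpoly p \<theta> | p. True}"
    using assms unfolding cubic_field_def by blast
  define R where "R = {z. rpoly q z = 0}"
  have "card R = 3" using irreducible_rat_poly_roots[OF q(2) \<theta>] q(1) by (simp add: R_def)
  then obtain z1 z2 z3 where R: "R = {z1, z2, z3}" and z: "z1 \<noteq> z2" "z1 \<noteq> z3" "z2 \<noteq> z3"
    by (metis card_3_iff)
  have root: "rpoly q z1 = 0" "rpoly q z2 = 0" "rpoly q z3 = 0"
    using R unfolding R_def by auto
  have irrat: "z \<notin> \<rat>" if "rpoly q z = 0" for z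
  proof
    assume "z \<in> \<rat>"
    then obtain r where r: "z = of_rat r" by (auto simp: Rats_def)
    then have "rpoly [:-r, 1:] z = 0" by (simp add: of_rat_minus)
    then have "q dvd [:-r, 1:]" using irreducible_rpoly_dvd q(2) that by blast
    then have "degree q \<le> degree [:-r, 1:]" by (rule dvd_imp_degree_le) simp
    then show False using q(1) by simp
  qed
  \<comment> \<open>The value at \<open>\<theta>\<close> does not determine \<open>p\<close>, but
    two choices differ by a multiple of \<open>q\<close>, which vanishes at every root.\<close>
  have welldef: "rpoly p z = rpoly p' z" if "rpoly p \<theta> = rpoly p' \<theta>" "z \<in> R" for p p' z
  proof -
    have "rpoly (p - p') \<theta> = 0" using that by (simp add: rpoly_diff)
    then have "q dvd p - p'" using irreducible_rpoly_dvd q(2) \<theta> by blast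
    then obtain k where "p - p' = q * k" ..
    then have "rpoly (p - p') z = 0" using that(2) by (simp add: rpoly_mult R_def)
    then show ?thesis by (simp add: rpoly_diff)
  qed
  define \<tau> where "\<tau> z = (\<lambda>x. if x \<in> K then rpoly (SOME p. x = rpoly p \<theta>) z else 0)" for z
  have inK: "rpoly p \<theta> \<in> K" for p unfolding K by blast
  have \<tau>: "\<tau> z (rpoly p \<theta>) = rpoly p z" if "z \<in> R" for p z
  proof -
    have "rpoly p \<theta> = rpoly (SOME p'. rpoly p \<theta> = rpoly p' \<theta>) \<theta>" by (rule someI) (rule refl)
    from welldef[OF this that] show ?thesis using inK by (simp add: \<tau>_def)
  qed
  have Rats: "\<rat> \<subseteq> K"
  proof
    fix x :: complex assume "x \<in> \<rat>"
    then obtain r where "x = of_rat r" by (auto simp: Rats_def)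
    then show "x \<in> K" using inK[of "[:r:]"] by simp
  qed
  have repK: "\<exists>p. x = rpoly p \<theta>" if "x \<in> K" for x
    using that unfolding K by (rule CollectE)  simp
  have add: "x + y \<in> K" if "x \<in> K" "y \<in> K" for x y
    using repK[OF that(1)] repK[OF that(2)] inK rpoly_add by metis
  have mult: "x * y \<in> K" if "x \<in> K" "y \<in> K" for x y
    using repK[OF that(1)] repK[OF that(2)] inK rpoly_mult by metis
  have \<tau>_emb: "\<tau> z \<in> embeddings K" if z: "z \<in> R" for z
  proof -
    have "\<tau> z (x + y) = \<tau> z x + \<tau> z y \<and> \<tau> z (x * y) = \<tau> z x * \<tau> z y" if "x \<in> K" "y \<in> K" for x y
    proof -
      obtain p p' where x: "x = rpoly p \<theta>" and y: "y = rpoly p' \<theta>" using repK \<open>x \<in> K\<close> \<open>y \<in> K\<close> by metis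
      have "\<tau> z (rpoly (p + p') \<theta>) = \<tau> z x + \<tau> z y" "\<tau> z (rpoly (p * p') \<theta>) = \<tau> z x * \<tau> z y"
        unfolding x y \<tau>[OF z] by (simp_all add: rpoly_add rpoly_mult)
      then show ?thesis by (simp add: x y rpoly_add rpoly_mult)
    qed
    moreover have "\<tau> z 1 = 1" using \<tau>[OF z, of 1] by simp
    ultimately show ?thesis by (auto simp: embeddings_def \<tau>_def)
  qed
  \<comment> \<open>An embedding fixes the rationals, so it is determined by the image of
    \<open>\<theta>\<close>, which is again a root of \<open>q\<close>; hence there are no
    embeddings besides the \<open>\<tau> z\<close>.\<close>
  have emb_\<tau>: "\<exists>z\<in>R. \<sigma> = \<tau> z" if \<sigma>: "\<sigma> \<in> embeddings K" for \<sigma>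
  proof -
    have \<theta>K: "\<theta> \<in> K" using inK[of "[:0, 1:]"] by simp
    have rp: "\<sigma> (rpoly p \<theta>) = rpoly p (\<sigma> \<theta>)" for p
    proof (induction p)
      case 0
      then show ?case using embedding_of_rat[OF \<sigma> Rats, of 0] by simp
    next
      case (pCons a p)
      have "of_rat a \<in> K" using Rats by auto
      then have "\<sigma> (of_rat a + \<theta> * rpoly p \<theta>) = \<sigma> (of_rat a) + \<sigma> \<theta> * \<sigma> (rpoly p \<theta>)"
        using in_embeddingsD(1,2)[OF \<sigma>] \<theta>K inK mult by simp
      then show ?case using pCons embedding_of_rat[OF \<sigma> Rats] by simp
    qed
    have "rpoly q (\<sigma> \<theta>) = 0"
      using rp[of q] \<theta> embedding_of_rat[OF \<sigma> Rats, of 0] by simp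
    then have "\<sigma> \<theta> \<in> R" by (simp add: R_def)
    moreover have "\<sigma> x = \<tau> (\<sigma> \<theta>) x" for x
    proof (cases "x \<in> K")
      case True
      then obtain p where "x = rpoly p \<theta>" using repK by blast
      then show ?thesis using rp \<tau>[OF \<open>\<sigma> \<theta> \<in> R\<close>] by simp
    next
      case False
      then show ?thesis using in_embeddingsD(4)[OF \<sigma>] by (simp add: \<tau>_def)
    qed
    ultimately show ?thesis by blast
  qed
  have emb: "embeddings K = {\<tau> z1, \<tau> z2, \<tau> z3}" using \<tau>_emb emb_\<tau> R by auto
  have \<tau>_\<theta>: "\<tau> z \<theta> = z" if "z \<in> R" for z using \<tau>[OF that, of "[:0, 1:]"] by simp
  have dist: "distinct [\<tau> z1, \<tau> z2, \<tau> z3]"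
    using z \<tau>_\<theta>[of z1] \<tau>_\<theta>[of z2] \<tau>_\<theta>[of z3] R by auto
  note e = cubic_root_sums[OF root z q(1)]
  have rep: "\<exists>u v w. x = of_rat u + of_rat v * \<theta> + of_rat w * \<theta>^2
      \<and> (\<forall>z\<in>R. \<tau> z x = of_rat u + of_rat v * z + of_rat w * z^2)" if "x \<in> K" for x
  proof -
    obtain p where p: "x = rpoly p \<theta>" using repK[OF \<open>x \<in> K\<close>] by blast
    obtain u v w where "\<And>z. rpoly q z = 0 \<Longrightarrow> rpoly p z = of_rat u + of_rat v * z + of_rat w * z^2"
      using rpoly_quadratic_rep[OF q(1) \<theta>] by metis
    then have uvw: "rpoly p z = of_rat u + of_rat v * z + of_rat w * z^2" if "z \<in> R" for z
      using that by (simp add: R_def)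
    have "\<theta> \<in> R" using \<theta> by (simp add: R_def)
    have "x = of_rat u + of_rat v * \<theta> + of_rat w * \<theta>^2" using uvw[OF \<open>\<theta> \<in> R\<close>] p by simp
    moreover have "\<tau> z x = of_rat u + of_rat v * z + of_rat w * z^2" if "z \<in> R" for z
      using uvw[OF that] \<tau>[OF that] p by simp
    ultimately show ?thesis by blast
  qed
  have "cubic_embeddings K (\<tau> z1) (\<tau> z2) (\<tau> z3)"
  proof
    show "embeddings K = {\<tau> z1, \<tau> z2, \<tau> z3}" "distinct [\<tau> z1, \<tau> z2, \<tau> z3]" by fact+
    show "x \<in> K" if "x \<in> \<rat>" for x using that Rats by auto
    show "x + y \<in> K" "x * y \<in> K" if "x \<in> K" "y \<in> K" for x y using that add mult by auto
  next
    fix x assume "x \<in> K"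
    then obtain u v w where x: "x = of_rat u + of_rat v * \<theta> + of_rat w * \<theta>^2"
      and \<tau>x: "\<forall>z\<in>R. \<tau> z x = of_rat u + of_rat v * z + of_rat w * z^2"
      using rep by blast
    have \<tau>x: "\<tau> z1 x = of_rat u + of_rat v * z1 + of_rat w * z1^2"
      "\<tau> z2 x = of_rat u + of_rat v * z2 + of_rat w * z2^2"
      "\<tau> z3 x = of_rat u + of_rat v * z3 + of_rat w * z3^2"
      using \<tau>x R by auto
    have "\<tau> z1 x + \<tau> z2 x + \<tau> z3 x = 3 * of_rat u + of_rat v * (z1 + z2 + z3)
        + of_rat w * ((z1 + z2 + z3)^2 - 2 * (z1 * z2 + z1 * z3 + z2 * z3))"
      unfolding \<tau>x by (simp add: algebra_simps power2_eq_square)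
    also have "\<dots> \<in> \<rat>" by (rule Rats_add[OF Rats_add[OF _ Rats_mult[OF _ e(1)]]
            Rats_mult[OF _ Rats_diff[OF Rats_power[OF e(1)] Rats_mult[OF _ e(2)]]]]) auto
    finally show "\<tau> z1 x + \<tau> z2 x + \<tau> z3 x \<in> \<rat>" .
    assume "x \<notin> \<rat>"
    \<comment> \<open>Equality at two roots \<open>a\<close> and \<open>b\<close> gives
      \<open>v + w * (a + b) = 0\<close>. As \<open>a + b\<close> is the rational sum of the roots
      minus the third root \<open>c\<close>, the case \<open>w \<noteq> 0\<close> would make
      \<open>c\<close> rational, and \<open>w = 0\<close> would make \<open>x\<close>
      rational.\<close>
    have *: "of_rat u + of_rat v * a + of_rat w * a^2 \<noteq> of_rat u + of_rat v * b + of_rat w * b^2"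
      if "a \<noteq> b" "a + b + c = z1 + z2 + z3" "rpoly q c = 0" for a b c
    proof
      assume "of_rat u + of_rat v * a + of_rat w * a^2 = of_rat u + of_rat v * b + of_rat w * b^2"
      then have "(a - b) * (of_rat v + of_rat w * (a + b)) = 0"
        by (simp add: algebra_simps power2_eq_square)
      moreover have "a + b = z1 + z2 + z3 - c" using that(2) by (simp add: eq_diff_eq)
      ultimately have *: "of_rat v + of_rat w * (z1 + z2 + z3 - c) = 0" using that(1) by simp
      show False
      proof (cases "w = 0")
        case True
        then have "v = 0" using * by simp
        then show False using True x \<open>x \<notin> \<rat>\<close> by simp
      next
        case False
        have solve: "y = e + v' / w'" if "v' + w' * (e - y) = 0" "w' \<noteq> 0" for v' w' e y :: complex
          using that by (simp add: field_simps)
        have "c = z1 + z2 + z3 + of_rat v / of_rat w" using solve[OF *] False by simp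
        also have "\<dots> \<in> \<rat>" using Rats_add[OF e(1)] by simp
        finally show False using irrat that(3) by blast
      qed
    qed
    show "\<tau> z1 x \<noteq> \<tau> z2 x \<and> \<tau> z1 x \<noteq> \<tau> z3 x \<and> \<tau> z2 x \<noteq> \<tau> z3 x"
      unfolding \<tau>x using *[OF z(1) _ root(3)] *[OF z(2) _ root(2)] *[OF z(3) _ root(1)]
      by (intro conjI) (simp_all only: add_ac simp_thms not_False_eq_True)
  qed
  then show ?thesis by (rule that)
qed

section \<open>Traces and coordinates\<close>

context cubic_embeddings
begin

lemma embs: "t1 \<in> embeddings K" "t2 \<in> embeddings K" "t3 \<in> embeddings K"
  using embeddings_eq by auto

lemma of_rat_in [simp]: "of_rat r \<in> K"
  by (rule Rats_subset) simp

lemma of_int_in [simp]: "of_int k \<in> K"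
  by (rule Rats_subset) simp

lemma one_in [simp]: "1 \<in> K" and zero_in [simp]: "0 \<in> K" and numeral_in [simp]: "numeral m \<in> K"
  by (rule Rats_subset; simp)+

declare add_closed [simp] mult_closed [simp]

lemma uminus_closed [simp]: "x \<in> K \<Longrightarrow> - x \<in> K"
  using mult_closed[of "of_int (-1)" x] of_int_in[of "-1"] by simp

lemma diff_closed [simp]: "x \<in> K \<Longrightarrow> y \<in> K \<Longrightarrow> x - y \<in> K"
  using add_closed[of x "- y"] by simp

lemma power_closed [simp]: "x \<in> K \<Longrightarrow> x ^ n \<in> K"
  by (induction n) auto

lemma emb_of_rat:
  assumes "\<tau> \<in> embeddings K"
  shows "\<tau> (of_rat r) = of_rat r"
  using embedding_of_rat[OF assms] Rats_subset by blast

lemma emb_of_int: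
  assumes "\<tau> \<in> embeddings K"
  shows "\<tau> (of_int k) = of_int k"
  using emb_of_rat[OF assms, of "of_int k"] by simp

lemma emb_uminus:
  assumes \<tau>: "\<tau> \<in> embeddings K" and "x \<in> K"
  shows "\<tau> (- x) = - \<tau> x"
  using in_embeddingsD(2)[OF \<tau>, of "of_int (-1)" x] emb_of_int[OF \<tau>, of "-1"] assms(2)
    of_int_in[of "-1"] by simp

lemma emb_diff:
  assumes \<tau>: "\<tau> \<in> embeddings K" and "x \<in> K" "y \<in> K"
  shows "\<tau> (x - y) = \<tau> x - \<tau> y"
  using in_embeddingsD(1)[OF \<tau>, of x "- y"] emb_uminus[OF \<tau>, of y] assms by simp

lemma emb_power:
  assumes \<tau>: "\<tau> \<in> embeddings K" and "x \<in> K"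
  shows "\<tau> (x ^ n) = \<tau> x ^ n"
  by (induction n) (use in_embeddingsD(2,3)[OF \<tau>] assms in simp_all)

lemma emb_numeral:
  assumes "\<tau> \<in> embeddings K"
  shows "\<tau> (numeral m) = numeral m"
  using emb_of_int[OF assms, of "numeral m"] by simp

lemma emb_zero:
  assumes "\<tau> \<in> embeddings K"
  shows "\<tau> 0 = 0"
  using emb_of_int[OF assms, of 0] by simp

lemmas emb_simps [simp] =
  in_embeddingsD(1)[OF embs(1)] in_embeddingsD(1)[OF embs(2)] in_embeddingsD(1)[OF embs(3)]
  in_embeddingsD(2)[OF embs(1)] in_embeddingsD(2)[OF embs(2)] in_embeddingsD(2)[OF embs(3)]
  in_embeddingsD(3)[OF embs(1)] in_embeddingsD(3)[OF embs(2)] in_embeddingsD(3)[OF embs(3)]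
  emb_of_int[OF embs(1)] emb_of_int[OF embs(2)] emb_of_int[OF embs(3)]
  emb_of_rat[OF embs(1)] emb_of_rat[OF embs(2)] emb_of_rat[OF embs(3)]
  emb_uminus[OF embs(1)] emb_uminus[OF embs(2)] emb_uminus[OF embs(3)]
  emb_diff[OF embs(1)] emb_diff[OF embs(2)] emb_diff[OF embs(3)]
  emb_power[OF embs(1)] emb_power[OF embs(2)] emb_power[OF embs(3)]
  emb_numeral[OF embs(1)] emb_numeral[OF embs(2)] emb_numeral[OF embs(3)]
  emb_zero[OF embs(1)] emb_zero[OF embs(2)] emb_zero[OF embs(3)]

text \<open>Since \<open>K\<close> is a set of complex numbers, its inclusion, extended by 0, is one
  of the three embeddings. This allows identities in \<open>K\<close> to be checked on
  conjugates.\<close>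

lemma self_conjugate:
  assumes "x \<in> K"
  shows "x \<in> {t1 x, t2 x, t3 x}"
proof -
  have "(\<lambda>x. if x \<in> K then x else 0) \<in> embeddings K"
    by (simp add: embeddings_def)
  then show ?thesis using assms by (auto simp: embeddings_eq dest: fun_cong[of _ _ x])
qed

lemma conjugates_eqI:
  assumes "x \<in> K" "y \<in> K" "t1 x = t1 y" "t2 x = t2 y" "t3 x = t3 y"
  shows "x = y"
  using self_conjugate[of "x - y"] assms by simp

abbreviation ints :: "complex set" where "ints \<equiv> ring_of_integers K"

lemma ints_iff: "x \<in> ints \<longleftrightarrow> x \<in> K \<and> algebraic_int x"
  by (simp add: ring_of_integers_def algebraic_integer_iff)

lemma ints_in [simp]: "x \<in> ints \<Longrightarrow> x \<in> K"
  by (simp add: ints_iff)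

lemma ints_add [simp]: "x \<in> ints \<Longrightarrow> y \<in> ints \<Longrightarrow> x + y \<in> ints"
  and ints_diff [simp]: "x \<in> ints \<Longrightarrow> y \<in> ints \<Longrightarrow> x - y \<in> ints"
  and ints_mult [simp]: "x \<in> ints \<Longrightarrow> y \<in> ints \<Longrightarrow> x * y \<in> ints"
  and ints_power [simp]: "x \<in> ints \<Longrightarrow> x ^ k \<in> ints"
  and ints_uminus [simp]: "x \<in> ints \<Longrightarrow> - x \<in> ints"
  and ints_of_int [simp]: "of_int m \<in> ints"
  by (auto simp: ints_iff intro: algebraic_int_add algebraic_int_diff algebraic_int_mult
      algebraic_int_power)

lemma ints_numeral [simp]: "numeral m \<in> ints" and ints_1 [simp]: "1 \<in> ints"
  using ints_of_int[of "numeral m"] ints_of_int[of 1] by simp_all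

lemma emb_algebraic_int:
  assumes \<tau>: "\<tau> \<in> embeddings K" and x: "x \<in> ints"
  shows "algebraic_int (\<tau> x)"
proof -
  obtain p :: "int poly" where p: "poly (map_poly of_int p) x = 0" "lead_coeff p = 1"
    using x unfolding ints_iff algebraic_int_altdef_ipoly by blast
  have "poly (map_poly of_int p) x \<in> K \<and>
      \<tau> (poly (map_poly of_int p) x) = poly (map_poly of_int p) (\<tau> x)"
    by (induction p)
      (use x in_embeddingsD(1,2)[OF \<tau>] emb_of_int[OF \<tau>] emb_zero[OF \<tau>] in simp_all)
  then have "poly (map_poly of_int p) (\<tau> x) = 0" using p(1) emb_zero[OF \<tau>] by simp
  then show ?thesis using p(2) unfolding algebraic_int_altdef_ipoly by blast
qed

lemma Ints_iff_ints_Rats: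
  assumes "x \<in> ints"
  shows "x \<in> \<int> \<longleftrightarrow> x \<in> \<rat>"
  using assms rational_algebraic_int_is_int[of x] Ints_subset_Rats by (auto simp: ints_iff)

section \<open>Symmetric functions of the conjugates\<close>

definition tr where "tr x = t1 x + t2 x + t3 x"
definition sym2 where "sym2 x = t1 x * t2 x + t1 x * t3 x + t2 x * t3 x"
definition field_norm where "field_norm x = t1 x * t2 x * t3 x"
text \<open>The sign depends on the order of the embeddings; the square is the discriminant of the
  characteristic polynomial.\<close>

definition vandermonde where "vandermonde x = (t1 x - t2 x) * (t1 x - t3 x) * (t2 x - t3 x)"

lemma trace_eq: "trace K x = tr x"
  using distinct_embeddings by (simp add: trace_def tr_def embeddings_eq add.assoc)

lemma tr_Rats: "x \<in> K \<Longrightarrow> tr x \<in> \<rat>"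
  unfolding tr_def by (rule trace_rational)

lemma tr_Ints: "x \<in> ints \<Longrightarrow> tr x \<in> \<int>"
  using tr_Rats[of x] rational_algebraic_int_is_int[of "tr x"] emb_algebraic_int embs
  by (auto simp: tr_def intro!: algebraic_int_add)

text \<open>The locale provides rational traces, so rationality comes from Newton's identities
  between power sums and elementary symmetric functions, while integrality comes from the
  conjugates. The norm is treated in the same way, with cubes.\<close>

lemma sym2_Ints:
  assumes "x \<in> ints"
  shows "sym2 x \<in> \<int>"
proof -
  have "algebraic_int (sym2 x)" unfolding sym2_def
    by (intro algebraic_int_add algebraic_int_mult emb_algebraic_int embs assms)
  moreover have eq: "sym2 x = (tr x ^ 2 - tr (x ^ 2)) / 2"
    using assms by (simp add: sym2_def tr_def power2_eq_square algebra_simps)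
  have "sym2 x \<in> \<rat>"
    by (subst eq, intro Rats_divide Rats_diff Rats_power tr_Rats) (use assms in auto)
  ultimately show ?thesis using rational_algebraic_int_is_int by blast
qed

lemma field_norm_Ints:
  assumes "x \<in> ints"
  shows "field_norm x \<in> \<int>"
proof -
  have "algebraic_int (field_norm x)" unfolding field_norm_def
    by (intro algebraic_int_add algebraic_int_mult emb_algebraic_int embs assms)
  moreover have eq: "field_norm x = (tr (x ^ 3) - tr x * tr (x ^ 2) + sym2 x * tr x) / 3"
    using assms by (simp add: field_norm_def sym2_def tr_def power2_eq_square power3_eq_cube algebra_simps)
  have "sym2 x \<in> \<rat>" using sym2_Ints[OF assms] Ints_subset_Rats by blast
  then have "field_norm x \<in> \<rat>"
    unfolding eq by (intro Rats_divide Rats_diff Rats_add Rats_mult tr_Rats) (use assms in auto)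
  ultimately show ?thesis using rational_algebraic_int_is_int by blast
qed

lemma cubic_equation:
  assumes "x \<in> K"
  shows "x ^ 3 - tr x * x ^ 2 + sym2 x * x - field_norm x = 0"
proof -
  have "x ^ 3 - tr x * x ^ 2 + sym2 x * x - field_norm x = (x - t1 x) * (x - t2 x) * (x - t3 x)"
    by (simp add: tr_def sym2_def field_norm_def power2_eq_square power3_eq_cube algebra_simps)
  then show ?thesis using self_conjugate[OF assms] by auto
qed

lemma vandermonde_square:
  "vandermonde x ^ 2 = tr x ^ 2 * sym2 x ^ 2 - 4 * sym2 x ^ 3 - 4 * tr x ^ 3 * field_norm x
     + 18 * tr x * sym2 x * field_norm x - 27 * field_norm x ^ 2"
  unfolding vandermonde_def tr_def sym2_def field_norm_def
  by (simp add: power2_eq_square power3_eq_cube algebra_simps)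

lemma conjugates_distinct_ints:
  assumes "x \<in> ints" "x \<notin> \<int>"
  shows "t1 x \<noteq> t2 x" "t1 x \<noteq> t3 x" "t2 x \<noteq> t3 x"
  using conjugates_distinct[of x] Ints_iff_ints_Rats[OF assms(1)] assms by auto

lemma vandermonde_nonzero: "x \<in> ints \<Longrightarrow> x \<notin> \<int> \<Longrightarrow> vandermonde x \<noteq> 0"
  using conjugates_distinct_ints[of x] by (simp add: vandermonde_def)

lemma vandermonde_square_Ints: "x \<in> ints \<Longrightarrow> vandermonde x ^ 2 \<in> \<int>"
  unfolding vandermonde_square using tr_Ints[of x] sym2_Ints[of x] field_norm_Ints[of x] by simp

text \<open>The coefficients come from Lagrange interpolation at the conjugates of \<open>\<alpha>\<close>,
  whose numerators are traces.\<close>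

lemma power_basis_coordinates:
  assumes \<alpha>: "\<alpha> \<in> ints" and x: "x \<in> K"
  obtains y0 y1 y2 where "y0 \<in> ints" "y1 \<in> ints" "y2 \<in> ints"
    "vandermonde \<alpha> ^ 2 * x = tr (x * y0) + tr (x * y1) * \<alpha> + tr (x * y2) * \<alpha> ^ 2"
proof -
  obtain e1 where e1: "tr \<alpha> = of_int e1" using tr_Ints[OF \<alpha>] by (auto elim: Ints_cases)
  obtain e2 where e2: "sym2 \<alpha> = of_int e2" using sym2_Ints[OF \<alpha>] by (auto elim: Ints_cases)
  \<comment> \<open>For the characteristic polynomial \<open>f\<close>, the first factor is
    \<open>f'(\<alpha>)\<close> and the second the squared difference of the other two conjugates,
    so \<open>y2\<close> is the discriminant of \<open>f\<close> divided by
    \<open>f'(\<alpha>)\<close>, written without division. \<open>y1\<close> and \<open>y0\<close>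
    multiply it by the lower coefficients of \<open>f(X) / (X - \<alpha>)\<close>.\<close>
  define y2 where "y2 = (3 * \<alpha>^2 - 2 * of_int e1 * \<alpha> + of_int e2) *
    (of_int e1 ^ 2 - 4 * of_int e2 + 2 * of_int e1 * \<alpha> - 3 * \<alpha>^2)"
  define y1 where "y1 = - (y2 * (of_int e1 - \<alpha>))"
  define y0 where "y0 = y2 * (of_int e2 - \<alpha> * (of_int e1 - \<alpha>))"
  have y: "y0 \<in> ints" "y1 \<in> ints" "y2 \<in> ints" using \<alpha> by (simp_all add: y0_def y1_def y2_def)
  define a b c where "a = t1 \<alpha>" and "b = t2 \<alpha>" and "c = t3 \<alpha>"
  note abc = a_def[symmetric] b_def[symmetric] c_def[symmetric]
  have e1': "of_int e1 = a + b + c" and e2': "of_int e2 = a * b + a * c + b * c"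
    using e1 e2 by (simp_all add: tr_def sym2_def abc)
  have y2': "t1 y2 = (a - b) * (a - c) * (b - c)^2" "t2 y2 = (b - a) * (b - c) * (a - c)^2"
    "t3 y2 = (c - a) * (c - b) * (a - b)^2"
    using \<alpha> unfolding y2_def
    by (simp_all add: abc) (simp_all add: e1' e2' power2_eq_square algebra_simps)
  have y1': "t1 y1 = - (t1 y2 * (b + c))" "t2 y1 = - (t2 y2 * (a + c))" "t3 y1 = - (t3 y2 * (a + b))"
    using \<alpha> y unfolding y1_def by (simp_all add: abc) (simp_all add: e1')
  have y0': "t1 y0 = t1 y2 * (b * c)" "t2 y0 = t2 y2 * (a * c)" "t3 y0 = t3 y2 * (a * b)"
    using \<alpha> y unfolding y0_def by (simp_all add: abc) (simp_all add: e1' e2' algebra_simps)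
  have interp: "tr (x * y0) + tr (x * y1) * s + tr (x * y2) * s^2
      = t1 x * t1 y2 * ((s - b) * (s - c)) + t2 x * t2 y2 * ((s - a) * (s - c))
        + t3 x * t3 y2 * ((s - a) * (s - b))" for s
    using x y unfolding tr_def by (simp add: y0' y1') (simp add: power2_eq_square algebra_simps)
  have D: "vandermonde \<alpha> ^ 2 = ((a - b) * (a - c) * (b - c))^2" by (simp add: vandermonde_def abc)
  have "vandermonde \<alpha> ^ 2 * x = tr (x * y0) + tr (x * y1) * \<alpha> + tr (x * y2) * \<alpha> ^ 2"
  proof (rule conjugates_eqI)
    obtain D where D': "vandermonde \<alpha> ^ 2 = of_int D" using vandermonde_square_Ints[OF \<alpha>] by (auto elim: Ints_cases)
    obtain r0 where r0: "tr (x * y0) = of_rat r0"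
      using tr_Rats[of "x * y0"] x y by (auto elim: Rats_cases)
    obtain r1 where r1: "tr (x * y1) = of_rat r1"
      using tr_Rats[of "x * y1"] x y by (auto elim: Rats_cases)
    obtain r2 where r2: "tr (x * y2) = of_rat r2"
      using tr_Rats[of "x * y2"] x y by (auto elim: Rats_cases)
    note r = D' r0 r1 r2
    show "vandermonde \<alpha> ^ 2 * x \<in> K" using x by (simp add: D')
    show "tr (x * y0) + tr (x * y1) * \<alpha> + tr (x * y2) * \<alpha> ^ 2 \<in> K" using \<alpha> by (simp add: r)
    have "t1 (vandermonde \<alpha> ^ 2 * x) = vandermonde \<alpha> ^ 2 * t1 x" "t2 (vandermonde \<alpha> ^ 2 * x) = vandermonde \<alpha> ^ 2 * t2 x"
      "t3 (vandermonde \<alpha> ^ 2 * x) = vandermonde \<alpha> ^ 2 * t3 x"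
      using x by (simp_all add: D')
    moreover have "t1 (tr (x * y0) + tr (x * y1) * \<alpha> + tr (x * y2) * \<alpha> ^ 2)
          = tr (x * y0) + tr (x * y1) * a + tr (x * y2) * a ^ 2"
      "t2 (tr (x * y0) + tr (x * y1) * \<alpha> + tr (x * y2) * \<alpha> ^ 2)
          = tr (x * y0) + tr (x * y1) * b + tr (x * y2) * b ^ 2"
      "t3 (tr (x * y0) + tr (x * y1) * \<alpha> + tr (x * y2) * \<alpha> ^ 2)
          = tr (x * y0) + tr (x * y1) * c + tr (x * y2) * c ^ 2"
      using \<alpha> by (simp_all add: r abc)
    ultimately show
      "t1 (vandermonde \<alpha> ^ 2 * x) = t1 (tr (x * y0) + tr (x * y1) * \<alpha> + tr (x * y2) * \<alpha> ^ 2)"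
      "t2 (vandermonde \<alpha> ^ 2 * x) = t2 (tr (x * y0) + tr (x * y1) * \<alpha> + tr (x * y2) * \<alpha> ^ 2)"
      "t3 (vandermonde \<alpha> ^ 2 * x) = t3 (tr (x * y0) + tr (x * y1) * \<alpha> + tr (x * y2) * \<alpha> ^ 2)"
      unfolding interp D by (simp_all add: y2' power2_eq_square mult_ac) (simp_all add: algebra_simps)
  qed
  with y show ?thesis by (rule that)
qed

text \<open>The right-hand side mentions only \<open>\<alpha>\<close>; this is how a field is
  recovered from a single one of its elements.\<close>

lemma field_eq_span:
  assumes \<alpha>: "\<alpha> \<in> ints" "\<alpha> \<notin> \<int>"
  shows "K = {of_rat a + of_rat b * \<alpha> + of_rat c * \<alpha> ^ 2 | a b c. True}"
proof (intro equalityI subsetI)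
  fix x assume x: "x \<in> K"
  obtain y0 y1 y2 where y: "y0 \<in> ints" "y1 \<in> ints" "y2 \<in> ints"
    and eq: "vandermonde \<alpha> ^ 2 * x = tr (x * y0) + tr (x * y1) * \<alpha> + tr (x * y2) * \<alpha> ^ 2"
    using power_basis_coordinates[OF \<alpha>(1) x] .
  obtain D where D: "vandermonde \<alpha> ^ 2 = of_int D" using vandermonde_square_Ints[OF \<alpha>(1)] by (auto elim: Ints_cases)
  obtain r0 where r0: "tr (x * y0) = of_rat r0"
    using tr_Rats[of "x * y0"] x y by (auto elim: Rats_cases)
  obtain r1 where r1: "tr (x * y1) = of_rat r1"
    using tr_Rats[of "x * y1"] x y by (auto elim: Rats_cases)
  obtain r2 where r2: "tr (x * y2) = of_rat r2"
    using tr_Rats[of "x * y2"] x y by (auto elim: Rats_cases)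
  have "D \<noteq> 0" using D vandermonde_nonzero[OF \<alpha>] by auto
  then have "x = (of_rat r0 + of_rat r1 * \<alpha> + of_rat r2 * \<alpha> ^ 2) / of_int D"
    using eq by (simp add: D r0 r1 r2 eq_divide_eq mult.commute)
  also have "\<dots> = of_rat (r0 / of_int D) + of_rat (r1 / of_int D) * \<alpha> + of_rat (r2 / of_int D) * \<alpha> ^ 2"
    by (simp add: of_rat_divide add_divide_distrib)
  finally show "x \<in> {of_rat a + of_rat b * \<alpha> + of_rat c * \<alpha> ^ 2 | a b c. True}" by blast
qed (use \<alpha> in auto)

text \<open>A polynomial of degree at most 2 that vanishes at the three distinct conjugates of
  \<open>\<alpha>\<close> is zero.\<close>

lemma power_basis_independent:
  assumes \<alpha>: "\<alpha> \<in> ints" "\<alpha> \<notin> \<int>"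
    and eq: "of_int a + of_int b * \<alpha> + of_int c * \<alpha> ^ 2 = 0"
  shows "a = 0 \<and> b = 0 \<and> c = 0"
proof -
  define p where "p = [:of_int a, of_int b, of_int c :: complex:]"
  have "p = 0"
  proof (rule ccontr)
    assume "p \<noteq> 0"
    have t: "\<tau> (of_int a + of_int b * \<alpha> + of_int c * \<alpha> ^ 2) = poly p (\<tau> \<alpha>)" if "\<tau> \<in> {t1, t2, t3}" for \<tau>
      using that \<alpha> by (auto simp: p_def power2_eq_square algebra_simps)
    have "{t1 \<alpha>, t2 \<alpha>, t3 \<alpha>} \<subseteq> {z. poly p z = 0}"
      using t[of t1] t[of t2] t[of t3] eq by auto
    then have "card {t1 \<alpha>, t2 \<alpha>, t3 \<alpha>} \<le> card {z. poly p z = 0}"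
      using poly_roots_finite[OF \<open>p \<noteq> 0\<close>] by (rule card_mono[rotated])
    also have "\<dots> \<le> degree p" by (rule card_poly_roots_bound[OF \<open>p \<noteq> 0\<close>])
    also have "\<dots> \<le> 2" by (simp add: p_def)
    finally show False using conjugates_distinct_ints[OF \<alpha>] by simp
  qed
  then show ?thesis by (simp add: p_def)
qed

end

section \<open>Adapted integral bases\<close>

lemma int_subgroup_generator:
  fixes S :: "int set"
  assumes diff: "\<And>a b. a \<in> S \<Longrightarrow> b \<in> S \<Longrightarrow> a - b \<in> S" and D: "D \<in> S" "D > 0"
  obtains g where "g > 0" "g \<in> S" "\<And>s. s \<in> S \<Longrightarrow> g dvd s"
proof -
  have zero: "0 \<in> S" using diff[OF D(1) D(1)] by simp
  have neg: "- a \<in> S" if "a \<in> S" for a using diff[OF zero that] by simp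
  have add: "a + b \<in> S" if "a \<in> S" "b \<in> S" for a b using diff[OF that(1) neg[OF that(2)]] by simp
  have mult: "k * a \<in> S" if "a \<in> S" for k a
  proof (induction k rule: int_induct[where k = 0])
    case base
    then show ?case by (simp add: zero)
  next
    case (step1 i)
    then show ?case using add[OF _ that, of "i * a"] by (simp add: algebra_simps)
  next
    case (step2 i)
    then show ?case using diff[OF _ that, of "i * a"] by (simp add: algebra_simps)
  qed
  define m where "m = (LEAST m. m > 0 \<and> int m \<in> S)"
  have m: "m > 0 \<and> int m \<in> S" unfolding m_def
    by (rule LeastI[of _ "nat D"]) (use D in auto)
  show ?thesis
  proof (rule that[of "int m"])
    fix s assume "s \<in> S"
    have "s mod int m = s - (s div int m) * int m" by (simp add: minus_div_mult_eq_mod)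
    then have *: "s mod int m \<in> S" using diff[OF \<open>s \<in> S\<close> mult] m by metis
    show "int m dvd s"
    proof (rule ccontr)
      assume "\<not> int m dvd s"
      then have "s mod int m > 0" using m by (simp add: dvd_eq_mod_eq_0 order_le_neq_trans)
      then have "m \<le> nat (s mod int m)" unfolding m_def
        by (intro Least_le) (use * in \<open>simp add: m_def\<close>)
      then have "int m \<le> s mod int m" using m by (simp add: le_nat_iff)
      moreover have "s mod int m < int m" by (rule pos_mod_bound) (use m in simp)
      ultimately show False by linarith
    qed
  qed (use m in auto)
qed

context cubic_embeddings
begin

lemma integral_coordinates:
  assumes \<alpha>: "\<alpha> \<in> ints" "\<alpha> \<notin> \<int>"
  obtains D :: int where "D > 0"
    "\<And>x. x \<in> ints \<Longrightarrow> \<exists>a b c. of_int D * x = of_int a + of_int b * \<alpha> + of_int c * \<alpha> ^ 2"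
proof -
  obtain d where d: "vandermonde \<alpha> ^ 2 = of_int d" using vandermonde_square_Ints[OF \<alpha>(1)] by (auto elim: Ints_cases)
  have "d \<noteq> 0" using d vandermonde_nonzero[OF \<alpha>] by auto
  show ?thesis
  \<comment> \<open>\<open>d\<close> is a common denominator but may be negative; its square is a
    positive one.\<close>
  proof (rule that[of "d * d"])
    show "d * d > 0" using \<open>d \<noteq> 0\<close> by (auto simp: zero_less_mult_iff)
    fix x assume x: "x \<in> ints"
    obtain y0 y1 y2 where y: "y0 \<in> ints" "y1 \<in> ints" "y2 \<in> ints"
      and eq: "vandermonde \<alpha> ^ 2 * x = tr (x * y0) + tr (x * y1) * \<alpha> + tr (x * y2) * \<alpha> ^ 2"
      using power_basis_coordinates[OF \<alpha>(1), of x] x by auto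
    obtain r0 where r0: "tr (x * y0) = of_int r0"
      using tr_Ints[of "x * y0"] x y by (auto elim: Ints_cases)
    obtain r1 where r1: "tr (x * y1) = of_int r1"
      using tr_Ints[of "x * y1"] x y by (auto elim: Ints_cases)
    obtain r2 where r2: "tr (x * y2) = of_int r2"
      using tr_Ints[of "x * y2"] x y by (auto elim: Ints_cases)
    have "of_int (d * d) * x = of_int d * (of_int r0 + of_int r1 * \<alpha> + of_int r2 * \<alpha> ^ 2)"
      using eq by (simp add: d r0 r1 r2)
    also have "\<dots> = of_int (d * r0) + of_int (d * r1) * \<alpha> + of_int (d * r2) * \<alpha> ^ 2"
      by (simp add: algebra_simps)
    finally show "\<exists>a b c. of_int (d * d) * x = of_int a + of_int b * \<alpha> + of_int c * \<alpha> ^ 2" by blast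
  qed
qed

lemma ints_rational_multiple:
  assumes "x \<in> ints" "of_int m * x = of_int a" "m \<noteq> 0"
  shows "x \<in> \<int>"
proof -
  have "x = of_int a / of_int m" using assms by (simp add: eq_divide_eq mult.commute)
  then have "x \<in> \<rat>" by simp
  then show ?thesis using Ints_iff_ints_Rats assms(1) by blast
qed

text \<open>In lattice terms, \<open>1\<close> and \<open>\<beta>\<close> span a primitive
  sublattice of the ring of integers, which is exactly what allows them to be extended to an
  integral basis.\<close>

definition saturated where
  "saturated \<beta> \<longleftrightarrow> \<beta> \<in> ints \<and> \<beta> \<notin> \<int> \<and>
    (\<forall>x\<in>ints. \<forall>m a b. m \<noteq> 0 \<longrightarrow> of_int m * x = of_int a + of_int b * \<beta> \<longrightarrow>
      (\<exists>i j. x = of_int i + of_int j * \<beta>))"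

text \<open>Among the integral elements \<open>(a + b \<alpha>) / D\<close>, one with the least
  positive \<open>b\<close>, called \<open>g\<close>, generates all of them modulo
  \<open>\<int>\<close>. Because \<open>\<alpha>\<close> itself has \<open>b = D\<close>, the
  multiplier is \<open>d = D / g\<close>.\<close>

lemma ex_saturated:
  assumes \<alpha>: "\<alpha> \<in> ints" "\<alpha> \<notin> \<int>"
  obtains \<beta> d r where "saturated \<beta>" "d > 0" "\<alpha> = of_int r + of_int d * \<beta>"
proof -
  obtain D where "D > 0"
    and D: "\<And>x. x \<in> ints \<Longrightarrow> \<exists>a b c. of_int D * x = of_int a + of_int b * \<alpha> + of_int c * \<alpha> ^ 2"
    using integral_coordinates[OF \<alpha>] by metis
  define S where "S = {b. \<exists>a. \<exists>x\<in>ints. of_int D * x = of_int a + of_int b * \<alpha>}"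
  have SI: "b \<in> S" if "x \<in> ints" "of_int D * x = of_int a + of_int b * \<alpha>" for a b x
    using that unfolding S_def by blast
  obtain g where g: "g > 0" "g \<in> S" "\<And>s. s \<in> S \<Longrightarrow> g dvd s"
  proof (rule int_subgroup_generator[of S D])
    fix b b' assume "b \<in> S" "b' \<in> S"
    then obtain a x a' x' where x: "x \<in> ints" "of_int D * x = of_int a + of_int b * \<alpha>"
      and x': "x' \<in> ints" "of_int D * x' = of_int a' + of_int b' * \<alpha>"
      unfolding S_def by blast
    have "of_int D * (x - x') = of_int (a - a') + of_int (b - b') * \<alpha>"
      using x(2) x'(2) by (simp add: right_diff_distrib) (simp add: algebra_simps)
    then show "b - b' \<in> S" using SI x(1) x'(1) ints_diff by blast
  next
    show "D \<in> S" using SI[of \<alpha> 0 D] \<alpha> by simp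
  qed (use \<open>D > 0\<close> in auto)
  obtain a0 \<beta> where \<beta>: "\<beta> \<in> ints" "of_int D * \<beta> = of_int a0 + of_int g * \<alpha>"
    using g(2) unfolding S_def by blast
  have "D \<in> S" using SI[of \<alpha> 0 D] \<alpha> by simp
  then obtain d where d: "D = g * d" using g(3) by blast
  then have "d > 0" using \<open>D > 0\<close> g(1) by (simp add: zero_less_mult_iff)
  have "of_int D * (\<alpha> - of_int d * \<beta>) = of_int (- d * a0)"
  proof -
    have "of_int D * (\<alpha> - of_int d * \<beta>) = of_int D * \<alpha> - of_int d * (of_int D * \<beta>)"
      by (simp add: algebra_simps)
    then show ?thesis unfolding \<beta>(2) by (simp add: d algebra_simps)
  qed
  then have "\<alpha> - of_int d * \<beta> \<in> \<int>"
    by (rule ints_rational_multiple[rotated]) (use \<alpha> \<beta> \<open>D > 0\<close> in auto)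
  then obtain r where "\<alpha> - of_int d * \<beta> = of_int r" by (auto elim: Ints_cases)
  then have r: "\<alpha> = of_int r + of_int d * \<beta>" by (simp add: algebra_simps)
  have "\<beta> \<notin> \<int>" using r \<alpha>(2) by auto
  have "\<exists>i j. x = of_int i + of_int j * \<beta>"
    if x: "x \<in> ints" "m \<noteq> 0" "of_int m * x = of_int a + of_int b * \<beta>" for x m a b
  proof -
    obtain A B C where ABC: "of_int D * x = of_int A + of_int B * \<alpha> + of_int C * \<alpha> ^ 2"
      using D x(1) by blast
    have "of_int (m * d) * (of_int D * x) = of_int (D * d) * (of_int m * x)"
      by simp
    also have "\<dots> = of_int D * (of_int (a * d) + of_int b * (of_int d * \<beta>))"
      unfolding x(3) by (simp add: algebra_simps)
    also have "\<dots> = of_int D * (of_int (a * d) + of_int b * (\<alpha> - of_int r))"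
      by (simp add: r)
    finally have "of_int (m * d * A - D * (a * d - b * r)) + of_int (m * d * B - D * b) * \<alpha>
        + of_int (m * d * C) * \<alpha> ^ 2 = 0"
      unfolding ABC by (simp add: algebra_simps)
    from power_basis_independent[OF \<alpha> this] have "C = 0"
      using \<open>m \<noteq> 0\<close> \<open>d > 0\<close> by simp
    then have AB: "of_int D * x = of_int A + of_int B * \<alpha>" using ABC by simp
    then obtain j where j: "B = g * j" using SI g(3) x(1) by blast
    have "of_int D * (x - of_int j * \<beta>) = of_int D * x - of_int j * (of_int D * \<beta>)"
      by (simp add: algebra_simps)
    also have "\<dots> = of_int (A - j * a0)" unfolding AB \<beta>(2) by (simp add: j algebra_simps)
    finally have "x - of_int j * \<beta> \<in> \<int>"
      by (rule ints_rational_multiple[rotated]) (use x \<beta> \<open>D > 0\<close> in auto)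
    then obtain i where "x - of_int j * \<beta> = of_int i" by (auto elim: Ints_cases)
    then have "x = of_int i + of_int j * \<beta>" by (simp add: algebra_simps)
    then show ?thesis by blast
  qed
  then have "saturated \<beta>" using \<beta>(1) \<open>\<beta> \<notin> \<int>\<close> unfolding saturated_def by blast
  then show ?thesis using \<open>d > 0\<close> r by (rule that)
qed

text \<open>\<open>n\<close> is the index of \<open>\<int>[\<beta>]\<close> in the ring of integers.
  Uniqueness of coordinates follows from the independence of the powers of
  \<open>\<beta>\<close>.\<close>

definition adapted_basis where
  "adapted_basis \<beta> \<gamma> n u v \<longleftrightarrow> \<beta> \<in> ints \<and> \<beta> \<notin> \<int> \<and> \<gamma> \<in> ints \<and> n > 0 \<and>
     of_int n * \<gamma> = \<beta> ^ 2 + of_int u * \<beta> + of_int v \<and>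
     (\<forall>x\<in>ints. \<exists>a b c. x = of_int a + of_int b * \<beta> + of_int c * \<gamma>)"

text \<open>Now \<open>\<gamma>\<close> has the least positive coefficient at
  \<open>\<beta>^2\<close>. What remains after removing that coefficient lies in the rational span
  of \<open>1\<close> and \<open>\<beta>\<close>; saturation turns it into an integral combination,
  once for \<open>u\<close> and \<open>v\<close> and once for the spanning property.\<close>

lemma saturated_adapted_basis:
  assumes "saturated \<beta>"
  obtains \<gamma> n u v where "adapted_basis \<beta> \<gamma> n u v"
proof -
  have \<beta>: "\<beta> \<in> ints" "\<beta> \<notin> \<int>"
    and sat: "\<And>x m a b. x \<in> ints \<Longrightarrow> m \<noteq> 0 \<Longrightarrow> of_int m * x = of_int a + of_int b * \<beta> \<Longrightarrow>
      \<exists>i j. x = of_int i + of_int j * \<beta>"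
    using assms unfolding saturated_def by blast+
  obtain D where "D > 0"
    and D: "\<And>x. x \<in> ints \<Longrightarrow> \<exists>a b c. of_int D * x = of_int a + of_int b * \<beta> + of_int c * \<beta> ^ 2"
    using integral_coordinates[OF \<beta>] by metis
  define S where "S = {c. \<exists>a b. \<exists>x\<in>ints. of_int D * x = of_int a + of_int b * \<beta> + of_int c * \<beta> ^ 2}"
  have SI: "c \<in> S" if "x \<in> ints" "of_int D * x = of_int a + of_int b * \<beta> + of_int c * \<beta> ^ 2" for a b c x
    using that unfolding S_def by blast
  have "D \<in> S" using SI[of "\<beta> ^ 2" 0 0 D] \<beta> by simp
  obtain g where g: "g > 0" "g \<in> S" "\<And>s. s \<in> S \<Longrightarrow> g dvd s"
  proof (rule int_subgroup_generator[of S D])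
    fix c c' assume "c \<in> S" "c' \<in> S"
    then obtain a b x a' b' x' where
      x: "x \<in> ints" "of_int D * x = of_int a + of_int b * \<beta> + of_int c * \<beta> ^ 2" and
      x': "x' \<in> ints" "of_int D * x' = of_int a' + of_int b' * \<beta> + of_int c' * \<beta> ^ 2"
      unfolding S_def by blast
    have "of_int D * (x - x') = of_int (a - a') + of_int (b - b') * \<beta> + of_int (c - c') * \<beta> ^ 2"
      using x(2) x'(2) by (simp add: right_diff_distrib) (simp add: algebra_simps)
    then show "c - c' \<in> S" using SI x(1) x'(1) ints_diff by blast
  qed (use \<open>D > 0\<close> \<open>D \<in> S\<close> in auto)
  obtain a0 b0 \<gamma> where \<gamma>: "\<gamma> \<in> ints" "of_int D * \<gamma> = of_int a0 + of_int b0 * \<beta> + of_int g * \<beta> ^ 2"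
    using g(2) unfolding S_def by blast
  obtain n where n: "D = g * n" using g(3) \<open>D \<in> S\<close> by blast
  then have "n > 0" using \<open>D > 0\<close> g(1) by (simp add: zero_less_mult_iff)
  have "of_int D * (of_int n * \<gamma> - \<beta> ^ 2) = of_int n * (of_int D * \<gamma>) - of_int D * \<beta> ^ 2"
    by (simp add: algebra_simps)
  also have "\<dots> = of_int (n * a0) + of_int (n * b0) * \<beta>"
    unfolding \<gamma>(2) by (simp add: n algebra_simps)
  finally have "\<exists>i j. of_int n * \<gamma> - \<beta> ^ 2 = of_int i + of_int j * \<beta>"
    by (rule sat[rotated 2]) (use \<open>D > 0\<close> \<beta>(1) \<gamma>(1) in auto)
  then obtain v u where "of_int n * \<gamma> - \<beta> ^ 2 = of_int v + of_int u * \<beta>" by blast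
  then have uv: "of_int n * \<gamma> = \<beta> ^ 2 + of_int u * \<beta> + of_int v" by (simp add: algebra_simps)
  have "\<exists>a b c. x = of_int a + of_int b * \<beta> + of_int c * \<gamma>" if x: "x \<in> ints" for x
  proof -
    obtain A B C where ABC: "of_int D * x = of_int A + of_int B * \<beta> + of_int C * \<beta> ^ 2"
      using D x by blast
    then obtain k where k: "C = g * k" using SI g(3) x by blast
    have "of_int D * (x - of_int k * \<gamma>) = of_int D * x - of_int k * (of_int D * \<gamma>)"
      by (simp add: algebra_simps)
    also have "\<dots> = of_int (A - k * a0) + of_int (B - k * b0) * \<beta>"
      unfolding ABC \<gamma>(2) by (simp add: k algebra_simps)
    finally have "\<exists>i j. x - of_int k * \<gamma> = of_int i + of_int j * \<beta>"
      by (rule sat[rotated 2]) (use \<open>D > 0\<close> x \<gamma>(1) in auto)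
    then obtain i j where "x - of_int k * \<gamma> = of_int i + of_int j * \<beta>" by blast
    then have "x = of_int i + of_int j * \<beta> + of_int k * \<gamma>" by (simp add: algebra_simps)
    then show ?thesis by blast
  qed
  with \<beta> \<gamma>(1) \<open>n > 0\<close> uv show ?thesis using that unfolding adapted_basis_def by blast
qed

text \<open>Translation changes neither \<open>\<gamma>\<close> nor \<open>n\<close>. It serves to
  make the trace of \<open>\<beta>\<close> small and to move the double root of its characteristic
  polynomial to 0.\<close>

lemma adapted_basis_shift:
  assumes "adapted_basis \<beta> \<gamma> n u v"
  shows "adapted_basis (\<beta> - of_int k) \<gamma> n (u + 2 * k) (v + u * k + k ^ 2)"
proof -
  have \<beta>: "\<beta> \<in> ints" "\<beta> \<notin> \<int>" and \<gamma>: "\<gamma> \<in> ints" "n > 0"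
    and eq: "of_int n * \<gamma> = \<beta> ^ 2 + of_int u * \<beta> + of_int v"
    and span: "\<And>x. x \<in> ints \<Longrightarrow> \<exists>a b c. x = of_int a + of_int b * \<beta> + of_int c * \<gamma>"
    using assms unfolding adapted_basis_def by blast+
  have "\<exists>a b c. x = of_int a + of_int b * (\<beta> - of_int k) + of_int c * \<gamma>" if x: "x \<in> ints" for x
  proof -
    obtain a b c where "x = of_int a + of_int b * \<beta> + of_int c * \<gamma>" using span[OF x] by blast
    then have "x = of_int (a + b * k) + of_int b * (\<beta> - of_int k) + of_int c * \<gamma>"
      by (simp add: algebra_simps)
    then show ?thesis by blast
  qed
  moreover have "\<beta> - of_int k \<notin> \<int>" using \<beta>(2) Ints_add[of "\<beta> - of_int k" "of_int k"] by auto
  ultimately show ?thesis using \<beta> \<gamma> eq unfolding adapted_basis_def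
    by (simp add: power2_eq_square algebra_simps)
qed

lemma adapted_basis_independent:
  assumes "adapted_basis \<beta> \<gamma> n u v" "of_int a + of_int b * \<beta> + of_int c * \<gamma> = 0"
  shows "a = 0 \<and> b = 0 \<and> c = 0"
proof -
  have \<beta>: "\<beta> \<in> ints" "\<beta> \<notin> \<int>" and "n > 0"
    and eq: "of_int n * \<gamma> = \<beta> ^ 2 + of_int u * \<beta> + of_int v"
    using assms(1) unfolding adapted_basis_def by blast+
  have "of_int n * (of_int a + of_int b * \<beta> + of_int c * \<gamma>)
      = of_int (n * a) + of_int (n * b) * \<beta> + of_int c * (of_int n * \<gamma>)"
    by (simp add: algebra_simps)
  also have "\<dots> = of_int (n * a + c * v) + of_int (n * b + c * u) * \<beta> + of_int c * \<beta> ^ 2"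
    unfolding eq by (simp add: algebra_simps)
  finally have "of_int (n * a + c * v) + of_int (n * b + c * u) * \<beta> + of_int c * \<beta> ^ 2 = 0"
    using assms(2) by simp
  from power_basis_independent[OF \<beta> this] show ?thesis using \<open>n > 0\<close> by auto
qed

lemma adapted_basis_integral_basis:
  assumes "adapted_basis \<beta> \<gamma> n u v"
  shows "integral_basis K 1 \<beta> \<gamma>"
proof -
  have \<beta>: "\<beta> \<in> ints" "\<gamma> \<in> ints"
    and span: "\<And>x. x \<in> ints \<Longrightarrow> \<exists>a b c. x = of_int a + of_int b * \<beta> + of_int c * \<gamma>"
    using assms unfolding adapted_basis_def by blast+
  have "\<exists>!(a :: int \<times> int \<times> int).
      x = of_int (fst a) * 1 + of_int (fst (snd a)) * \<beta> + of_int (snd (snd a)) * \<gamma>"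
    if x: "x \<in> ints" for x
  proof -
    obtain a b c where abc: "x = of_int a + of_int b * \<beta> + of_int c * \<gamma>" using span[OF x] by blast
    show ?thesis
    proof (rule ex1I[of _ "(a, b, c)"])
      fix y :: "int \<times> int \<times> int"
      assume y: "x = of_int (fst y) * 1 + of_int (fst (snd y)) * \<beta> + of_int (snd (snd y)) * \<gamma>"
      have "of_int (a - fst y) + of_int (b - fst (snd y)) * \<beta> + of_int (c - snd (snd y)) * \<gamma> = x - x"
        by (subst (1) y, subst abc) (simp add: algebra_simps)
      then have "of_int (a - fst y) + of_int (b - fst (snd y)) * \<beta> + of_int (c - snd (snd y)) * \<gamma> = 0"
        by simp
      from adapted_basis_independent[OF assms this] show "y = (a, b, c)"
        by (auto simp: prod_eq_iff)
    qed (simp add: abc)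
  qed
  then show ?thesis using \<beta> unfolding integral_basis_def by auto
qed

lemma ex_reduced_shift:
  assumes "x \<in> ints"
  obtains k where "reduced K (x - of_int k)"
proof -
  obtain m where m: "tr x = of_int m" using tr_Ints[OF assms] by (auto elim: Ints_cases)
  \<comment> \<open>Subtracting \<open>k\<close> lowers the trace by \<open>3 * k\<close>, and this
    \<open>k\<close> is the integer nearest to \<open>m / 3\<close>.\<close>
  define k where "k = (m + 1) div 3"
  define j where "j = m - 3 * k"
  have "j = -1 \<or> j = 0 \<or> j = 1" unfolding j_def k_def by presburger
  moreover have "trace K (x - of_int k) = of_int j"
    using m assms by (simp add: j_def trace_eq tr_def algebra_simps)
  ultimately have "trace K (x - of_int k) \<in> {-1, 0, 1}" by auto
  then show ?thesis using that assms by (simp add: reduced_def)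
qed

lemma ex_adapted_basis:
  assumes \<alpha>: "\<alpha> \<in> ints" "\<alpha> \<notin> \<int>"
  obtains \<beta> \<gamma> n u v d r where "adapted_basis \<beta> \<gamma> n u v" "reduced K \<beta>" "d > 0"
    "\<alpha> = of_int r + of_int d * \<beta>"
proof -
  obtain \<beta> d r where \<beta>: "saturated \<beta>" "d > 0" "\<alpha> = of_int r + of_int d * \<beta>"
    using ex_saturated[OF \<alpha>] .
  obtain \<gamma> n u v where "adapted_basis \<beta> \<gamma> n u v" using saturated_adapted_basis[OF \<beta>(1)] .
  obtain k where "reduced K (\<beta> - of_int k)"
    using ex_reduced_shift[of \<beta>] \<beta>(1) unfolding saturated_def by blast
  moreover have "\<alpha> = of_int (r + d * k) + of_int d * (\<beta> - of_int k)"
    using \<beta>(3) by (simp add: algebra_simps)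
  ultimately show ?thesis
    using that adapted_basis_shift[OF \<open>adapted_basis \<beta> \<gamma> n u v\<close>, of k] \<beta>(2) by blast
qed

end

section \<open>The discriminant\<close>

text \<open>The matrix on the left is the second matrix on the right times the transpose of the
  first: conjugates of a basis times coordinates.\<close>

lemma det3_mult:
  "det3 (a11*x1+a12*x2+a13*x3) (a21*x1+a22*x2+a23*x3) (a31*x1+a32*x2+a33*x3)
        (a11*y1+a12*y2+a13*y3) (a21*y1+a22*y2+a23*y3) (a31*y1+a32*y2+a33*y3)
        (a11*z1+a12*z2+a13*z3) (a21*z1+a22*z2+a23*z3) (a31*z1+a32*z2+a33*z3)
   = det3 a11 a12 a13 a21 a22 a23 a31 a32 a33 * det3 x1 x2 x3 y1 y2 y3 z1 z2 z3"
  unfolding det3_def by (simp add: algebra_simps)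

lemma det3_of_int:
  "det3 (of_int a11) (of_int a12) (of_int a13) (of_int a21) (of_int a22) (of_int a23)
     (of_int a31) (of_int a32) (of_int a33) \<in> \<int>"
  unfolding det3_def by simp

context cubic_embeddings
begin

lemma integral_basis_coordinates:
  assumes "integral_basis K w1 w2 w3" "x \<in> ints"
  obtains a b c :: int where "x = of_int a * w1 + of_int b * w2 + of_int c * w3"
  using assms unfolding integral_basis_def by (metis (no_types, lifting))

text \<open>The factor is the determinant of the coordinates. Applied in both directions to two
  integral bases, the lemma shows that their determinants differ by a unit of \<open>\<int>\<close>,
  so the square in \<open>discriminant\<close> does not depend on the basis.\<close>

lemma integral_basis_det_multiple:
  assumes w: "integral_basis K w1 w2 w3" and x: "{x1, x2, x3} \<subseteq> ints"
    and s: "embeddings K = {s1, s2, s3}"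
  obtains m :: int where
    "det3 (s1 x1) (s1 x2) (s1 x3) (s2 x1) (s2 x2) (s2 x3) (s3 x1) (s3 x2) (s3 x3)
     = of_int m * det3 (s1 w1) (s1 w2) (s1 w3) (s2 w1) (s2 w2) (s2 w3) (s3 w1) (s3 w2) (s3 w3)"
proof -
  have wK: "w1 \<in> K" "w2 \<in> K" "w3 \<in> K" using w by (auto simp: integral_basis_def)
  obtain a1 b1 c1 :: int where 1: "x1 = of_int a1 * w1 + of_int b1 * w2 + of_int c1 * w3"
    using integral_basis_coordinates[OF w] x by blast
  obtain a2 b2 c2 :: int where 2: "x2 = of_int a2 * w1 + of_int b2 * w2 + of_int c2 * w3"
    using integral_basis_coordinates[OF w] x by blast
  obtain a3 b3 c3 :: int where 3: "x3 = of_int a3 * w1 + of_int b3 * w2 + of_int c3 * w3"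
    using integral_basis_coordinates[OF w] x by blast
  have lin: "s (of_int a * w1 + of_int b * w2 + of_int c * w3)
      = of_int a * s w1 + of_int b * s w2 + of_int c * s w3" if "s \<in> {s1, s2, s3}" for s a b c
  proof -
    have "s \<in> embeddings K" using that s by simp
    then show ?thesis
      using wK in_embeddingsD(1,2)[of s K] emb_of_int[of s] by simp
  qed
  obtain m where m: "det3 (of_int a1) (of_int b1) (of_int c1) (of_int a2) (of_int b2) (of_int c2)
     (of_int a3) (of_int b3) (of_int c3) = of_int m"
    using det3_of_int[of a1 b1 c1 a2 b2 c2 a3 b3 c3] by (metis Ints_cases)
  show ?thesis
  proof (rule that[of m])
    show "det3 (s1 x1) (s1 x2) (s1 x3) (s2 x1) (s2 x2) (s2 x3) (s3 x1) (s3 x2) (s3 x3)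
     = of_int m * det3 (s1 w1) (s1 w2) (s1 w3) (s2 w1) (s2 w2) (s2 w3) (s3 w1) (s3 w2) (s3 w3)"
      unfolding 1 2 3 by (simp only: lin insert_iff simp_thms det3_mult m)
  qed
qed

text \<open>Multiplying the column of \<open>\<gamma>\<close> by \<open>n\<close> and removing its
  multiples of the other two columns leaves the Vandermonde matrix of the conjugates of
  \<open>\<beta>\<close>. Squaring removes the sign that depends on the order of the embeddings,
  which is arbitrary here.\<close>

lemma adapted_basis_det:
  assumes ab: "adapted_basis \<beta> \<gamma> n u v" and s: "embeddings K = {s1, s2, s3}" "distinct [s1, s2, s3]"
  shows "(of_int n * det3 (s1 1) (s1 \<beta>) (s1 \<gamma>) (s2 1) (s2 \<beta>) (s2 \<gamma>) (s3 1) (s3 \<beta>) (s3 \<gamma>)) ^ 2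
    = vandermonde \<beta> ^ 2"
proof -
  have \<beta>: "\<beta> \<in> ints" "\<beta> \<notin> \<int>" and \<gamma>: "\<gamma> \<in> ints"
    and eq: "of_int n * \<gamma> = \<beta> ^ 2 + of_int u * \<beta> + of_int v"
    using ab unfolding adapted_basis_def by blast+
  have emb: "s 1 = 1 \<and> of_int n * s \<gamma> = s \<beta> ^ 2 + of_int u * s \<beta> + of_int v" if "s \<in> {s1, s2, s3}" for s
  proof -
    have s: "s \<in> embeddings K" using that s by simp
    have "s (of_int n * \<gamma>) = s (\<beta> ^ 2 + of_int u * \<beta> + of_int v)" by (simp only: eq)
    then show ?thesis
      using \<beta> \<gamma> in_embeddingsD(1-3)[OF s] emb_of_int[OF s] emb_power[OF s] by simp
  qed
  have det: "of_int n * det3 1 b1 g1 1 b2 g2 1 b3 g3 = (b2 - b1) * (b3 - b1) * (b3 - b2)"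
    if "of_int n * g1 = b1 ^ 2 + of_int u * b1 + of_int v" "of_int n * g2 = b2 ^ 2 + of_int u * b2 + of_int v"
      "of_int n * g3 = b3 ^ 2 + of_int u * b3 + of_int v" for b1 b2 b3 g1 g2 g3 :: complex
  proof -
    have "of_int n * det3 1 b1 g1 1 b2 g2 1 b3 g3
       = b2 * (of_int n * g3) - (of_int n * g2) * b3 - b1 * (of_int n * g3) + b1 * (of_int n * g2)
        + (of_int n * g1) * b3 - (of_int n * g1) * b2"
      by (simp add: det3_def algebra_simps)
    then show ?thesis unfolding that by (simp add: power2_eq_square algebra_simps)
  qed
  have e: "s1 1 = 1" "s2 1 = 1" "s3 1 = 1"
    "of_int n * s1 \<gamma> = s1 \<beta> ^ 2 + of_int u * s1 \<beta> + of_int v"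
    "of_int n * s2 \<gamma> = s2 \<beta> ^ 2 + of_int u * s2 \<beta> + of_int v"
    "of_int n * s3 \<gamma> = s3 \<beta> ^ 2 + of_int u * s3 \<beta> + of_int v"
    using emb[of s1] emb[of s2] emb[of s3] by simp_all
  have "s1 \<in> {t1, t2, t3}" "s2 \<in> {t1, t2, t3}" "s3 \<in> {t1, t2, t3}"
    using s(1) embeddings_eq by auto
  then have "(s1 = t1 \<and> s2 = t2 \<and> s3 = t3) \<or> (s1 = t1 \<and> s2 = t3 \<and> s3 = t2) \<or>
     (s1 = t2 \<and> s2 = t1 \<and> s3 = t3) \<or> (s1 = t2 \<and> s2 = t3 \<and> s3 = t1) \<or>
     (s1 = t3 \<and> s2 = t1 \<and> s3 = t2) \<or> (s1 = t3 \<and> s2 = t2 \<and> s3 = t1)"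
    using s(2) by auto
  then have "((s2 \<beta> - s1 \<beta>) * (s3 \<beta> - s1 \<beta>) * (s3 \<beta> - s2 \<beta>)) ^ 2 = vandermonde \<beta> ^ 2"
    unfolding vandermonde_def power_mult_distrib by (elim disjE conjE) (simp_all add: power2_commute mult_ac)
  then show ?thesis using det[OF e(4-6)] e(1-3) by simp
qed

lemma discriminant_adapted_basis:
  assumes ab: "adapted_basis \<beta> \<gamma> n u v"
  shows "of_int n ^ 2 * discriminant K = vandermonde \<beta> ^ 2"
proof -
  have \<beta>: "\<beta> \<in> ints" "\<beta> \<notin> \<int>" and \<gamma>: "\<gamma> \<in> ints" and n: "n > 0"
    using ab unfolding adapted_basis_def by blast+
  note ib = adapted_basis_integral_basis[OF ab]
  define d where "d = (vandermonde \<beta> / of_int n) ^ 2"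
  have "discriminant K = d"
    unfolding discriminant_def
  proof (rule the_equality)
    let ?G = "det3 (t1 1) (t1 \<beta>) (t1 \<gamma>) (t2 1) (t2 \<beta>) (t2 \<gamma>) (t3 1) (t3 \<beta>) (t3 \<gamma>)"
    have "d = ?G ^ 2"
      using adapted_basis_det[OF ab embeddings_eq distinct_embeddings] n
      by (simp add: d_def power_divide power_mult_distrib field_simps)
    then show "\<exists>w1 w2 w3 t1 t2 t3. integral_basis K w1 w2 w3 \<and>
      embeddings K = {t1, t2, t3} \<and> distinct [t1, t2, t3] \<and>
      d = (det3 (t1 w1) (t1 w2) (t1 w3) (t2 w1) (t2 w2) (t2 w3) (t3 w1) (t3 w2) (t3 w3))^2"
      using ib embeddings_eq distinct_embeddings by blast
  next
    fix d' assume "\<exists>w1 w2 w3 s1 s2 s3. integral_basis K w1 w2 w3 \<and>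
      embeddings K = {s1, s2, s3} \<and> distinct [s1, s2, s3] \<and>
      d' = (det3 (s1 w1) (s1 w2) (s1 w3) (s2 w1) (s2 w2) (s2 w3) (s3 w1) (s3 w2) (s3 w3))^2"
    then obtain w1 w2 w3 s1 s2 s3 where w: "integral_basis K w1 w2 w3"
      and s: "embeddings K = {s1, s2, s3}" "distinct [s1, s2, s3]"
      and d': "d' = (det3 (s1 w1) (s1 w2) (s1 w3) (s2 w1) (s2 w2) (s2 w3) (s3 w1) (s3 w2) (s3 w3))^2"
      by blast
    let ?W = "det3 (s1 w1) (s1 w2) (s1 w3) (s2 w1) (s2 w2) (s2 w3) (s3 w1) (s3 w2) (s3 w3)"
    let ?G = "det3 (s1 1) (s1 \<beta>) (s1 \<gamma>) (s2 1) (s2 \<beta>) (s2 \<gamma>) (s3 1) (s3 \<beta>) (s3 \<gamma>)"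
    have "{1, \<beta>, \<gamma>} \<subseteq> ints" using \<beta> \<gamma> by simp
    from integral_basis_det_multiple[OF w this s(1)] obtain m where m: "?G = of_int m * ?W" .
    have "{w1, w2, w3} \<subseteq> ints" using w by (simp add: integral_basis_def)
    from integral_basis_det_multiple[OF ib this s(1)] obtain m' where m': "?W = of_int m' * ?G" .
    have G: "(of_int n * ?G) ^ 2 = vandermonde \<beta> ^ 2" by (rule adapted_basis_det[OF ab s])
    then have "?G \<noteq> 0" using vandermonde_nonzero[OF \<beta>] by auto
    moreover have "?G = of_int (m * m') * ?G" using m m' by simp
    ultimately have "of_int (m * m') = (1 :: complex)" by (metis mult_cancel_right2)
    then have "m * m' = 1" by (simp only: of_int_eq_1_iff)
    then have "m' = 1 \<or> m' = - 1" using zmult_eq_1_iff by auto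
    then have "?W ^ 2 = ?G ^ 2" using m' by auto
    then show "d' = d"
      using G n unfolding d' d_def by (simp add: power_divide power_mult_distrib field_simps)
  qed
  then show ?thesis using n by (simp add: d_def power_divide)
qed

text \<open>The determinant shows an algebraic integer, the quotient by \<open>n^2\<close> a
  rational number.\<close>

lemma discriminant_Ints:
  assumes ab: "adapted_basis \<beta> \<gamma> n u v"
  shows "discriminant K \<in> \<int>"
proof -
  have \<beta>: "\<beta> \<in> ints" "\<beta> \<notin> \<int>" and \<gamma>: "\<gamma> \<in> ints" and n: "n > 0"
    using ab unfolding adapted_basis_def by blast+
  let ?G = "det3 (t1 1) (t1 \<beta>) (t1 \<gamma>) (t2 1) (t2 \<beta>) (t2 \<gamma>) (t3 1) (t3 \<beta>) (t3 \<gamma>)"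
  have eq: "discriminant K = vandermonde \<beta> ^ 2 / of_int n ^ 2"
    using discriminant_adapted_basis[OF ab] n by (simp add: field_simps)
  have "discriminant K = ?G ^ 2"
    using adapted_basis_det[OF ab embeddings_eq distinct_embeddings] n
    by (simp add: eq power_mult_distrib field_simps)
  moreover have "algebraic_int ?G"
    unfolding det3_def
    by (intro algebraic_int_add algebraic_int_diff algebraic_int_mult
        emb_algebraic_int[OF embs(1)] emb_algebraic_int[OF embs(2)] emb_algebraic_int[OF embs(3)])
      (use \<beta> \<gamma> in simp_all)
  ultimately have "algebraic_int (discriminant K)" by (simp add: algebraic_int_power)
  moreover have "discriminant K \<in> \<rat>"
    unfolding eq using vandermonde_square_Ints[OF \<beta>(1)] Ints_subset_Rats by (intro Rats_divide) auto
  ultimately show ?thesis using rational_algebraic_int_is_int by blast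
qed

lemma discriminant_ge_1:
  assumes ab: "adapted_basis \<beta> \<gamma> n u v"
  shows "cmod (discriminant K) \<ge> 1"
proof -
  have \<beta>: "\<beta> \<in> ints" "\<beta> \<notin> \<int>" using ab unfolding adapted_basis_def by blast+
  obtain d where d: "discriminant K = of_int d" using discriminant_Ints[OF ab] by (auto elim: Ints_cases)
  have "d \<noteq> 0" using discriminant_adapted_basis[OF ab] vandermonde_nonzero[OF \<beta>] d by auto
  then show ?thesis by (simp add: d)
qed

text \<open>The multiplication table of \<open>\<beta> \<gamma>\<close> and \<open>\<gamma>\<^sup>2\<close> forces the characteristic polynomial of
  \<open>\<beta>\<close> to have a root modulo \<open>n\<^sup>2\<close> which is a double root modulo \<open>n\<close>; the root is the
  \<open>\<gamma>\<close>-coordinate of \<open>\<beta> \<gamma>\<close>.\<close>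

lemma adapted_basis_double_root:
  assumes ab: "adapted_basis \<beta> \<gamma> n u v"
    and e: "tr \<beta> = of_int e1" "sym2 \<beta> = of_int e2" "field_norm \<beta> = of_int e3"
  obtains s where "n dvd 3 * s ^ 2 - 2 * e1 * s + e2" "n ^ 2 dvd s ^ 3 - e1 * s ^ 2 + e2 * s - e3"
proof -
  have \<beta>: "\<beta> \<in> ints" "\<beta> \<notin> \<int>" and \<gamma>: "\<gamma> \<in> ints" and n: "n > 0"
    and span: "\<And>x. x \<in> ints \<Longrightarrow> \<exists>a b c. x = of_int a + of_int b * \<beta> + of_int c * \<gamma>"
    using ab unfolding adapted_basis_def by blast+
  obtain p q s where pqs: "\<beta> * \<gamma> = of_int p + of_int q * \<beta> + of_int s * \<gamma>"
    using span[of "\<beta> * \<gamma>"] \<beta> \<gamma> by auto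
  \<comment> \<open>After translation by \<open>s\<close> the product
    \<open>\<delta> * \<gamma>\<close> has no \<open>\<gamma>\<close>-coordinate, so the root to be
    exhibited becomes 0.\<close>
  define \<delta> where "\<delta> = \<beta> - of_int s"
  define u' v' p' where "u' = u + 2 * s" and "v' = v + u * s + s ^ 2" and "p' = p + q * s"
  have ab': "adapted_basis \<delta> \<gamma> n u' v'"
    unfolding \<delta>_def u'_def v'_def by (rule adapted_basis_shift[OF ab])
  then have \<delta>: "\<delta> \<in> ints" "\<delta> \<notin> \<int>" and n\<gamma>: "of_int n * \<gamma> = \<delta> ^ 2 + of_int u' * \<delta> + of_int v'"
    unfolding adapted_basis_def by blast+
  have \<delta>\<gamma>: "\<delta> * \<gamma> = of_int p' + of_int q * \<delta>"
    using pqs by (simp add: \<delta>_def p'_def algebra_simps)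
  obtain a b c where abc: "\<gamma> ^ 2 = of_int a + of_int b * \<delta> + of_int c * \<gamma>"
    using ab' \<gamma> unfolding adapted_basis_def by (meson ints_power)
  \<comment> \<open>\<open>n^2 * \<gamma>^2\<close> is computed twice, from the coordinates of
    \<open>\<gamma>^2\<close> and from those of \<open>\<delta> * \<gamma>\<close>. Comparing the
    coefficients of \<open>\<delta>^2\<close> and \<open>\<delta>\<close> gives
    \<open>v' = n * (c - q)\<close> and then \<open>n * p' = n^2 * b\<close>.\<close>
  have "of_int n ^ 2 * \<gamma> ^ 2 = of_int n ^ 2 * (of_int a + of_int b * \<delta>) + of_int (n * c) * (of_int n * \<gamma>)"
    unfolding abc by (simp add: power2_eq_square algebra_simps)
  moreover have "of_int n ^ 2 * \<gamma> ^ 2 = of_int n * (\<delta> * (\<delta> * \<gamma>)) + of_int (n * u') * (\<delta> * \<gamma>) + of_int v' * (of_int n * \<gamma>)"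
  proof -
    have "of_int n ^ 2 * \<gamma> ^ 2 = of_int n * \<gamma> * (of_int n * \<gamma>)" by (simp add: power2_eq_square)
    also have "\<dots> = of_int n * \<gamma> * (\<delta> ^ 2 + of_int u' * \<delta> + of_int v')" unfolding n\<gamma> ..
    finally show ?thesis by (simp add: power2_eq_square algebra_simps)
  qed
  ultimately have "of_int n ^ 2 * (of_int a + of_int b * \<delta>) + of_int (n * c) * (of_int n * \<gamma>)
     = of_int n * (\<delta> * (\<delta> * \<gamma>)) + of_int (n * u') * (\<delta> * \<gamma>) + of_int v' * (of_int n * \<gamma>)" by simp
  then have "of_int (n ^ 2 * a + n * c * v' - n * u' * p' - v' * v')
     + of_int (n ^ 2 * b + n * c * u' - n * p' - n * u' * q - v' * u') * \<delta>
     + of_int (n * c - n * q - v') * \<delta> ^ 2 = 0"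
    unfolding n\<gamma> \<delta>\<gamma> by (simp add: power2_eq_square algebra_simps)
  from power_basis_independent[OF \<delta> this]
  have i1: "n ^ 2 * b + n * c * u' - n * p' - n * u' * q - v' * u' = 0" and v': "v' = n * c - n * q"
    by auto
  have np: "n * p' = n ^ 2 * b" using i1 unfolding v' by (simp add: algebra_simps)
  have "\<delta> * (of_int n * \<gamma>) = of_int n * (\<delta> * \<gamma>)" by simp
  then have cub: "\<delta> ^ 3 + of_int u' * \<delta> ^ 2 + of_int (v' - n * q) * \<delta> - of_int (n * p') = 0"
    unfolding n\<gamma> \<delta>\<gamma> by (simp add: power2_eq_square power3_eq_cube algebra_simps)
  have "\<beta> ^ 3 - of_int e1 * \<beta> ^ 2 + of_int e2 * \<beta> - of_int e3 = 0"
    using cubic_equation[of \<beta>] \<beta> e by simp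
  moreover have "\<beta> = \<delta> + of_int s" by (simp add: \<delta>_def)
  ultimately have cub': "(\<delta> + of_int s) ^ 3 - of_int e1 * (\<delta> + of_int s) ^ 2
     + of_int e2 * (\<delta> + of_int s) - of_int e3 = 0"
    by simp
  \<comment> \<open>Two cubic equations for \<open>\<delta>\<close> are subtracted: the one from the
    multiplication table and the Taylor expansion at \<open>s\<close> of the characteristic
    polynomial of \<open>\<beta>\<close>. Their coefficients therefore agree, and those from the
    table carry the factors \<open>n\<close> and \<open>n^2\<close>.\<close>
  have "of_int (s ^ 3 - e1 * s ^ 2 + e2 * s - e3 + n * p')
    + of_int (3 * s ^ 2 - 2 * e1 * s + e2 - (v' - n * q)) * \<delta>
    + of_int (3 * s - e1 - u') * \<delta> ^ 2
    = ((\<delta> + of_int s) ^ 3 - of_int e1 * (\<delta> + of_int s) ^ 2 + of_int e2 * (\<delta> + of_int s) - of_int e3)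
    - (\<delta> ^ 3 + of_int u' * \<delta> ^ 2 + of_int (v' - n * q) * \<delta> - of_int (n * p'))"
    by (simp add: power2_eq_square power3_eq_cube algebra_simps)
  then have "of_int (s ^ 3 - e1 * s ^ 2 + e2 * s - e3 + n * p')
    + of_int (3 * s ^ 2 - 2 * e1 * s + e2 - (v' - n * q)) * \<delta>
    + of_int (3 * s - e1 - u') * \<delta> ^ 2 = 0"
    unfolding cub cub' by simp
  from power_basis_independent[OF \<delta> this]
  have "3 * s ^ 2 - 2 * e1 * s + e2 = n * (c - 2 * q)" "s ^ 3 - e1 * s ^ 2 + e2 * s - e3 = n ^ 2 * (- b)"
    using np v' by (auto simp: algebra_simps)
  then show ?thesis using that dvd_triv_left by metis
qed

end

section \<open>Scaling\<close>

context cubic_embeddings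
begin

text \<open>Unlike \<open>abs_inf\<close>, this size is invariant under adding integers and also
  homogeneous, so it passes through \<open>\<alpha> = r + d \<beta>\<close> and is defined on
  classes modulo \<open>\<int>\<close>.\<close>

definition spread where
  "spread x = max (cmod (t1 x - t2 x)) (max (cmod (t1 x - t3 x)) (cmod (t2 x - t3 x)))"

lemma spread_ge:
  "cmod (t1 x - t2 x) \<le> spread x" "cmod (t1 x - t3 x) \<le> spread x" "cmod (t2 x - t3 x) \<le> spread x"
  by (auto simp: spread_def)

lemma spread_nonneg: "spread x \<ge> 0"
  using spread_ge(1)[of x] norm_ge_zero[of "t1 x - t2 x"] by linarith

lemma spread_affine:
  assumes "x \<in> K"
  shows "spread (of_int r + of_int d * x) = \<bar>of_int d\<bar> * spread x"
proof -
  have m: "\<bar>of_int d\<bar> * max a b = max (\<bar>of_int d\<bar> * a) (\<bar>of_int d\<bar> * b)" for a b :: real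
    by (simp add: max_mult_distrib_left)
  have *: "cmod (of_int d * a - of_int d * b) = \<bar>of_int d\<bar> * cmod (a - b)" for a b
    by (simp add: right_diff_distrib[symmetric] norm_mult)
  show ?thesis using assms by (simp add: spread_def m *)
qed

lemma spread_diff:
  assumes "x \<in> K" "y \<in> K"
  shows "spread (x - y) \<le> spread x + spread y"
proof -
  have *: "cmod (a - b - (c - d)) \<le> spread x + spread y"
    if "cmod (a - c) \<le> spread x" "cmod (b - d) \<le> spread y" for a b c d
    using norm_triangle_ineq4[of "a - c" "b - d"] that by (simp add: algebra_simps)
  have "cmod (t1 (x - y) - t2 (x - y)) \<le> spread x + spread y"
    "cmod (t1 (x - y) - t3 (x - y)) \<le> spread x + spread y"
    "cmod (t2 (x - y) - t3 (x - y)) \<le> spread x + spread y"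
    using assms by (simp_all add: * spread_ge)
  then show ?thesis unfolding spread_def[of "x - y"] by simp
qed

lemma abs_inf_ge:
  "cmod (t1 x) \<le> abs_inf K x" "cmod (t2 x) \<le> abs_inf K x" "cmod (t3 x) \<le> abs_inf K x"
  unfolding abs_inf_def embeddings_eq by (auto intro!: Max_ge)

lemma spread_le_abs_inf: "spread x \<le> 2 * abs_inf K x"
proof -
  have "cmod (a - b) \<le> 2 * B" if "cmod a \<le> B" "cmod b \<le> B" for a b B
    using norm_triangle_ineq4[of a b] that by linarith
  then show ?thesis unfolding spread_def using abs_inf_ge[of x] by simp
qed

lemma vandermonde_le_spread: "cmod (vandermonde x) \<le> spread x ^ 3"
proof -
  have "cmod (vandermonde x) = cmod (t1 x - t2 x) * cmod (t1 x - t3 x) * cmod (t2 x - t3 x)"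
    by (simp add: vandermonde_def norm_mult)
  also have "\<dots> \<le> spread x * spread x * spread x"
    by (intro mult_mono spread_ge mult_nonneg_nonneg spread_nonneg) auto
  finally show ?thesis by (simp add: power3_eq_cube)
qed

text \<open>\<open>vandermonde x ^ 2\<close> is a nonzero integer of absolute value at most the
  sixth power of the spread. The bound limits the possible multiples \<open>d\<close>.\<close>

lemma spread_ge_1:
  assumes "x \<in> ints" "x \<notin> \<int>"
  shows "spread x \<ge> 1"
proof (rule ccontr)
  assume "\<not> spread x \<ge> 1"
  then have "spread x ^ 3 < 1 ^ 3" by (intro power_strict_mono spread_nonneg) auto
  then have "cmod (vandermonde x) < 1" using vandermonde_le_spread[of x] by simp
  then have "cmod (vandermonde x ^ 2) < 1" by (simp add: norm_power power_less_one_iff)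
  moreover obtain d where d: "vandermonde x ^ 2 = of_int d"
    using vandermonde_square_Ints[OF assms(1)] by (auto elim: Ints_cases)
  moreover have "d \<noteq> 0" using d vandermonde_nonzero[OF assms] by auto
  ultimately show False by simp
qed

text \<open>Here reducedness enters: \<open>3 * t1 x\<close> is the trace plus two differences of
  conjugates, and the absolute value of the trace is at most
  \<open>1 \<le> spread x\<close>.\<close>

lemma conjugates_le_spread:
  assumes x: "x \<in> ints" "x \<notin> \<int>" "reduced K x"
  shows "cmod (t1 x) \<le> spread x" "cmod (t2 x) \<le> spread x" "cmod (t3 x) \<le> spread x"
proof -
  have tr: "cmod (tr x) \<le> 1" using x(3) by (auto simp: reduced_def trace_eq)
  have *: "cmod a \<le> spread x"
    if "a + b + c = tr x" "cmod (a - b) \<le> spread x" "cmod (a - c) \<le> spread x" for a b c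
  proof -
    have "3 * a = tr x + (a - b) + (a - c)" using that(1) by (simp add: algebra_simps)
    then have "cmod (3 * a) \<le> cmod (tr x) + cmod (a - b) + cmod (a - c)"
      by (metis norm_triangle_ineq norm_triangle_mono order_refl)
    then show ?thesis using that tr spread_ge_1[OF x(1,2)] by (simp add: norm_mult)
  qed
  show "cmod (t1 x) \<le> spread x"
    by (rule *[of _ "t2 x" "t3 x"]) (use spread_ge[of x] in \<open>simp_all add: tr_def\<close>)
  show "cmod (t2 x) \<le> spread x"
    by (rule *[of _ "t1 x" "t3 x"])
      (use spread_ge[of x] in \<open>simp_all add: tr_def norm_minus_commute\<close>)
  show "cmod (t3 x) \<le> spread x"
    by (rule *[of _ "t1 x" "t2 x"])
      (use spread_ge[of x] in \<open>simp_all add: tr_def norm_minus_commute algebra_simps\<close>)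
qed

lemma reduced_tr:
  assumes "reduced K x"
  shows "\<exists>i. tr x = of_int i \<and> \<bar>i\<bar> \<le> 1"
proof -
  have "tr x = of_int (-1) \<or> tr x = of_int 0 \<or> tr x = of_int 1"
    using assms by (simp add: reduced_def trace_eq)
  then show ?thesis by (elim disjE) (rule exI, rule conjI, assumption, simp)+
qed

text \<open>The traces differ by \<open>3 * k\<close>, but at most by 2.\<close>

lemma reduced_unique:
  assumes "reduced K x" "reduced K y" "x - y = of_int k"
  shows "x = y"
proof -
  have xy: "x \<in> ints" "y \<in> ints" using assms by (auto simp: reduced_def)
  have "tr (x - y) = 3 * of_int k" by (simp add: assms(3) tr_def)
  then have "tr x - tr y = of_int (3 * k)" using xy by (simp add: tr_def algebra_simps)
  moreover obtain i j where ij: "tr x = of_int i" "\<bar>i\<bar> \<le> 1" "tr y = of_int j" "\<bar>j\<bar> \<le> 1"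
    using reduced_tr[OF assms(1)] reduced_tr[OF assms(2)] by blast
  ultimately have "of_int (i - j) = (of_int (3 * k) :: complex)" by simp
  then have "i - j = 3 * k" by (simp only: of_int_eq_iff)
  then have "k = 0" using ij by arith
  then show ?thesis using assms(3) by simp
qed

definition spread_set where
  "spread_set V = {x \<in> ints - \<int>. reduced K x \<and> spread x < V}"

lemma S_set_subset_spread_set: "S_set K Y \<subseteq> spread_set (2 * Y)"
proof
  fix x assume "x \<in> S_set K Y"
  then show "x \<in> spread_set (2 * Y)"
    using spread_le_abs_inf[of x] by (auto simp: S_set_def spread_set_def)
qed

text \<open>Two elements with the same coordinates modulo \<open>N\<close> differ by \<open>N\<close> times an element of
  spread \<open>2 V / N\<close>, up to an integer.\<close>

lemma card_spread_set_scale: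
  assumes fin: "finite (spread_set (2 * V / real N))" and N: "N > 0"
  shows "finite (spread_set V)"
    and "card (spread_set V) \<le> N ^ 2 * (card (spread_set (2 * V / real N)) + 1)"
proof -
  let ?T = "spread_set (2 * V / real N)"
  have "finite (spread_set V) \<and> card (spread_set V) \<le> N ^ 2 * (card ?T + 1)"
  proof (cases "spread_set V = {}")
    case False
    then obtain \<alpha> where "\<alpha> \<in> ints" "\<alpha> \<notin> \<int>" by (auto simp: spread_set_def)
    then obtain \<beta> \<gamma> n u v where "adapted_basis \<beta> \<gamma> n u v" by (rule ex_adapted_basis)
    then have \<beta>\<gamma>: "\<beta> \<in> ints" "\<gamma> \<in> ints"
      and span: "\<And>x. x \<in> ints \<Longrightarrow> \<exists>a b c. x = of_int a + of_int b * \<beta> + of_int c * \<gamma>"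
      unfolding adapted_basis_def by blast+
    define F where "F = (\<lambda>(i, j). {x \<in> spread_set V. \<exists>a b c. x = of_int a + of_int b * \<beta> + of_int c * \<gamma>
      \<and> b mod int N = i \<and> c mod int N = j})"
    have F_iff: "x \<in> F (i, j) \<longleftrightarrow> x \<in> spread_set V \<and>
      (\<exists>a b c. x = of_int a + of_int b * \<beta> + of_int c * \<gamma> \<and> b mod int N = i \<and> c mod int N = j)" for x i j
      by (simp add: F_def)
    define I where "I = {0..<int N} \<times> {0..<int N}"
    have cover: "spread_set V \<subseteq> (\<Union>k\<in>I. F k)"
    proof
      fix x assume x: "x \<in> spread_set V"
      then have "x \<in> ints" by (simp add: spread_set_def)
      then obtain a b c where "x = of_int a + of_int b * \<beta> + of_int c * \<gamma>"
        using span by blast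
      then have "x \<in> F (b mod int N, c mod int N)" using x unfolding F_iff by blast
      then show "x \<in> (\<Union>k\<in>I. F k)" using N by (intro UN_I) (auto simp: I_def)
    qed
    have fiber: "finite (F k) \<and> card (F k) \<le> card ?T + 1" for k
    proof (cases "F k = {}")
      case False
      obtain i j where k: "k = (i, j)" by (cases k)
      obtain x0 a0 b0 c0 where x0: "x0 \<in> spread_set V" "x0 = of_int a0 + of_int b0 * \<beta> + of_int c0 * \<gamma>"
        "b0 mod int N = i" "c0 mod int N = j"
        using False F_iff unfolding k by blast
      have ex: "\<exists>y. y \<in> insert 0 ?T \<and> (\<exists>m. x = x0 + of_int m + of_int N * y)" if x: "x \<in> F k" for x
      proof -
        obtain a b c where xV: "x \<in> spread_set V" "x = of_int a + of_int b * \<beta> + of_int c * \<gamma>"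
          "b mod int N = i" "c mod int N = j"
          using x F_iff unfolding k by blast
        have "b mod int N = b0 mod int N" "c mod int N = c0 mod int N" using xV x0 by auto
        then obtain p q where pq: "b - b0 = int N * p" "c - c0 = int N * q"
          unfolding mod_eq_dvd_iff by (auto elim!: dvdE)
        define y where "y = of_int p * \<beta> + of_int q * \<gamma>"
        have y: "y \<in> ints" using \<beta>\<gamma> by (simp add: y_def)
        obtain m where m: "reduced K (y - of_int m)" using ex_reduced_shift[OF y] .
        have "x - x0 = of_int (a - a0) + of_int (b - b0) * \<beta> + of_int (c - c0) * \<gamma>"
          unfolding xV(2) x0(2) by (simp add: algebra_simps)
        also have "\<dots> = of_int (a - a0) + of_int N * y"
          unfolding pq y_def by (simp add: algebra_simps)
        finally have xx0: "x - x0 = of_int (a - a0 + int N * m) + of_int (int N) * (y - of_int m)"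
          by (simp add: algebra_simps)
        \<comment> \<open>The value 0 occurs when \<open>x\<close> and \<open>x0\<close> differ by
          an integer; it lies outside \<open>?T\<close>, which contains no integers, and is the
          reason for the extra 1 in the count.\<close>
        have "y - of_int m \<in> insert 0 ?T"
        proof (cases "y - of_int m \<in> \<int>")
          case True
          then obtain l where "y - of_int m = of_int l" by (rule Ints_cases)
          moreover have "reduced K 0" by (simp add: reduced_def trace_eq tr_def)
             (metis ints_of_int of_int_0)
          ultimately have "y - of_int m = 0" using reduced_unique[OF m, of 0 l] by simp
          then show ?thesis by simp
        next
          case False
          have "spread (x - x0) = real N * spread (y - of_int m)"
            unfolding xx0 using y by (subst spread_affine) simp_all
          moreover have "spread (x - x0) < 2 * V"
            using spread_diff[of x x0] xV(1) x0(1) by (auto simp: spread_set_def)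
          ultimately have "spread (y - of_int m) < 2 * V / real N"
            using N by (simp add: field_simps)
          then show ?thesis using False y m by (simp add: spread_set_def)
        qed
        moreover have "x = x0 + of_int (a - a0 + int N * m) + of_int N * (y - of_int m)"
          using xx0 by (simp add: algebra_simps)
        ultimately show ?thesis by blast
      qed
      define g where "g x = (SOME y. y \<in> insert 0 ?T \<and> (\<exists>m. x = x0 + of_int m + of_int N * y))" for x
      have g: "g x \<in> insert 0 ?T" "\<exists>m. x = x0 + of_int m + of_int N * g x" if "x \<in> F k" for x
        using someI_ex[OF ex[OF that]] unfolding g_def by blast+
      have inj: "inj_on g (F k)"
      proof (rule inj_onI)
        fix x x' assume x: "x \<in> F k" "x' \<in> F k" "g x = g x'"
        obtain m where m: "x = x0 + of_int m + of_int N * g x" using g(2)[OF x(1)] by blast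
        obtain m' where m': "x' = x0 + of_int m' + of_int N * g x'" using g(2)[OF x(2)] by blast
        have "x - x' = of_int (m - m')" by (subst m, subst m', subst x(3)) (simp add: algebra_simps)
        moreover have "reduced K x" "reduced K x'" using x by (auto simp: F_def spread_set_def k)
        ultimately show "x = x'" using reduced_unique by blast
      qed
      have "g ` F k \<subseteq> insert 0 ?T" using g(1) by blast
      then have "finite (F k)" "card (F k) \<le> card (insert 0 ?T)"
        using fin inj by (auto intro: inj_on_finite card_inj_on_le)
      then show ?thesis using card_insert_le_m1[of "card ?T + 1" ?T 0] by auto
    qed simp
    have finI: "finite I" by (simp add: I_def)
    have finU: "finite (\<Union>k\<in>I. F k)" using finI fiber by blast
    have "card (spread_set V) \<le> card (\<Union>k\<in>I. F k)" by (rule card_mono[OF finU cover])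
    also have "\<dots> \<le> (\<Sum>k\<in>I. card (F k))" by (rule card_UN_le[OF finI])
    also have "\<dots> \<le> (\<Sum>k\<in>I. card ?T + 1)" using fiber by (intro sum_mono) blast
    also have "\<dots> = N ^ 2 * (card ?T + 1)" by (simp add: I_def card_cartesian_product power2_eq_square)
    finally show ?thesis using finite_subset[OF cover finU] by blast
  qed simp
  then show "finite (spread_set V)" "card (spread_set V) \<le> N ^ 2 * (card ?T + 1)" by blast+
qed

lemma spread_set_decompose:
  assumes "\<alpha> \<in> spread_set V"
  obtains \<beta> \<gamma> n u v d r where "adapted_basis \<beta> \<gamma> n u v" "reduced K \<beta>" "d > 0"
    "\<alpha> = of_int r + of_int d * \<beta>" "spread \<beta> < V / of_int d" "of_int d < V"
proof -
  have \<alpha>: "\<alpha> \<in> ints" "\<alpha> \<notin> \<int>" "spread \<alpha> < V" using assms by (auto simp: spread_set_def)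
  obtain \<beta> \<gamma> n u v d r where ab: "adapted_basis \<beta> \<gamma> n u v" "reduced K \<beta>" "d > 0"
    "\<alpha> = of_int r + of_int d * \<beta>"
    using ex_adapted_basis[OF \<alpha>(1,2)] .
  have \<beta>: "\<beta> \<in> ints" "\<beta> \<notin> \<int>" using ab(1) by (auto simp: adapted_basis_def)
  have sp: "spread \<alpha> = of_int d * spread \<beta>" unfolding ab(4) using \<beta> \<open>d > 0\<close> by (subst spread_affine) auto
  have "spread \<beta> < V / of_int d" using \<alpha>(3) ab(3) sp by (simp add: field_simps)
  moreover have "of_int d * 1 \<le> of_int d * spread \<beta>"
    using spread_ge_1[OF \<beta>] ab(3) by (intro mult_left_mono) auto
  then have "of_int d < V" using \<alpha>(3) sp by simp
  ultimately show ?thesis using ab that by blast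
qed

end

section \<open>Characteristic polynomials of bounded size\<close>

definition cubic_disc :: "int \<Rightarrow> int \<Rightarrow> int \<Rightarrow> int" where
  "cubic_disc e1 e2 e3 = e1^2 * e2^2 - 4 * e2^3 - 4 * e1^3 * e3 + 18 * e1 * e2 * e3 - 27 * e3^2"

text \<open>The triple stands for \<open>x^3 - e1 x^2 + e2 x - e3\<close>, and no field is
  mentioned. \<open>3 * U^2\<close> bounds the three products of two conjugates;
  \<open>n^2 * Z \<le> 2 * U^6\<close> combines \<open>n^2 |\<Delta>| \<le> U^6\<close> with
  \<open>Z \<le> 2 |\<Delta>|\<close>. The constant coefficient is limited through the
  discriminant.\<close>

definition bounded_cubics :: "real \<Rightarrow> real \<Rightarrow> (int \<times> int \<times> int) set" where
  "bounded_cubics U Z = {(e1, e2, e3). e1 \<in> {-1, 0, 1} \<and> \<bar>of_int e2\<bar> \<le> 3 * U^2 \<and>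
     (\<exists>n s. n > 0 \<and> of_int n ^ 2 * Z \<le> 2 * U ^ 6 \<and>
        n dvd 3 * s^2 - 2 * e1 * s + e2 \<and> n^2 dvd s^3 - e1 * s^2 + e2 * s - e3 \<and>
        \<bar>of_int (cubic_disc e1 e2 e3)\<bar> \<le> of_int n ^ 2 * Z)}"

definition cubic_roots :: "(int \<times> int \<times> int) \<Rightarrow> complex set" where
  "cubic_roots = (\<lambda>(e1, e2, e3). {z. z^3 - of_int e1 * z^2 + of_int e2 * z - of_int e3 = 0})"

context cubic_embeddings
begin

lemma adapted_basis_bounded_cubic:
  assumes ab: "adapted_basis \<beta> \<gamma> n u v" and red: "reduced K \<beta>" and U: "spread \<beta> < U"
    and Z: "cmod (discriminant K) \<le> Z" "Z \<le> 2 * cmod (discriminant K)"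
  shows "\<exists>e\<in>bounded_cubics U Z. \<beta> \<in> cubic_roots e"
proof -
  have \<beta>: "\<beta> \<in> ints" "\<beta> \<notin> \<int>" and n: "n > 0" using ab unfolding adapted_basis_def by blast+
  obtain e1 where e1: "tr \<beta> = of_int e1" using tr_Ints[OF \<beta>(1)] by (auto elim: Ints_cases)
  obtain e2 where e2: "sym2 \<beta> = of_int e2" using sym2_Ints[OF \<beta>(1)] by (auto elim: Ints_cases)
  obtain e3 where e3: "field_norm \<beta> = of_int e3" using field_norm_Ints[OF \<beta>(1)] by (auto elim: Ints_cases)
  obtain s where s: "n dvd 3 * s ^ 2 - 2 * e1 * s + e2" "n ^ 2 dvd s ^ 3 - e1 * s ^ 2 + e2 * s - e3"
    using adapted_basis_double_root[OF ab e1 e2 e3] .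
  have "vandermonde \<beta> ^ 2 = of_int (cubic_disc e1 e2 e3)"
    unfolding vandermonde_square e1 e2 e3 cubic_disc_def by simp
  then have D: "\<bar>of_int (cubic_disc e1 e2 e3)\<bar> = cmod (vandermonde \<beta> ^ 2)" by simp
  also have D': "\<dots> = of_int n ^ 2 * cmod (discriminant K)"
    unfolding discriminant_adapted_basis[OF ab, symmetric] by (simp add: norm_mult norm_power)
  also have "\<dots> \<le> of_int n ^ 2 * Z" using Z(1) by (intro mult_left_mono) auto
  finally have disc: "\<bar>of_int (cubic_disc e1 e2 e3)\<bar> \<le> of_int n ^ 2 * Z" .
  have B: "spread \<beta> \<ge> 0" by (rule spread_nonneg)
  have "of_int n ^ 2 * Z \<le> 2 * cmod (vandermonde \<beta> ^ 2)"
    using mult_left_mono[OF Z(2), of "of_int n ^ 2"] D' by simp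
  also have "cmod (vandermonde \<beta> ^ 2) \<le> (spread \<beta> ^ 3) ^ 2"
    unfolding norm_power by (intro power_mono vandermonde_le_spread) auto
  also have "(spread \<beta> ^ 3) ^ 2 = spread \<beta> ^ 6" by (simp flip: power_mult)
  also have "\<dots> \<le> U ^ 6" using U B by (intro power_mono) auto
  finally have n2: "of_int n ^ 2 * Z \<le> 2 * U ^ 6" by simp
  note c = conjugates_le_spread[OF \<beta> red]
  have prod: "cmod (a * b) \<le> U ^ 2" if "cmod a \<le> spread \<beta>" "cmod b \<le> spread \<beta>" for a b
  proof -
    have "cmod (a * b) \<le> spread \<beta> * spread \<beta>" unfolding norm_mult using that B by (intro mult_mono) auto
    also have "\<dots> \<le> U * U" using U B by (intro mult_mono) auto
    finally show ?thesis by (simp add: power2_eq_square)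
  qed
  have "cmod (sym2 \<beta>) \<le> cmod (t1 \<beta> * t2 \<beta>) + cmod (t1 \<beta> * t3 \<beta>) + cmod (t2 \<beta> * t3 \<beta>)"
    unfolding sym2_def by (intro norm_triangle_mono order_refl)
  also have "\<dots> \<le> 3 * U ^ 2" using prod[OF c(1,2)] prod[OF c(1,3)] prod[OF c(2,3)] by simp
  finally have "\<bar>of_int e2\<bar> \<le> 3 * U ^ 2" using e2 by simp
  moreover have "(of_int e1 :: complex) \<in> {of_int (-1), of_int 0, of_int 1}"
    using red e1 by (simp add: reduced_def trace_eq)
  then have "e1 \<in> {-1, 0, 1}" by (simp only: insert_iff of_int_eq_iff empty_iff)
  ultimately have "(e1, e2, e3) \<in> bounded_cubics U Z"
    using n n2 s disc unfolding bounded_cubics_def by blast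
  moreover have "\<beta> \<in> cubic_roots (e1, e2, e3)"
    using cubic_equation[of \<beta>] \<beta> by (simp add: cubic_roots_def e1 e2 e3)
  ultimately show ?thesis by blast
qed

end

section \<open>Counting cubic polynomials\<close>

text \<open>Only differences of elements enter, so the position of the interval containing
  \<open>A\<close> is irrelevant.\<close>

lemma card_congruent_bounded:
  fixes A :: "int set" and L :: real
  assumes m: "m > 0" and L: "L \<ge> 0"
    and cong: "\<And>x y. x \<in> A \<Longrightarrow> y \<in> A \<Longrightarrow> m dvd x - y"
    and bound: "\<And>x y. x \<in> A \<Longrightarrow> y \<in> A \<Longrightarrow> of_int (x - y) \<le> L"
  shows "finite A" "real (card A) \<le> L / of_int m + 1"
proof -
  have "finite A \<and> real (card A) \<le> L / of_int m + 1"
  proof (cases "A = {}")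
    case False
    then obtain x0 where x0: "x0 \<in> A" by blast
    have "A \<subseteq> {x0 - \<lfloor>L\<rfloor>..x0 + \<lfloor>L\<rfloor>}"
    proof
      fix x assume "x \<in> A"
      then have "x - x0 \<le> \<lfloor>L\<rfloor>" "x0 - x \<le> \<lfloor>L\<rfloor>" using bound x0 by (simp_all only: le_floor_iff)
      then show "x \<in> {x0 - \<lfloor>L\<rfloor>..x0 + \<lfloor>L\<rfloor>}" by simp
    qed
    then have fin: "finite A" by (rule finite_subset) simp
    define a where "a = Min A"
    have a: "a \<in> A" "\<And>x. x \<in> A \<Longrightarrow> a \<le> x" using fin False by (simp_all add: a_def)
    define g where "g x = (x - a) div m" for x
    have gm: "x = a + m * g x" if "x \<in> A" for x using cong[OF that a(1)] by (simp add: g_def)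
    have "g ` A \<subseteq> {0..\<lfloor>L / of_int m\<rfloor>}"
    proof (intro image_subsetI)
      fix x assume x: "x \<in> A"
      have "0 \<le> g x" using a(2)[OF x] m by (simp add: g_def pos_imp_zdiv_nonneg_iff)
      have "of_int m * of_int (g x) = (of_int (x - a) :: real)"
        using arg_cong[OF gm[OF x], of real_of_int] by simp
      then have "of_int (g x) \<le> L / of_int m" using bound[OF x a(1)] m by (simp add: field_simps)
      then show "g x \<in> {0..\<lfloor>L / of_int m\<rfloor>}" using \<open>0 \<le> g x\<close> by (simp add: le_floor_iff)
    qed
    moreover have "inj_on g A" using gm by (metis inj_onI)
    ultimately have "card A \<le> card {0..\<lfloor>L / of_int m\<rfloor>}" by (intro card_inj_on_le) auto
    also have "\<dots> = nat (\<lfloor>L / of_int m\<rfloor> + 1)" by simp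
    finally have "real (card A) \<le> real (nat (\<lfloor>L / of_int m\<rfloor> + 1))" by simp
    also have "\<dots> = of_int \<lfloor>L / of_int m\<rfloor> + 1"
    proof -
      have "\<lfloor>L / of_int m\<rfloor> \<ge> 0" using L m by simp
      then show ?thesis by simp
    qed
    also have "\<dots> \<le> L / of_int m + 1" by simp
    finally show ?thesis using fin by blast
  qed (use L m in simp)
  then show "finite A" "real (card A) \<le> L / of_int m + 1" by blast+
qed

text \<open>On one side of the vertex \<open>e\<close> of a parabola, \<open>|x - y|\<close> is at
  most \<open>|(x - e) + (y - e)|\<close>, and the product of the two is the difference of the
  squares. A range of values of length \<open>T\<close> thus leaves arguments in a range of length
  at most \<open>sqrt T\<close>, wherever the vertex lies.\<close>

lemma same_side_of_vertex:
  fixes x y e :: real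
  assumes "0 \<le> (x - e) * (y - e)"
  shows "(x - y)^2 \<le> \<bar>(x - e)^2 - (y - e)^2\<bar>"
proof -
  have "(x - y)^2 \<le> ((x - e) + (y - e))^2"
    using assms by (simp add: power2_eq_square algebra_simps)
  then have "\<bar>x - y\<bar> \<le> \<bar>(x - e) + (y - e)\<bar>" by (simp add: abs_le_square_iff)
  then have "\<bar>x - y\<bar> * \<bar>x - y\<bar> \<le> \<bar>x - y\<bar> * \<bar>(x - e) + (y - e)\<bar>" by (intro mult_left_mono) auto
  also have "\<dots> = \<bar>(x - e)^2 - (y - e)^2\<bar>"
    by (simp flip: abs_mult add: power2_eq_square algebra_simps)
  finally show ?thesis by (simp add: power2_eq_square flip: abs_mult)
qed

text \<open>The discriminant is quadratic in \<open>e3\<close> with leading coefficient -27, so each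
  side of its vertex contributes one residue class modulo \<open>m\<close> in a range of length
  \<open>sqrt (2 * T / 27) \<le> sqrt T\<close>.\<close>

lemma card_bounded_disc:
  fixes T :: real and m c e1 e2 :: int
  assumes m: "m > 0" and T: "T \<ge> 0"
  defines "A \<equiv> {e3. m dvd c - e3 \<and> \<bar>of_int (cubic_disc e1 e2 e3)\<bar> \<le> T}"
  shows "finite A" "real (card A) \<le> 2 * (sqrt T / of_int m + 1)"
proof -
  \<comment> \<open>The vertex, found by completing the square in \<open>e3\<close>.\<close>
  define v where "v = (18 * of_int e1 * of_int e2 - 4 * of_int e1 ^ 3) / (54 :: real)"
  have disc: "of_int (cubic_disc e1 e2 e3) = of_int (cubic_disc e1 e2 0) + 27 * v^2 - 27 * (of_int e3 - v)^2" for e3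
    by (simp add: cubic_disc_def v_def power2_eq_square field_simps)
  define A1 where "A1 = {e3 \<in> A. of_int e3 \<ge> v}"
  define A2 where "A2 = {e3 \<in> A. of_int e3 < v}"
  have cong: "m dvd x - y" if "x \<in> A" "y \<in> A" for x y
    using that dvd_diff[of m "c - y" "c - x"] by (simp add: A_def)
  have bound: "of_int (x - y) \<le> sqrt T"
    if "x \<in> A" "y \<in> A" "0 \<le> (of_int x - v) * (of_int y - v)" for x y
  proof -
    have "(of_int (x - y))^2 \<le> \<bar>(of_int x - v)^2 - (of_int y - v)^2\<bar>"
      using same_side_of_vertex[OF that(3)] by simp
    also have "\<dots> = \<bar>of_int (cubic_disc e1 e2 y) - of_int (cubic_disc e1 e2 x)\<bar> / 27"
      unfolding disc[of x] disc[of y] by (simp add: abs_if)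
    also have "\<dots> \<le> (2 * T) / 27"
    proof -
      have "\<bar>of_int (cubic_disc e1 e2 y) - of_int (cubic_disc e1 e2 x)\<bar> \<le> 2 * T"
        using that(1,2) abs_triangle_ineq4[of "real_of_int (cubic_disc e1 e2 y)" "of_int (cubic_disc e1 e2 x)"]
        by (simp add: A_def)
      then show ?thesis by (rule divide_right_mono) simp
    qed
    also have "\<dots> \<le> T" using T by simp
    finally show ?thesis by (rule real_le_rsqrt)
  qed
  have side: "finite B" "real (card B) \<le> sqrt T / of_int m + 1"
    if "B \<subseteq> A" "\<And>x y. x \<in> B \<Longrightarrow> y \<in> B \<Longrightarrow> 0 \<le> (of_int x - v) * (of_int y - v)" for B
  proof -
    have "0 \<le> sqrt T" using T by simp
    moreover have "m dvd x - y" if "x \<in> B" "y \<in> B" for x y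
      using cong[of x y] that \<open>B \<subseteq> A\<close> by blast
    moreover have "of_int (x - y) \<le> sqrt T" if "x \<in> B" "y \<in> B" for x y
      using bound[of x y] that \<open>B \<subseteq> A\<close> \<open>\<And>x y. x \<in> B \<Longrightarrow> y \<in> B \<Longrightarrow> 0 \<le> (of_int x - v) * (of_int y - v)\<close>
      by blast
    ultimately show "finite B" "real (card B) \<le> sqrt T / of_int m + 1"
      using card_congruent_bounded[OF m, of "sqrt T" B] by blast+
  qed
  have A1: "finite A1" "real (card A1) \<le> sqrt T / of_int m + 1"
    by (rule side; auto simp: A1_def)+
  have A2: "finite A2" "real (card A2) \<le> sqrt T / of_int m + 1"
    by (rule side; auto simp: A2_def mult_nonpos_nonpos)+
  have A: "A = A1 \<union> A2" by (auto simp: A1_def A2_def)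
  show "finite A" using A A1 A2 by simp
  have "card A \<le> card A1 + card A2" unfolding A by (rule card_Un_le)
  then have "real (card A) \<le> real (card A1) + real (card A2)" by linarith
  then show "real (card A) \<le> 2 * (sqrt T / of_int m + 1)"
    using order_trans[OF _ add_mono[OF A1(2) A2(2)]] by (simp add: algebra_simps)
qed

text \<open>\<open>r\<close> is a candidate for the double root. For fixed \<open>r\<close> the
  first congruence determines \<open>e2\<close> modulo \<open>n\<close>, and the second then
  determines \<open>e3\<close> modulo \<open>n^2\<close>, hence the dependent sum.\<close>

definition cubics_at :: "real \<Rightarrow> real \<Rightarrow> int \<Rightarrow> int \<Rightarrow> int \<Rightarrow> (int \<times> int) set" where
  "cubics_at B Z n e1 r = (SIGMA e2:{e2. n dvd 3 * r^2 - 2 * e1 * r + e2 \<and> \<bar>of_int e2\<bar> \<le> B}.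
     {e3. n^2 dvd r^3 - e1 * r^2 + e2 * r - e3 \<and> \<bar>of_int (cubic_disc e1 e2 e3)\<bar> \<le> of_int n ^ 2 * Z})"

lemma card_cubics_at:
  assumes n: "n > 0" and B: "B \<ge> 0" and Z: "Z \<ge> 0"
  shows "finite (cubics_at B Z n e1 r)"
    "real (card (cubics_at B Z n e1 r)) \<le> (2 * B / of_int n + 1) * (2 * (sqrt Z / of_int n + 1))"
proof -
  let ?E = "{e2. n dvd 3 * r^2 - 2 * e1 * r + e2 \<and> \<bar>of_int e2\<bar> \<le> B}"
  let ?F = "\<lambda>e2. {e3. n^2 dvd r^3 - e1 * r^2 + e2 * r - e3 \<and> \<bar>of_int (cubic_disc e1 e2 e3)\<bar> \<le> of_int n ^ 2 * Z}"
  have E: "finite ?E" "real (card ?E) \<le> 2 * B / of_int n + 1"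
  proof -
    have "0 \<le> 2 * B" using B by simp
    moreover have "n dvd x - y" if "x \<in> ?E" "y \<in> ?E" for x y
      using that dvd_diff[of n "3 * r^2 - 2 * e1 * r + x" "3 * r^2 - 2 * e1 * r + y"] by simp
    moreover have "of_int (x - y) \<le> 2 * B" if "x \<in> ?E" "y \<in> ?E" for x y using that by auto
    ultimately show "finite ?E" "real (card ?E) \<le> 2 * B / of_int n + 1"
      using card_congruent_bounded[OF n, of "2 * B" ?E] by blast+
  qed
  have F: "finite (?F e2)" "real (card (?F e2)) \<le> 2 * (sqrt Z / of_int n + 1)" for e2
  proof -
    have "sqrt (of_int n ^ 2 * Z) / of_int (n ^ 2) = sqrt Z / of_int n"
      using n by (simp add: real_sqrt_mult power2_eq_square)
    then show "finite (?F e2)" "real (card (?F e2)) \<le> 2 * (sqrt Z / of_int n + 1)"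
      using card_bounded_disc[of "n^2" "of_int n ^ 2 * Z" "r^3 - e1 * r^2 + e2 * r" e1 e2] n Z by simp_all
  qed
  show "finite (cubics_at B Z n e1 r)" unfolding cubics_at_def by (rule finite_SigmaI) (use E F in auto)
  have "real (card (cubics_at B Z n e1 r)) = (\<Sum>e2\<in>?E. real (card (?F e2)))"
    unfolding cubics_at_def using E F by (subst card_SigmaI) auto
  also have "\<dots> \<le> (\<Sum>e2\<in>?E. 2 * (sqrt Z / of_int n + 1))" by (intro sum_mono F)
  also have "\<dots> = real (card ?E) * (2 * (sqrt Z / of_int n + 1))" by simp
  also have "\<dots> \<le> (2 * B / of_int n + 1) * (2 * (sqrt Z / of_int n + 1))"
    by (intro mult_right_mono E) (use n Z in simp)
  finally show "real (card (cubics_at B Z n e1 r)) \<le> (2 * B / of_int n + 1) * (2 * (sqrt Z / of_int n + 1))" .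
qed

text \<open>In the Taylor expansion of \<open>f(s - n * k)\<close> at \<open>s\<close> the linear
  term is a multiple of \<open>n * f'(s)\<close>, which is divisible by \<open>n^2\<close> thanks to
  the first congruence. So only \<open>n\<close> residues have to be considered as double
  roots.\<close>

lemma double_root_mod:
  fixes n :: int
  assumes "n dvd 3 * s^2 - 2 * e1 * s + e2" "n^2 dvd s^3 - e1 * s^2 + e2 * s - e3"
  shows "n dvd 3 * (s mod n)^2 - 2 * e1 * (s mod n) + e2"
    "n^2 dvd (s mod n)^3 - e1 * (s mod n)^2 + e2 * (s mod n) - e3"
proof -
  define k where "k = s div n"
  have r: "s mod n = s - n * k" by (simp add: k_def minus_mult_div_eq_mod)
  obtain a where a: "3 * s^2 - 2 * e1 * s + e2 = n * a" using assms(1) ..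
  obtain b where b: "s^3 - e1 * s^2 + e2 * s - e3 = n^2 * b" using assms(2) ..
  have "3 * (s mod n)^2 - 2 * e1 * (s mod n) + e2
     = (3 * s^2 - 2 * e1 * s + e2) + n * (- 6 * s * k + 3 * n * k^2 + 2 * e1 * k)"
    unfolding r by (simp add: power2_eq_square algebra_simps)
  also have "\<dots> = n * (a - 6 * s * k + 3 * n * k^2 + 2 * e1 * k)" unfolding a by (simp add: algebra_simps)
  finally show "n dvd 3 * (s mod n)^2 - 2 * e1 * (s mod n) + e2" by simp
  have "(s mod n)^3 - e1 * (s mod n)^2 + e2 * (s mod n) - e3
     = (s^3 - e1 * s^2 + e2 * s - e3) - n * k * (3 * s^2 - 2 * e1 * s + e2) + n^2 * (k^2 * (3 * s - e1) - n * k^3)"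
    unfolding r by (simp add: power2_eq_square power3_eq_cube algebra_simps)
  also have "\<dots> = n^2 * (b - k * a + (k^2 * (3 * s - e1) - n * k^3))"
    unfolding a b by (simp add: power2_eq_square algebra_simps)
  finally show "n^2 dvd (s mod n)^3 - e1 * (s mod n)^2 + e2 * (s mod n) - e3" by simp
qed

lemma bounded_cubics_cover:
  assumes Z: "Z > 0" and M: "\<And>n :: int. n > 0 \<Longrightarrow> of_int n ^ 2 * Z \<le> 2 * U ^ 6 \<Longrightarrow> n \<le> int M"
  shows "bounded_cubics U Z \<subseteq> (\<Union>n\<in>{1..M}. \<Union>e1\<in>{-1, 0, 1}. \<Union>r\<in>{0..<int n}.
     Pair e1 ` cubics_at (3 * U^2) Z (int n) e1 r)"
proof
  fix e assume "e \<in> bounded_cubics U Z"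
  then obtain e1 e2 e3 n s where e: "e = (e1, e2, e3)" and e1: "e1 \<in> {-1, 0, 1}"
    and e2: "\<bar>of_int e2\<bar> \<le> 3 * U^2" and n: "n > 0" "of_int n ^ 2 * Z \<le> 2 * U ^ 6"
    and s: "n dvd 3 * s^2 - 2 * e1 * s + e2" "n^2 dvd s^3 - e1 * s^2 + e2 * s - e3"
    and d: "\<bar>of_int (cubic_disc e1 e2 e3)\<bar> \<le> of_int n ^ 2 * Z"
    unfolding bounded_cubics_def by blast
  have nM: "nat n \<in> {1..M}" and nn: "int (nat n) = n" using n M[OF n] by auto
  have r: "s mod n \<in> {0..<int (nat n)}" using n by simp
  have "(e2, e3) \<in> cubics_at (3 * U^2) Z (int (nat n)) e1 (s mod n)"
    using e2 d double_root_mod[OF s] unfolding cubics_at_def nn by simp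
  then show "e \<in> (\<Union>n\<in>{1..M}. \<Union>e1\<in>{-1, 0, 1}. \<Union>r\<in>{0..<int n}.
     Pair e1 ` cubics_at (3 * U^2) Z (int n) e1 r)"
    unfolding e using nM e1 r by blast
qed

lemma real_card_UN_le:
  "finite I \<Longrightarrow> real (card (\<Union>i\<in>I. A i)) \<le> (\<Sum>i\<in>I. real (card (A i)))"
  unfolding of_nat_sum[symmetric] of_nat_le_iff by (rule card_UN_le)

lemma card_bounded_cubics_sum:
  assumes Z: "Z > 0" and M: "\<And>n :: int. n > 0 \<Longrightarrow> of_int n ^ 2 * Z \<le> 2 * U ^ 6 \<Longrightarrow> n \<le> int M"
  shows "finite (bounded_cubics U Z)"
    "real (card (bounded_cubics U Z)) \<le> (\<Sum>n=1..M. 6 * (6 * U^2 + real n) * (sqrt Z / real n + 1))"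
proof -
  let ?C = "\<lambda>n e1 r. Pair e1 ` cubics_at (3 * U^2) Z (int n) e1 r"
  let ?B = "\<lambda>n. (6 * U^2 / real n + 1) * (2 * (sqrt Z / real n + 1))"
  have C: "finite (?C n e1 r)" "real (card (?C n e1 r)) \<le> ?B n" if "n \<in> {1..M}" for n e1 r
  proof -
    have *: "finite (cubics_at (3 * U^2) Z (int n) e1 r)" "real (card (cubics_at (3 * U^2) Z (int n) e1 r)) \<le> ?B n"
      using card_cubics_at[of "int n" "3 * U^2" Z e1 r] that Z by simp_all
    then show "finite (?C n e1 r)" by simp
    have "card (?C n e1 r) = card (cubics_at (3 * U^2) Z (int n) e1 r)"
      by (rule card_image) (simp add: inj_on_def)
    then show "real (card (?C n e1 r)) \<le> ?B n" using * by simp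
  qed
  let ?D = "\<lambda>n. \<Union>e1\<in>{-1, 0, 1}. \<Union>r\<in>{0..<int n}. ?C n e1 r"
  have fin: "finite (\<Union>n\<in>{1..M}. ?D n)" using C(1) by (intro finite_UN_I) auto
  show "finite (bounded_cubics U Z)"
    by (rule finite_subset[OF bounded_cubics_cover[OF Z M] fin])
  have inner: "real (card (?D n)) \<le> 6 * (6 * U^2 + real n) * (sqrt Z / real n + 1)" if n: "n \<in> {1..M}" for n
  proof -
    have "real (card (?D n)) \<le> (\<Sum>e1\<in>{-1, 0, 1}. real (card (\<Union>r\<in>{0..<int n}. ?C n e1 r)))"
      by (rule real_card_UN_le) simp
    also have "\<dots> \<le> (\<Sum>e1\<in>{-1, 0, 1}. \<Sum>r\<in>{0..<int n}. real (card (?C n e1 r)))"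
      by (intro sum_mono real_card_UN_le) simp
    also have "\<dots> \<le> (\<Sum>e1\<in>{-1, 0, 1 :: int}. \<Sum>r\<in>{0..<int n}. ?B n)"
      by (intro sum_mono C(2) n)
    \<comment> \<open>Three traces and \<open>n\<close> residues; the factor \<open>n\<close>
      cancels the denominator in the count of \<open>e2\<close>.\<close>
    also have "\<dots> = 3 * (real n * ?B n)" by simp
    also have "\<dots> = 6 * (6 * U^2 + real n) * (sqrt Z / real n + 1)"
    proof -
      have "3 * (N * ((6 * a / N + 1) * (2 * b))) = 6 * (6 * a + N) * b" if "N > 0" for N a b :: real
        using that by (simp add: divide_simps)
      from this[of "real n" "U^2" "sqrt Z / real n + 1"] show ?thesis using n by simp
    qed
    finally show ?thesis .
  qed
  have "real (card (bounded_cubics U Z)) \<le> real (card (\<Union>n\<in>{1..M}. ?D n))"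
    unfolding of_nat_le_iff by (rule card_mono[OF fin bounded_cubics_cover[OF Z M]])
  also have "\<dots> \<le> (\<Sum>n=1..M. real (card (?D n)))" by (rule real_card_UN_le) simp
  also have "\<dots> \<le> (\<Sum>n=1..M. 6 * (6 * U^2 + real n) * (sqrt Z / real n + 1))"
    by (intro sum_mono inner)
  finally show "real (card (bounded_cubics U Z)) \<le> (\<Sum>n=1..M. 6 * (6 * U^2 + real n) * (sqrt Z / real n + 1))" .
qed

lemma sum_inverse_le_ln: "n \<ge> 1 \<Longrightarrow> (\<Sum>k=1..n. 1 / real k) \<le> 1 + ln (real n)"
proof (induction n rule: nat_induct_at_least)
  case (Suc n)
  have "ln (real n / real (Suc n)) \<le> real n / real (Suc n) - 1"
    using Suc.hyps by (intro ln_le_minus_one) simp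
  then have "ln (real n) - ln (real (Suc n)) \<le> real n / real (Suc n) - 1"
    using Suc.hyps by (simp add: ln_div)
  also have "\<dots> = - (1 / real (Suc n))" by (simp add: field_simps)
  finally show ?case using Suc.IH by simp
qed simp

text \<open>Here \<open>q\<close> stands for \<open>Z^(1/4)\<close>. The assumption
  \<open>U \<le> \<kappa> * q\<close> gives \<open>n \<le> 2 * \<kappa> * U^2\<close> and
  \<open>n \<le> 2 * \<kappa>^3 * q\<close> for every admissible \<open>n\<close>, so both rounding
  terms are absorbed, and what is left is a harmonic sum.\<close>

lemma card_bounded_cubics:
  fixes \<kappa> q U :: real
  assumes \<kappa>: "\<kappa> \<ge> 1" and q: "q \<ge> 1" and U: "U > 0" "U \<le> \<kappa> * q"
  shows "finite (bounded_cubics U (q ^ 4))"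
    "real (card (bounded_cubics U (q ^ 4))) \<le> 144 * \<kappa> ^ 4 * U^2 * q^2 * (1 + ln (2 * \<kappa>^3 * q))"
proof -
  have \<kappa>0: "\<kappa> > 0" and q0: "q > 0" using \<kappa> q by auto
  define M where "M = nat \<lfloor>2 * U^3 / q^2\<rfloor>"
  have M: "n \<le> int M" if "n > 0" "of_int n ^ 2 * q ^ 4 \<le> 2 * U ^ 6" for n :: int
  proof -
    have "(of_int n * q^2)^2 = of_int n ^ 2 * q ^ 4" by (simp add: power_mult_distrib flip: power_mult)
    \<comment> \<open>Enlarging 2 to the square 4 keeps the root free of
      \<open>sqrt 2\<close>.\<close>
    also have "\<dots> \<le> 4 * U ^ 6" using that(2) U(1) zero_le_power[of U 6] by linarith
    also have "\<dots> = (2 * U^3)^2" by (simp add: power_mult_distrib flip: power_mult)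
    finally have "of_int n * q^2 \<le> 2 * U^3" by (rule power2_le_imp_le) (use U in simp)
    then have "of_int n \<le> 2 * U^3 / q^2" using q0 by (simp add: field_simps)
    then show ?thesis by (simp add: M_def le_floor_iff le_nat_iff)
  qed
  have q4: "q ^ 4 > 0" using q0 by simp
  have sq: "sqrt (q ^ 4) = q^2" using q0 by (intro real_sqrt_unique) (simp_all flip: power_mult)
  have sum: "finite (bounded_cubics U (q ^ 4))"
    "real (card (bounded_cubics U (q ^ 4))) \<le> (\<Sum>n=1..M. 6 * (6 * U^2 + real n) * (q^2 / real n + 1))"
    using card_bounded_cubics_sum[OF q4, of U M] M unfolding sq by blast+
  show "finite (bounded_cubics U (q ^ 4))" by (rule sum(1))
  have RHS: "0 \<le> 144 * \<kappa> ^ 4 * U^2 * q^2 * (1 + ln (2 * \<kappa>^3 * q))"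
  proof -
    have "1 \<le> 2 * \<kappa>^3" using one_le_power[OF \<kappa>, of 3] by simp
    then have "1 * 1 \<le> 2 * \<kappa>^3 * q" by (rule mult_mono) (use \<kappa> q in auto)
    then show ?thesis by simp
  qed
  show "real (card (bounded_cubics U (q ^ 4))) \<le> 144 * \<kappa> ^ 4 * U^2 * q^2 * (1 + ln (2 * \<kappa>^3 * q))"
  proof (cases "M = 0")
    case True
    then show ?thesis using sum(2) RHS by simp
  next
    case False
    have real_M: "real M \<le> 2 * U^3 / q^2" using U by (simp add: M_def)
    have nq: "real n * q^2 \<le> 2 * U^3" if "n \<in> {1..M}" for n
    proof -
      have "real n \<le> 2 * U^3 / q^2" using real_M that by simp
      then show ?thesis using q0 by (simp add: field_simps)
    qed
    have U3: "U^3 \<le> \<kappa> * q * U^2"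
      using mult_right_mono[OF U(2), of "U^2"] by (simp add: power3_eq_cube power2_eq_square mult.assoc)
    have n1: "real n \<le> 2 * \<kappa> * U^2" if "n \<in> {1..M}" for n
    proof -
      have "real n * q * q \<le> (2 * \<kappa> * U^2) * q"
        using nq[OF that] U3 by (simp add: power2_eq_square mult_ac)
      then have "real n * q \<le> 2 * \<kappa> * U^2" using q0 by simp
      moreover have "real n * 1 \<le> real n * q" using q by (intro mult_left_mono) auto
      ultimately show ?thesis by simp
    qed
    have n2: "real n \<le> 2 * \<kappa>^3 * q" if "n \<in> {1..M}" for n
    proof -
      have "U^3 \<le> (\<kappa> * q)^3" using U by (intro power_mono) auto
      then have "real n * q^2 \<le> 2 * (\<kappa> * q)^3" using nq[OF that] by simp
      also have "\<dots> = (2 * \<kappa>^3 * q) * q^2" by (simp add: power_mult_distrib power3_eq_cube power2_eq_square)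
      finally show ?thesis using q0 by simp
    qed
    have term_bound: "6 * (6 * U^2 + real n) * (q^2 / real n + 1) \<le> 144 * \<kappa>^4 * U^2 * q^2 * (1 / real n)"
      if n: "n \<in> {1..M}" for n
    proof -
      have "1 * U^2 \<le> \<kappa> * U^2" using \<kappa> by (intro mult_right_mono) auto
      then have a: "6 * U^2 + real n \<le> 8 * \<kappa> * U^2" using n1[OF n] by simp
      have "q * 1 \<le> q * q" using q by (intro mult_left_mono) auto
      then have "2 * \<kappa>^3 * q \<le> 2 * \<kappa>^3 * q^2" using \<kappa>0 by (simp add: power2_eq_square)
      moreover have "1 * q^2 \<le> \<kappa>^3 * q^2" using \<kappa> by (intro mult_right_mono one_le_power) auto
      ultimately have "q^2 + real n \<le> 3 * \<kappa>^3 * q^2" using n2[OF n] by simp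
      then have "(q^2 + real n) / real n \<le> 3 * \<kappa>^3 * q^2 / real n" by (rule divide_right_mono) simp
      then have b: "q^2 / real n + 1 \<le> 3 * \<kappa>^3 * q^2 / real n" using n by (simp add: add_divide_distrib)
      \<comment> \<open>The factor 144 is \<open>6 * 8 * 3\<close>, with \<open>8 * \<kappa>\<close>
        and \<open>3 * \<kappa>^3\<close> from the two absorptions.\<close>
      have "(6 * U^2 + real n) * (q^2 / real n + 1) \<le> (8 * \<kappa> * U^2) * (3 * \<kappa>^3 * q^2 / real n)"
        using a b \<kappa>0 by (intro mult_mono) auto
      then have "6 * ((6 * U^2 + real n) * (q^2 / real n + 1)) \<le> 6 * ((8 * \<kappa> * U^2) * (3 * \<kappa>^3 * q^2 / real n))"
        by simp
      also have "\<dots> = 144 * \<kappa>^4 * U^2 * q^2 * (1 / real n)"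
        by (simp add: power3_eq_cube power4_eq_xxxx)
      finally show ?thesis by (simp only: mult.assoc)
    qed
    have "real (card (bounded_cubics U (q ^ 4))) \<le> (\<Sum>n=1..M. 144 * \<kappa>^4 * U^2 * q^2 * (1 / real n))"
      by (rule order_trans[OF sum(2)]) (intro sum_mono term_bound)
    also have "\<dots> = 144 * \<kappa>^4 * U^2 * q^2 * (\<Sum>n=1..M. 1 / real n)"
      by (simp only: sum_distrib_left)
    also have "\<dots> \<le> 144 * \<kappa>^4 * U^2 * q^2 * (1 + ln (2 * \<kappa>^3 * q))"
    proof (rule mult_left_mono)
      have "real M \<le> 2 * \<kappa>^3 * q" using n2[of M] False by simp
      then have "ln (real M) \<le> ln (2 * \<kappa>^3 * q)" using False by (intro ln_mono) auto
      then show "(\<Sum>n=1..M. 1 / real n) \<le> 1 + ln (2 * \<kappa>^3 * q)"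
        using sum_inverse_le_ln[of M] False by simp
    qed (use \<kappa>0 in simp)
    finally show ?thesis .
  qed
qed

lemma cubic_roots_card: "finite (cubic_roots e)" "card (cubic_roots e) \<le> 3"
proof -
  obtain e1 e2 e3 where e: "e = (e1, e2, e3)" by (cases e)
  define p where "p = [: - of_int e3, of_int e2, - of_int e1, 1 :: complex:]"
  have "p \<noteq> 0" by (simp add: p_def)
  have eq: "cubic_roots e = {z. poly p z = 0}"
    by (auto simp: e cubic_roots_def p_def power2_eq_square power3_eq_cube algebra_simps)
  show "finite (cubic_roots e)" unfolding eq by (rule poly_roots_finite[OF \<open>p \<noteq> 0\<close>])
  have "card {z. poly p z = 0} \<le> degree p" by (rule card_poly_roots_bound[OF \<open>p \<noteq> 0\<close>])
  then show "card (cubic_roots e) \<le> 3" unfolding eq by (simp add: p_def)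
qed

lemma card_bounded_cubic_roots:
  fixes \<kappa> q U :: real
  assumes "\<kappa> \<ge> 1" "q \<ge> 1" "U > 0" "U \<le> \<kappa> * q"
  shows "finite (\<Union>e\<in>bounded_cubics U (q ^ 4). cubic_roots e)"
    "real (card (\<Union>e\<in>bounded_cubics U (q ^ 4). cubic_roots e))
      \<le> 432 * \<kappa> ^ 4 * U^2 * q^2 * (1 + ln (2 * \<kappa>^3 * q))"
proof -
  note b = card_bounded_cubics[OF assms]
  show "finite (\<Union>e\<in>bounded_cubics U (q ^ 4). cubic_roots e)"
    using b(1) cubic_roots_card(1) by blast
  have "card (\<Union>e\<in>bounded_cubics U (q ^ 4). cubic_roots e) \<le> (\<Sum>e\<in>bounded_cubics U (q ^ 4). card (cubic_roots e))"
    by (rule card_UN_le[OF b(1)])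
  also have "\<dots> \<le> (\<Sum>e\<in>bounded_cubics U (q ^ 4). 3)" by (intro sum_mono cubic_roots_card)
  finally have "real (card (\<Union>e\<in>bounded_cubics U (q ^ 4). cubic_roots e)) \<le> 3 * real (card (bounded_cubics U (q ^ 4)))"
    by simp
  then show "real (card (\<Union>e\<in>bounded_cubics U (q ^ 4). cubic_roots e))
      \<le> 432 * \<kappa> ^ 4 * U^2 * q^2 * (1 + ln (2 * \<kappa>^3 * q))"
    using b(2) by simp
qed

section \<open>Counting over all fields\<close>

text \<open>\<open>spread_set\<close> refers to a chosen order of the embeddings; this form depends
  on \<open>K\<close> alone and permits comparing different fields.\<close>

definition spread_elements :: "complex set \<Rightarrow> real \<Rightarrow> complex set" where
  "spread_elements K V = {x \<in> ring_of_integers K - \<int>. reduced K x \<and>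
     (\<forall>\<sigma>\<in>embeddings K. \<forall>\<tau>\<in>embeddings K. cmod (\<sigma> x - \<tau> x) < V)}"

lemma (in cubic_embeddings) spread_elements_eq: "spread_elements K V = spread_set V"
proof -
  have "(\<forall>\<sigma>\<in>embeddings K. \<forall>\<tau>\<in>embeddings K. cmod (\<sigma> x - \<tau> x) < V) \<longleftrightarrow> spread x < V" for x
    unfolding embeddings_eq spread_def
    using norm_ge_zero[of "t1 x - t2 x"] by (auto simp: norm_minus_commute simp del: norm_ge_zero)
  then show ?thesis unfolding spread_elements_def spread_set_def by auto
qed

lemma spread_elements_decompose:
  assumes K: "cubic_field K" and \<Delta>: "cmod (discriminant K) \<le> Z" "Z \<le> 2 * cmod (discriminant K)"
    and \<alpha>: "\<alpha> \<in> spread_elements K V"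
  shows "\<exists>d \<beta> r. d \<in> {1..nat \<lfloor>V\<rfloor>} \<and> \<beta> \<in> (\<Union>e\<in>bounded_cubics (V / real d) Z. cubic_roots e) \<and>
    \<alpha> = of_int r + of_nat d * \<beta>"
proof -
  obtain t1 t2 t3 where "cubic_embeddings K t1 t2 t3" using cubic_field_embeddings[OF K] .
  then interpret cubic_embeddings K t1 t2 t3 .
  obtain \<beta> \<gamma> n u v d r where ab: "adapted_basis \<beta> \<gamma> n u v" "reduced K \<beta>" and d: "d > 0"
    and \<alpha>': "\<alpha> = of_int r + of_int d * \<beta>" and sp: "spread \<beta> < V / of_int d" and dV: "of_int d < V"
    using spread_set_decompose \<alpha> unfolding spread_elements_eq by blast
  obtain e where "e \<in> bounded_cubics (V / of_int d) Z" "\<beta> \<in> cubic_roots e"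
    using adapted_basis_bounded_cubic[OF ab sp \<Delta>] by blast
  moreover have "real (nat d) = of_int d" "of_nat (nat d) = (of_int d :: complex)" using d by simp_all
  moreover have "nat d \<in> {1..nat \<lfloor>V\<rfloor>}" using d dV by (auto simp: le_nat_iff le_floor_iff nat_le_iff)
  ultimately show ?thesis using \<alpha>' by (intro exI[of _ "nat d"] exI[of _ \<beta>] exI[of _ r]) auto
qed

text \<open>Elements differing by an integer generate the same subfield of the complex numbers.
  Hence a pair of field and reduced element is recovered from the element modulo
  \<open>\<int>\<close>.\<close>

lemma field_determined_by_element:
  assumes K: "cubic_field K1" "cubic_field K2"
    and x: "x1 \<in> spread_elements K1 V" "x2 \<in> spread_elements K2 V" "x1 - x2 = of_int k"
  shows "K1 = K2 \<and> x1 = x2"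
proof -
  obtain t1 t2 t3 where "cubic_embeddings K1 t1 t2 t3" using cubic_field_embeddings[OF K(1)] .
  then interpret A: cubic_embeddings K1 t1 t2 t3 .
  obtain s1 s2 s3 where "cubic_embeddings K2 s1 s2 s3" using cubic_field_embeddings[OF K(2)] .
  then interpret B: cubic_embeddings K2 s1 s2 s3 .
  have x1: "x1 \<in> A.ints" "x1 \<notin> \<int>" and x2: "x2 \<in> B.ints"
    using x by (auto simp: spread_elements_def)
  have "x1 = x2 + of_int k" using x(3) by (simp add: algebra_simps)
  then have "x1 \<in> B.ints" using x2 by simp
  then have "K1 = K2" using A.field_eq_span[OF x1] B.field_eq_span[of x1] x1(2) by simp
  moreover have "reduced K1 x1" "reduced K2 x2" using x by (auto simp: spread_elements_def)
  ultimately show ?thesis using A.reduced_unique x(3) by blast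
qed

lemma sum_inverse_squares_le: "(\<Sum>d=1..n. 1 / real d ^ 2) \<le> 2"
proof -
  have "(\<Sum>d=1..n. 1 / real d ^ 2) \<le> 2 - 1 / real n" if "n \<ge> 1"
    using that
  proof (induction n rule: nat_induct_at_least)
    case (Suc n)
    have "1 / real (Suc n) ^ 2 \<le> 1 / (real n * real (Suc n))"
      using Suc.hyps by (intro divide_left_mono) (auto simp: power2_eq_square)
    also have "\<dots> = 1 / real n - 1 / real (Suc n)" using Suc.hyps by (simp add: field_simps)
    finally show ?case using Suc.IH by simp
  qed simp
  moreover have "1 / real n \<ge> 0" by simp
  ultimately show ?thesis by (cases "n \<ge> 1") (linarith, simp)
qed

text \<open>A pair \<open>(K, \<alpha>)\<close> is encoded by \<open>(d, \<beta>)\<close>; the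
  forgotten \<open>r\<close> and \<open>K\<close> are recovered because \<open>\<alpha>\<close> is
  reduced and determines its field. The size of \<open>\<beta>\<close> is below
  \<open>V / d\<close>, so the sum over \<open>d\<close> costs only a factor 2, and
  \<open>864 = 2 * 432\<close>. The same injection gives finiteness.\<close>

lemma sum_card_spread_elements:
  fixes \<kappa> q V :: real and \<K> :: "complex set set"
  assumes fin: "finite \<K>" and K: "\<And>K. K \<in> \<K> \<Longrightarrow> cubic_field K"
    and \<Delta>: "\<And>K. K \<in> \<K> \<Longrightarrow> cmod (discriminant K) \<le> q ^ 4"
      "\<And>K. K \<in> \<K> \<Longrightarrow> q ^ 4 \<le> 2 * cmod (discriminant K)"
    and \<kappa>: "\<kappa> \<ge> 1" and q: "q \<ge> 1" and V: "V > 0" "V \<le> \<kappa> * q"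
  shows "\<And>K. K \<in> \<K> \<Longrightarrow> finite (spread_elements K V)"
    "(\<Sum>K\<in>\<K>. real (card (spread_elements K V))) \<le> 864 * \<kappa>^4 * V^2 * q^2 * (1 + ln (2 * \<kappa>^3 * q))"
proof -
  define R where "R d = (\<Union>e\<in>bounded_cubics (V / real d) (q ^ 4). cubic_roots e)" for d
  let ?L = "1 + ln (2 * \<kappa>^3 * q)"
  let ?D = "SIGMA d:{1..nat \<lfloor>V\<rfloor>}. R d"
  let ?T = "SIGMA K:\<K>. spread_elements K V"
  have R: "finite (R d)" "real (card (R d)) \<le> 432 * \<kappa> ^ 4 * (V / real d)^2 * q^2 * ?L"
    if "d \<in> {1..nat \<lfloor>V\<rfloor>}" for d
  proof -
    have "V / real d \<le> V / 1" using that V by (intro divide_left_mono) auto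
    then have "V / real d > 0" "V / real d \<le> \<kappa> * q" using V that by auto
    then show "finite (R d)" "real (card (R d)) \<le> 432 * \<kappa> ^ 4 * (V / real d)^2 * q^2 * ?L"
      unfolding R_def using card_bounded_cubic_roots[OF \<kappa> q] by blast+
  qed
  define P where "P x y \<longleftrightarrow> y \<in> ?D \<and> (\<exists>r. snd x = of_int r + of_nat (fst y) * snd y)"
    for x :: "complex set \<times> complex" and y
  define h where "h x = (SOME y. P x y)" for x
  have h: "P x (h x)" if xT: "x \<in> ?T" for x
  proof -
    obtain K \<alpha> where x: "x = (K, \<alpha>)" "K \<in> \<K>" "\<alpha> \<in> spread_elements K V" using xT by auto
    obtain d \<beta> r where "d \<in> {1..nat \<lfloor>V\<rfloor>}" "\<beta> \<in> R d" "\<alpha> = of_int r + of_nat d * \<beta>"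
      using spread_elements_decompose[OF K[OF x(2)] \<Delta>(1)[OF x(2)] \<Delta>(2)[OF x(2)] x(3)] unfolding R_def
      by blast
    then have "P x (d, \<beta>)" unfolding P_def x(1) by auto
    then show ?thesis unfolding h_def by (rule someI)
  qed
  have "inj_on h ?T"
  proof (rule inj_onI)
    fix x x' assume xx: "x \<in> ?T" "x' \<in> ?T" "h x = h x'"
    obtain r where r: "snd x = of_int r + of_nat (fst (h x)) * snd (h x)" using h[OF xx(1)] by (auto simp: P_def)
    obtain r' where r': "snd x' = of_int r' + of_nat (fst (h x')) * snd (h x')" using h[OF xx(2)] by (auto simp: P_def)
    have "snd x - snd x' = of_int (r - r')" unfolding r r' xx(3) by simp
    moreover have "cubic_field (fst x)" "cubic_field (fst x')" "snd x \<in> spread_elements (fst x) V"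
      "snd x' \<in> spread_elements (fst x') V"
      using xx(1,2) K by auto
    ultimately have "fst x = fst x' \<and> snd x = snd x'" using field_determined_by_element by blast
    then show "x = x'" by (simp add: prod_eq_iff)
  qed
  moreover have "h ` ?T \<subseteq> ?D" using h unfolding P_def by blast
  moreover have finD: "finite ?D" using R(1) by (intro finite_SigmaI) auto
  ultimately have finT: "finite ?T" and cardT: "card ?T \<le> card ?D"
    by (auto intro: inj_on_finite card_inj_on_le)
  show fin': "finite (spread_elements K V)" if "K \<in> \<K>" for K
  proof -
    have "spread_elements K V \<subseteq> snd ` ?T" using that by force
    then show ?thesis using finT finite_subset by blast
  qed
  have "(\<Sum>K\<in>\<K>. real (card (spread_elements K V))) = real (card ?T)"
    using fin fin' by (subst card_SigmaI) auto
  also have "\<dots> \<le> real (card ?D)" using cardT by simp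
  also have "\<dots> = (\<Sum>d=1..nat \<lfloor>V\<rfloor>. real (card (R d)))" using R(1) by (subst card_SigmaI) auto
  also have "\<dots> \<le> (\<Sum>d=1..nat \<lfloor>V\<rfloor>. 432 * \<kappa> ^ 4 * (V / real d)^2 * q^2 * ?L)"
    by (intro sum_mono R)
  also have "\<dots> = 432 * \<kappa> ^ 4 * V^2 * q^2 * ?L * (\<Sum>d=1..nat \<lfloor>V\<rfloor>. 1 / real d ^ 2)"
    by (subst sum_distrib_left) (simp add: power_divide mult_ac)
  also have "\<dots> \<le> 432 * \<kappa> ^ 4 * V^2 * q^2 * ?L * 2"
  proof (rule mult_left_mono[OF sum_inverse_squares_le])
    have "1 \<le> 2 * \<kappa>^3" using one_le_power[OF \<kappa>, of 3] by simp
    then have "1 * 1 \<le> 2 * \<kappa>^3 * q" by (rule mult_mono) (use \<kappa> q in auto)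
    then show "0 \<le> 432 * \<kappa> ^ 4 * V^2 * q^2 * ?L" by simp
  qed
  finally show "(\<Sum>K\<in>\<K>. real (card (spread_elements K V))) \<le> 864 * \<kappa>^4 * V^2 * q^2 * ?L" by simp
qed

section \<open>Isomorphic cubic fields and their discriminants\<close>

lemma field_iso_refl: "field_iso K K"
  unfolding field_iso_def by (intro exI[of _ "\<lambda>x. x"]) (auto simp: bij_betw_def)

lemma cubic_field_closed:
  assumes "cubic_field K"
  shows "1 \<in> K" "x \<in> K \<Longrightarrow> y \<in> K \<Longrightarrow> x + y \<in> K" "x \<in> K \<Longrightarrow> y \<in> K \<Longrightarrow> x * y \<in> K"
proof -
  obtain t1 t2 t3 where "cubic_embeddings K t1 t2 t3" using cubic_field_embeddings[OF assms] .
  then interpret cubic_embeddings K t1 t2 t3 .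
  show "1 \<in> K" "x \<in> K \<Longrightarrow> y \<in> K \<Longrightarrow> x + y \<in> K" "x \<in> K \<Longrightarrow> y \<in> K \<Longrightarrow> x * y \<in> K" by simp_all
qed

lemma field_iso_sym:
  assumes "cubic_field K" "field_iso K L"
  shows "field_iso L K"
proof -
  obtain f where f: "bij_betw f K L" "f 1 = 1"
    and hom: "\<And>x y. x \<in> K \<Longrightarrow> y \<in> K \<Longrightarrow> f (x + y) = f x + f y \<and> f (x * y) = f x * f y"
    using assms(2) unfolding field_iso_def by blast
  define g where "g = inv_into K f"
  have gK: "g y \<in> K" and fg: "f (g y) = y" if "y \<in> L" for y
    using f(1) that by (auto simp: g_def bij_betw_def inv_into_into f_inv_into_f)
  have gf: "g (f x) = x" if "x \<in> K" for x
    using f(1) that by (simp add: g_def bij_betw_def inv_into_f_f)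
  note c = cubic_field_closed[OF assms(1)]
  have "g (x + y) = g x + g y \<and> g (x * y) = g x * g y" if xy: "x \<in> L" "y \<in> L" for x y
  proof -
    have "f (g x + g y) = x + y" "f (g x * g y) = x * y" using hom[of "g x" "g y"] gK fg xy by auto
    then show ?thesis using gf[of "g x + g y"] gf[of "g x * g y"] c gK xy by auto
  qed
  moreover have "bij_betw g L K" unfolding g_def by (rule bij_betw_inv_into[OF f(1)])
  moreover have "g 1 = 1" using gf[OF c(1)] f(2) by simp
  ultimately show ?thesis unfolding field_iso_def by blast
qed

lemma field_iso_trans:
  assumes "field_iso K L" "field_iso L M"
  shows "field_iso K M"
proof -
  obtain f where f: "bij_betw f K L" "f 1 = 1"
    and fh: "\<And>x y. x \<in> K \<Longrightarrow> y \<in> K \<Longrightarrow> f (x + y) = f x + f y \<and> f (x * y) = f x * f y"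
    using assms(1) unfolding field_iso_def by blast
  obtain g where g: "bij_betw g L M" "g 1 = 1"
    and gh: "\<And>x y. x \<in> L \<Longrightarrow> y \<in> L \<Longrightarrow> g (x + y) = g x + g y \<and> g (x * y) = g x * g y"
    using assms(2) unfolding field_iso_def by blast
  have fL: "f x \<in> L" if "x \<in> K" for x using f(1) that by (auto simp: bij_betw_def)
  have "(g \<circ> f) (x + y) = (g \<circ> f) x + (g \<circ> f) y \<and> (g \<circ> f) (x * y) = (g \<circ> f) x * (g \<circ> f) y"
    if "x \<in> K" "y \<in> K" for x y
    using fh[OF that] gh[OF fL[OF that(1)] fL[OF that(2)]] by simp
  moreover have "bij_betw (g \<circ> f) K M" by (rule bij_betw_trans[OF f(1) g(1)])
  moreover have "(g \<circ> f) 1 = 1" using f(2) g(2) by simp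
  ultimately show ?thesis unfolding field_iso_def by blast
qed

text \<open>This is the property selected by \<open>THE\<close> in \<open>discriminant\<close>. As a
  relation it can be carried along an isomorphism without regard to existence or uniqueness of the
  value.\<close>

definition has_discriminant :: "complex set \<Rightarrow> complex \<Rightarrow> bool" where
  "has_discriminant K d \<longleftrightarrow> (\<exists>w1 w2 w3 t1 t2 t3. integral_basis K w1 w2 w3 \<and>
      embeddings K = {t1, t2, t3} \<and> distinct [t1, t2, t3] \<and>
      d = (det3 (t1 w1) (t1 w2) (t1 w3) (t2 w1) (t2 w2) (t2 w3) (t3 w1) (t3 w2) (t3 w3))^2)"

text \<open>The isomorphism carries the basis along and its inverse is composed with the embeddings:
  the entries of the determinant stay the same.\<close>

lemma has_discriminant_transfer:
  assumes KL: "cubic_field K" "cubic_field L" "field_iso K L" and d: "has_discriminant K d"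
  shows "has_discriminant L d"
proof -
  obtain f where f: "bij_betw f K L" "f 1 = 1"
    and hom: "\<And>x y. x \<in> K \<Longrightarrow> y \<in> K \<Longrightarrow> f (x + y) = f x + f y \<and> f (x * y) = f x * f y"
    using KL(3) unfolding field_iso_def by blast
  define g where "g = inv_into K f"
  have gK: "g y \<in> K" and fg: "f (g y) = y" if "y \<in> L" for y
    using f(1) that by (auto simp: g_def bij_betw_def inv_into_into f_inv_into_f)
  have gf: "g (f x) = x" and fL: "f x \<in> L" if "x \<in> K" for x
    using f(1) that by (auto simp: g_def bij_betw_def inv_into_f_f)
  obtain a1 a2 a3 where "cubic_embeddings K a1 a2 a3" using cubic_field_embeddings[OF KL(1)] .
  then interpret A: cubic_embeddings K a1 a2 a3 .
  obtain b1 b2 b3 where "cubic_embeddings L b1 b2 b3" using cubic_field_embeddings[OF KL(2)] .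
  then interpret B: cubic_embeddings L b1 b2 b3 .
  have ghom: "g (x + y) = g x + g y \<and> g (x * y) = g x * g y" if xy: "x \<in> L" "y \<in> L" for x y
  proof -
    have "f (g x + g y) = x + y" "f (g x * g y) = x * y" using hom[of "g x" "g y"] gK fg xy by auto
    then show ?thesis using gf[of "g x + g y"] gf[of "g x * g y"] gK xy by auto
  qed
  have g1: "g 1 = 1" using gf[OF A.one_in] f(2) by simp
  \<comment> \<open>Extended by 0, the isomorphism and its inverse are themselves embeddings into
    the complex numbers, so they preserve integrality.\<close>
  define \<phi> where "\<phi> x = (if x \<in> K then f x else 0)" for x
  define \<psi> where "\<psi> y = (if y \<in> L then g y else 0)" for y
  have \<phi>: "\<phi> \<in> embeddings K" using hom f(2) by (simp add: embeddings_def \<phi>_def)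
  have \<psi>: "\<psi> \<in> embeddings L" using ghom g1 by (simp add: embeddings_def \<psi>_def)
  have \<phi>\<psi>: "\<phi> (\<psi> y) = y" "\<psi> y \<in> K" if "y \<in> L" for y using that gK fg by (simp_all add: \<phi>_def \<psi>_def)
  have \<psi>\<phi>: "\<psi> (\<phi> x) = x" "\<phi> x \<in> L" if "x \<in> K" for x using that gf fL by (simp_all add: \<phi>_def \<psi>_def)
  have \<phi>_ints: "\<phi> x \<in> B.ints" if "x \<in> A.ints" for x
    using A.emb_algebraic_int[OF \<phi> that] \<psi>\<phi>(2) that by (simp add: B.ints_iff)
  have \<psi>_ints: "\<psi> x \<in> A.ints" if "x \<in> B.ints" for x
    using B.emb_algebraic_int[OF \<psi> that] \<phi>\<psi>(2) that by (simp add: A.ints_iff)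
  obtain w1 w2 w3 t1 t2 t3 where w: "integral_basis K w1 w2 w3"
    and t: "embeddings K = {t1, t2, t3}" "distinct [t1, t2, t3]"
    and det: "d = (det3 (t1 w1) (t1 w2) (t1 w3) (t2 w1) (t2 w2) (t2 w3) (t3 w1) (t3 w2) (t3 w3))^2"
    using d unfolding has_discriminant_def by blast
  have wi: "w1 \<in> A.ints" "w2 \<in> A.ints" "w3 \<in> A.ints" using w by (auto simp: integral_basis_def)
  have \<phi>_lin: "\<phi> (of_int a * w1 + of_int b * w2 + of_int c * w3)
      = of_int a * \<phi> w1 + of_int b * \<phi> w2 + of_int c * \<phi> w3" for a b c
    using in_embeddingsD(1,2)[OF \<phi>] A.emb_of_int[OF \<phi>] wi by simp
  have lin_iff: "y = of_int a * \<phi> w1 + of_int b * \<phi> w2 + of_int c * \<phi> w3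
      \<longleftrightarrow> \<psi> y = of_int a * w1 + of_int b * w2 + of_int c * w3" if "y \<in> L" for y a b c
  proof
    assume "y = of_int a * \<phi> w1 + of_int b * \<phi> w2 + of_int c * \<phi> w3"
    then have "y = \<phi> (of_int a * w1 + of_int b * w2 + of_int c * w3)" by (simp add: \<phi>_lin)
    then show "\<psi> y = of_int a * w1 + of_int b * w2 + of_int c * w3" using \<psi>\<phi>(1) wi by simp
  next
    assume "\<psi> y = of_int a * w1 + of_int b * w2 + of_int c * w3"
    then have "\<phi> (\<psi> y) = of_int a * \<phi> w1 + of_int b * \<phi> w2 + of_int c * \<phi> w3" by (simp add: \<phi>_lin)
    then show "y = of_int a * \<phi> w1 + of_int b * \<phi> w2 + of_int c * \<phi> w3" using \<phi>\<psi>(1)[OF that] by simp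
  qed
  have "integral_basis L (\<phi> w1) (\<phi> w2) (\<phi> w3)"
    unfolding integral_basis_def
  proof (intro conjI ballI)
    show "{\<phi> w1, \<phi> w2, \<phi> w3} \<subseteq> B.ints" using \<phi>_ints wi by simp
    fix y assume y: "y \<in> B.ints"
    then have "\<exists>!(a :: int \<times> int \<times> int).
        \<psi> y = of_int (fst a) * w1 + of_int (fst (snd a)) * w2 + of_int (snd (snd a)) * w3"
      using w \<psi>_ints unfolding integral_basis_def by blast
    then show "\<exists>!(a :: int \<times> int \<times> int).
        y = of_int (fst a) * \<phi> w1 + of_int (fst (snd a)) * \<phi> w2 + of_int (snd (snd a)) * \<phi> w3"
      using lin_iff[of y] y by simp
  qed
  moreover define T where "T \<sigma> = (\<lambda>y. if y \<in> L then \<sigma> (\<psi> y) else 0)" for \<sigma> :: "complex \<Rightarrow> complex"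
  have T_emb: "T \<sigma> \<in> embeddings L" if "\<sigma> \<in> embeddings K" for \<sigma>
    using in_embeddingsD[OF that] in_embeddingsD(1-3)[OF \<psi>] \<phi>\<psi>(2) by (simp add: embeddings_def T_def)
  have T\<phi>: "T \<sigma> (\<phi> x) = \<sigma> x" if "x \<in> K" for \<sigma> x using \<psi>\<phi>[OF that] by (simp add: T_def)
  have T_inj: "\<sigma> = \<tau>" if "\<sigma> \<in> embeddings K" "\<tau> \<in> embeddings K" "T \<sigma> = T \<tau>" for \<sigma> \<tau>
  proof
    fix x show "\<sigma> x = \<tau> x"
    proof (cases "x \<in> K")
      case True
      then show ?thesis using T\<phi>[of x \<sigma>] T\<phi>[of x \<tau>] that(3) by simp
    next
      case False
      then show ?thesis using in_embeddingsD(4)[OF that(1)] in_embeddingsD(4)[OF that(2)] by simp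
    qed
  qed
  have te: "t1 \<in> embeddings K" "t2 \<in> embeddings K" "t3 \<in> embeddings K" by (simp_all add: t(1))
  have Td: "distinct [T t1, T t2, T t3]"
    using T_inj[OF te(1,2)] T_inj[OF te(1,3)] T_inj[OF te(2,3)] t(2) by auto
  moreover have "embeddings L = {T t1, T t2, T t3}"
  \<comment> \<open>Injectivity of \<open>T\<close> gives three embeddings of \<open>L\<close>, and
    there are only three.\<close>
  proof (rule card_subset_eq[symmetric])
    show "finite (embeddings L)" by (simp add: B.embeddings_eq)
    show "{T t1, T t2, T t3} \<subseteq> embeddings L" using T_emb te by simp
    show "card {T t1, T t2, T t3} = card (embeddings L)"
      using Td B.distinct_embeddings by (simp add: B.embeddings_eq)
  qed
  moreover have "d = (det3 (T t1 (\<phi> w1)) (T t1 (\<phi> w2)) (T t1 (\<phi> w3)) (T t2 (\<phi> w1)) (T t2 (\<phi> w2))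
     (T t2 (\<phi> w3)) (T t3 (\<phi> w1)) (T t3 (\<phi> w2)) (T t3 (\<phi> w3)))^2"
    using det T\<phi> wi by simp
  ultimately show ?thesis unfolding has_discriminant_def by blast
qed

lemma field_iso_discriminant:
  assumes "cubic_field K" "cubic_field L" "field_iso K L"
  shows "discriminant K = discriminant L"
proof -
  have "has_discriminant K = has_discriminant L"
    using has_discriminant_transfer assms field_iso_sym[OF assms(1,3)] by blast
  then show ?thesis unfolding discriminant_def has_discriminant_def[symmetric] by simp
qed

section \<open>Dyadic summation\<close>

lemma S_set_subset_spread_elements:
  assumes "cubic_field K"
  shows "S_set K Y \<subseteq> spread_elements K (2 * Y)"
proof -
  obtain t1 t2 t3 where "cubic_embeddings K t1 t2 t3" using cubic_field_embeddings[OF assms] .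
  then interpret cubic_embeddings K t1 t2 t3 .
  show ?thesis unfolding spread_elements_eq by (rule S_set_subset_spread_set)
qed

text \<open>A member of \<open>S_set\<close> is an integral element outside \<open>\<int>\<close>,
  and such an element provides the integral basis from which the discriminant is computed.\<close>

lemma discriminant_cubic_field_ge_1:
  assumes "cubic_field K" "S_set K Y \<noteq> {}"
  shows "cmod (discriminant K) \<ge> 1"
proof -
  obtain t1 t2 t3 where "cubic_embeddings K t1 t2 t3" using cubic_field_embeddings[OF assms(1)] .
  then interpret cubic_embeddings K t1 t2 t3 .
  obtain \<alpha> where "\<alpha> \<in> ints" "\<alpha> \<notin> \<int>" using assms(2) by (auto simp: S_set_def)
  then obtain \<beta> \<gamma> n u v where "adapted_basis \<beta> \<gamma> n u v" by (rule ex_adapted_basis)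
  then show ?thesis by (rule discriminant_ge_1)
qed

lemma spread_elements_mono: "V \<le> W \<Longrightarrow> spread_elements K V \<subseteq> spread_elements K W"
  unfolding spread_elements_def by fastforce

text \<open>In \<open>4 * W\<close> one factor 2 passes from \<open>abs_inf\<close> to
  \<open>spread\<close>, the other from elements to differences. The nonempty set at scale
  \<open>W\<close> makes the count at least 1, so the extra 1 in the scaling bound at most doubles
  it.\<close>

lemma card_S_set_scale:
  assumes K: "cubic_field K" and fin: "finite (spread_elements K (4 * W))"
    and ne: "S_set K W \<noteq> {}" and N: "N > 0" "Y \<le> W * real N"
  shows "card (S_set K Y) \<le> 2 * N ^ 2 * card (spread_elements K (4 * W))"
proof -
  obtain t1 t2 t3 where "cubic_embeddings K t1 t2 t3" using cubic_field_embeddings[OF K] .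
  then interpret cubic_embeddings K t1 t2 t3 .
  obtain \<alpha> where \<alpha>: "\<alpha> \<in> S_set K W" using ne by blast
  then have \<alpha>2: "\<alpha> \<in> spread_elements K (2 * W)" using S_set_subset_spread_elements[OF K] by blast
  then have "spread \<alpha> < 2 * W" unfolding spread_elements_eq spread_set_def by blast
  then have "W > 0" using spread_nonneg[of \<alpha>] by linarith
  then have "\<alpha> \<in> spread_elements K (4 * W)" using \<alpha>2 spread_elements_mono[of "2 * W" "4 * W" K] by auto
  then have "card (spread_elements K (4 * W)) > 0" using fin by (auto simp: card_gt_0_iff)
  then have one: "1 \<le> card (spread_elements K (4 * W))" by simp
  have "2 * (2 * Y) / real N \<le> 4 * W" using N by (simp add: field_simps)
  then have sub: "spread_elements K (2 * (2 * Y) / real N) \<subseteq> spread_elements K (4 * W)"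
    by (rule spread_elements_mono)
  then have fin': "finite (spread_elements K (2 * (2 * Y) / real N))" using fin finite_subset by blast
  note sc = card_spread_set_scale[OF fin'[unfolded spread_elements_eq] N(1), folded spread_elements_eq]
  have "card (S_set K Y) \<le> card (spread_elements K (2 * Y))"
    by (rule card_mono[OF sc(1) S_set_subset_spread_elements[OF K]])
  also have "\<dots> \<le> N ^ 2 * (card (spread_elements K (2 * (2 * Y) / real N)) + 1)" by (rule sc(2))
  also have "\<dots> \<le> N ^ 2 * (card (spread_elements K (4 * W)) + card (spread_elements K (4 * W)))"
    using card_mono[OF fin sub] one by (intro mult_left_mono add_mono) auto
  finally show ?thesis by (simp add: algebra_simps)
qed

text \<open>\<open>N\<close> is about \<open>Y / W\<close> with \<open>W = C * q\<close>; the factor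
  \<open>W^2\<close> in the count at scale \<open>W\<close> cancels against \<open>N^2\<close>,
  leaving \<open>Y^2 * q^2\<close>. The factor 2 in \<open>C * q \<le> 2 * Y\<close> makes room for
  the upper end \<open>q^4\<close> of a dyadic range, which may exceed the bound on the
  discriminants.\<close>

lemma sum_card_S_set_dyadic:
  fixes C q Y :: real
  assumes fin: "finite \<K>" and K: "\<And>K. K \<in> \<K> \<Longrightarrow> cubic_field K"
    and \<Delta>: "\<And>K. K \<in> \<K> \<Longrightarrow> cmod (discriminant K) \<le> q ^ 4"
      "\<And>K. K \<in> \<K> \<Longrightarrow> q ^ 4 \<le> 2 * cmod (discriminant K)"
    and ne: "\<And>K. K \<in> \<K> \<Longrightarrow> S_set K (C * q) \<noteq> {}"
    and C: "C > 1" and q: "q \<ge> 1" and Y: "C * q \<le> 2 * Y"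
  shows "(\<Sum>K\<in>\<K>. real (card (S_set K Y))) \<le> 63700992 * C^4 * Y^2 * q^2 * (1 + ln (128 * C^3 * q))"
proof -
  define W where "W = C * q"
  define N where "N = nat \<lceil>Y / W\<rceil>"
  let ?L = "1 + ln (128 * C^3 * q)"
  have W: "W > 0" using C q by (simp add: W_def)
  then have "Y > 0" using Y by (simp add: W_def)
  then have "Y / W > 0" using W by simp
  then have N: "N > 0" and N1: "Y / W \<le> real N" and N2: "real N \<le> Y / W + 1"
    unfolding N_def by (simp, simp, linarith)
  have "Y \<le> W * real N" using N1 W by (simp add: field_simps)
  have "1 \<le> 2 * (Y / W)" using Y W by (simp add: W_def field_simps)
  \<comment> \<open>Rounding up costs 1, which is at most \<open>2 * (Y / W)\<close>.\<close>
  then have N3: "real N \<le> 3 * (Y / W)" using N2 by linarith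
  have \<kappa>: "4 * C \<ge> 1" using C by simp
  have V: "4 * W > 0" "4 * W \<le> (4 * C) * q" using W by (simp_all add: W_def)
  note sp = sum_card_spread_elements[OF fin K \<Delta> \<kappa> q V]
  have sum: "(\<Sum>K\<in>\<K>. real (card (spread_elements K (4 * W))))
      \<le> 864 * (4 * C)^4 * (4 * W)^2 * q^2 * (1 + ln (2 * (4 * C)^3 * q))"
    by (rule sp(2))
  have eL: "1 + ln (2 * (4 * C)^3 * q) = ?L" by (simp add: power_mult_distrib)
  have L0: "0 \<le> ?L"
  proof -
    have "1 \<le> C^3" by (rule one_le_power) (use C in simp)
    then have "1 \<le> 128 * C^3" by linarith
    then have "1 * 1 \<le> 128 * C^3 * q" by (rule mult_mono) (use C q in auto)
    then show ?thesis by simp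
  qed
  have "(\<Sum>K\<in>\<K>. real (card (S_set K Y))) \<le> (\<Sum>K\<in>\<K>. 2 * real N ^ 2 * real (card (spread_elements K (4 * W))))"
  proof (rule sum_mono)
    fix K assume "K \<in> \<K>"
    then have "card (S_set K Y) \<le> 2 * N ^ 2 * card (spread_elements K (4 * W))"
      using card_S_set_scale[OF K sp(1) _ N \<open>Y \<le> W * real N\<close>] ne by (simp add: W_def)
    then have "real (card (S_set K Y)) \<le> real (2 * N ^ 2 * card (spread_elements K (4 * W)))"
      by (simp only: of_nat_le_iff)
    then show "real (card (S_set K Y)) \<le> 2 * real N ^ 2 * real (card (spread_elements K (4 * W)))" by simp
  qed
  also have "\<dots> = 2 * real N ^ 2 * (\<Sum>K\<in>\<K>. real (card (spread_elements K (4 * W))))"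
    by (simp only: sum_distrib_left)
  also have "\<dots> \<le> 2 * real N ^ 2 * (864 * (4 * C)^4 * (4 * W)^2 * q^2 * ?L)"
    using sum unfolding eL by (rule mult_left_mono) simp
  also have "\<dots> \<le> 2 * (3 * (Y / W)) ^ 2 * (864 * (4 * C)^4 * (4 * W)^2 * q^2 * ?L)"
  proof (rule mult_right_mono)
    show "2 * real N ^ 2 \<le> 2 * (3 * (Y / W)) ^ 2" using N3 by (intro mult_left_mono power_mono) auto
    show "0 \<le> 864 * (4 * C)^4 * (4 * W)^2 * q^2 * ?L" using L0 C by simp
  qed
  \<comment> \<open>The constant is \<open>2 * 3^2 * 864 * 4^4 * 4^2\<close>.\<close>
  also have "\<dots> = 63700992 * C^4 * Y^2 * q^2 * ?L"
    using W by (simp add: power_mult_distrib power_divide field_simps)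
  finally show ?thesis .
qed

lemma dyadic_exponent:
  fixes x :: real
  assumes "x \<ge> 1"
  shows "2 ^ nat \<lfloor>log 2 x\<rfloor> \<le> x" "x < 2 ^ Suc (nat \<lfloor>log 2 x\<rfloor>)"
proof -
  define j where "j = nat \<lfloor>log 2 x\<rfloor>"
  have "log 2 x \<ge> 0" using assms by simp
  then have j: "real j \<le> log 2 x" "log 2 x < real (Suc j)" unfolding j_def by linarith+
  have "2 powr real j \<le> x" using j(1) assms by (subst powr_le_iff) auto
  then show "2 ^ nat \<lfloor>log 2 x\<rfloor> \<le> x" unfolding j_def[symmetric] by (simp add: powr_realpow)
  have "x < 2 powr real (Suc j)" using j(2) assms by (subst less_powr_iff) auto
  then show "x < 2 ^ Suc (nat \<lfloor>log 2 x\<rfloor>)" unfolding j_def[symmetric] by (simp only: powr_realpow zero_less_numeral)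
qed

lemma sum_card_S_set:
  fixes C X Y :: real
  assumes fin: "finite \<K>" and K: "\<And>K. K \<in> \<K> \<Longrightarrow> cubic_field K"
    and \<Delta>: "\<And>K. K \<in> \<K> \<Longrightarrow> cmod (discriminant K) \<le> X"
    and C: "C > 1"
    and ne: "\<And>Z K. Z > 0 \<Longrightarrow> cubic_field K \<Longrightarrow> cmod (discriminant K) \<le> Z \<Longrightarrow>
           S_set K (C * Z powr (1/4)) \<noteq> {}"
    and X: "X \<ge> 1" and Y: "C * X powr (1/4) \<le> Y"
  shows "(\<Sum>K\<in>\<K>. real (card (S_set K Y)))
    \<le> 254803968 * C^4 * X powr (1/2) * Y^2 * (1 + ln (256 * C^3) + ln X)^2"
proof -
  define \<L> where "\<L> = 1 + ln (256 * C^3) + ln X"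
  define J where "J = nat \<lfloor>log 2 X\<rfloor>"
  define D where "D K = nat \<lfloor>log 2 (cmod (discriminant K))\<rfloor>" for K
  have "1 \<le> C^3" by (rule one_le_power) (use C in simp)
  then have C3: "256 * C^3 \<ge> 1" by linarith
  have lnX: "ln X \<ge> 0" using X by simp
  have \<L>: "\<L> \<ge> 1" using C3 lnX unfolding \<L>_def by (simp add: ln_ge_zero)
  have \<Delta>1: "cmod (discriminant K) \<ge> 1" if "K \<in> \<K>" for K
    using discriminant_cubic_field_ge_1[OF K[OF that] ne[OF _ K[OF that] \<Delta>[OF that]]] X by simp
  have DJ: "D K \<le> J" if "K \<in> \<K>" for K
    unfolding D_def J_def using \<Delta>[OF that] \<Delta>1[OF that]
    by (intro nat_mono floor_mono log_mono) linarith+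
  have each: "(\<Sum>K\<in>{K \<in> \<K>. D K = j}. real (card (S_set K Y)))
      \<le> 127401984 * C^4 * X powr (1/2) * Y^2 * \<L>" if j: "j \<in> {0..J}" for j
  proof -
    \<comment> \<open>The absolute discriminants of this block lie between \<open>2^j\<close> and
      \<open>2^(j+1)\<close>; the hypothesis on \<open>C\<close> is used at the upper end
      \<open>Z = q^4\<close>.\<close>
    define q where "q = (2 ^ Suc j :: real) powr (1/4)"
    have q4: "q ^ 4 = 2 ^ Suc j" by (simp add: q_def powr_power)
    have q1: "q \<ge> 1" unfolding q_def by (rule ge_one_powr_ge_zero[OF one_le_power]) simp_all
    have "(2::real) ^ j \<le> 2 ^ J" using j by (intro power_increasing) auto
    also have "\<dots> \<le> X" unfolding J_def by (rule dyadic_exponent(1)[OF X])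
    finally have q4X: "q ^ 4 \<le> 2 * X" by (simp add: q4)
    have "q ^ 4 \<le> (2 * X powr (1/4)) ^ 4" using q4X X by (simp add: power_mult_distrib powr_power)
    then have "q \<le> 2 * X powr (1/4)" using power_le_imp_le_base[of q 3 "2 * X powr (1/4)"] by simp
    then have "C * q \<le> C * (2 * X powr (1/4))" using C by (intro mult_left_mono) auto
    then have CqY: "C * q \<le> 2 * Y" using Y by simp
    have "(q^2)^2 \<le> (2 * X powr (1/2))^2" using q4X X by (simp add: power_mult_distrib powr_power flip: power_mult)
    then have q2: "q^2 \<le> 2 * X powr (1/2)" by (rule power2_le_imp_le) simp
    have "q \<le> q ^ 4" using q1 power_increasing[of 1 4 q] by simp
    \<comment> \<open>The estimate \<open>q \<le> q^4 \<le> 2 * X\<close> is crude, but only a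
      logarithm is at stake; it turns 128 into 256.\<close>
    then have "128 * C^3 * q \<le> (256 * C^3) * X" using q4X C by simp
    moreover have "0 < 128 * C^3 * q" using C q1 by simp
    ultimately have "ln (128 * C^3 * q) \<le> ln ((256 * C^3) * X)" by simp
    also have "\<dots> = ln (256 * C^3) + ln X" by (rule ln_mult_pos) (use C X in simp_all)
    finally have L: "1 + ln (128 * C^3 * q) \<le> \<L>" by (simp add: \<L>_def)
    have "(\<Sum>K\<in>{K \<in> \<K>. D K = j}. real (card (S_set K Y)))
       \<le> 63700992 * C^4 * Y^2 * q^2 * (1 + ln (128 * C^3 * q))"
    proof (rule sum_card_S_set_dyadic[OF _ _ _ _ _ C q1 CqY])
      show "finite {K \<in> \<K>. D K = j}" using fin by simp
      fix K assume K': "K \<in> {K \<in> \<K>. D K = j}"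
      then have KK: "K \<in> \<K>" "D K = j" by auto
      show "cubic_field K" using K KK by blast
      have d: "2 ^ j \<le> cmod (discriminant K)" "cmod (discriminant K) < 2 ^ Suc j"
        using dyadic_exponent[OF \<Delta>1[OF KK(1)]] KK(2) unfolding D_def by auto
      show "cmod (discriminant K) \<le> q ^ 4" "q ^ 4 \<le> 2 * cmod (discriminant K)"
        using d unfolding q4 by simp_all
      show "S_set K (C * q) \<noteq> {}" unfolding q_def
        by (rule ne) (use d K KK in auto)
    qed
    also have "\<dots> \<le> 63700992 * C^4 * Y^2 * q^2 * \<L>"
      using L by (rule mult_left_mono) (use C in simp)
    also have "\<dots> \<le> 63700992 * C^4 * Y^2 * (2 * X powr (1/2)) * \<L>"
      by (intro mult_right_mono mult_left_mono q2) (use \<L> C in auto)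
    finally show ?thesis by (simp add: mult_ac)
  qed
  have "(\<Sum>K\<in>\<K>. real (card (S_set K Y))) = (\<Sum>j\<in>{0..J}. \<Sum>K\<in>{K \<in> \<K>. D K = j}. real (card (S_set K Y)))"
    by (rule sum.group[symmetric]) (use fin DJ in auto)
  also have "\<dots> \<le> (\<Sum>j\<in>{0..J}. 127401984 * C^4 * X powr (1/2) * Y^2 * \<L>)"
    by (intro sum_mono each)
  also have "\<dots> = real (J + 1) * (127401984 * C^4 * X powr (1/2) * Y^2 * \<L>)" by simp
  also have "\<dots> \<le> (2 * \<L>) * (127401984 * C^4 * X powr (1/2) * Y^2 * \<L>)"
  proof (rule mult_right_mono)
    \<comment> \<open>\<open>J\<close> is at most \<open>log 2 X\<close>, and
      \<open>ln 2 \<ge> 1/2\<close> turns this into \<open>2 * ln X\<close>.\<close>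
    have "ln 2 \<ge> (1/2 :: real)" using ln_le_minus_one[of "1/2 :: real"] by (simp add: ln_div)
    then have "1 / ln 2 \<le> (2 :: real)" by (simp add: field_simps)
    then have "ln X * (1 / ln 2) \<le> ln X * 2" using lnX by (rule mult_left_mono)
    then have "log 2 X \<le> 2 * ln X" by (simp add: log_def)
    moreover have "real J \<le> log 2 X" unfolding J_def using X by simp
    moreover have "ln (256 * C^3) \<ge> 0" using C3 by (rule ln_ge_zero)
    ultimately show "real (J + 1) \<le> 2 * \<L>" unfolding \<L>_def using lnX by simp
    show "0 \<le> 127401984 * C^4 * X powr (1/2) * Y^2 * \<L>" using C \<L> by simp
  qed
  also have "\<dots> = 254803968 * C^4 * X powr (1/2) * Y^2 * \<L>^2" by (simp add: power2_eq_square)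
  finally show ?thesis unfolding \<L>_def .
qed

text \<open>A class consists of all cubic fields isomorphic to one of bounded discriminant, so the
  bound for the chosen member rests on invariance under isomorphism. The third part makes the choice
  of members injective on classes.\<close>

lemma cubic_iso_classes_representative:
  assumes "cl \<in> cubic_iso_classes X"
  shows "cubic_field (SOME K. K \<in> cl)" "cmod (discriminant (SOME K. K \<in> cl)) \<le> X"
    "cl = {L. cubic_field L \<and> field_iso (SOME K. K \<in> cl) L}"
proof -
  obtain K where K: "cubic_field K" "cmod (discriminant K) \<le> X"
    and cl: "cl = {L. cubic_field L \<and> field_iso K L}"
    using assms unfolding cubic_iso_classes_def by (auto elim!: quotientE)
  define R where "R = (SOME K. K \<in> cl)"
  have "K \<in> cl" using K field_iso_refl by (simp add: cl)
  then have "R \<in> cl" unfolding R_def by (rule someI)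
  then have R: "cubic_field R" "field_iso K R" by (auto simp: cl)
  show "cubic_field (SOME K. K \<in> cl)" using R by (simp add: R_def)
  show "cmod (discriminant (SOME K. K \<in> cl)) \<le> X"
    using K(2) field_iso_discriminant[OF K(1) R] by (simp add: R_def)
  have "field_iso R K" using field_iso_sym K(1) R(2) by blast
  then have "cl = {L. cubic_field L \<and> field_iso R L}"
    unfolding cl using field_iso_trans R(2) by blast
  then show "cl = {L. cubic_field L \<and> field_iso (SOME K. K \<in> cl) L}" by (simp add: R_def)
qed

theorem theorem3p8:
  fixes C :: real
  assumes "C > 1"
    and "\<And>Z K. Z > 0 \<Longrightarrow> cubic_field K \<Longrightarrow> cmod (discriminant K) \<le> Z \<Longrightarrow>
           S_set K (C * Z powr (1/4)) \<noteq> {}"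
  shows "\<forall>\<epsilon>>0. \<exists>c. \<forall>X Y. X > 0 \<longrightarrow> Y > 0 \<longrightarrow> Y \<ge> C * X powr (1/4) \<longrightarrow>
           (\<Sum>cl\<in>cubic_iso_classes X. real (card (S_set (SOME K. K \<in> cl) Y)))
             \<le> c * X powr (1/2 + \<epsilon>) * Y^2"
proof (intro allI impI)
  fix \<epsilon> :: real assume \<epsilon>: "\<epsilon> > 0"
  define B where "B = 1 + ln (256 * C^3)"
  \<comment> \<open>The two logarithms form a square, so each is compared with
    \<open>X^(\<epsilon>/2)\<close>; the term \<open>2 / \<epsilon>\<close> comes from
    \<open>ln X \<le> X^(\<epsilon>/2) / (\<epsilon>/2)\<close>.\<close>
  define c where "c = 254803968 * C^4 * (B + 2 / \<epsilon>)^2"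
  have "c \<ge> 0" using assms(1) by (simp add: c_def)
  have "1 \<le> C^3" by (rule one_le_power) (use assms(1) in simp)
  then have "256 * C^3 \<ge> 1" by linarith
  then have B: "B \<ge> 0" unfolding B_def by (simp add: ln_ge_zero)
  show "\<exists>c. \<forall>X Y. X > 0 \<longrightarrow> Y > 0 \<longrightarrow> Y \<ge> C * X powr (1/4) \<longrightarrow>
           (\<Sum>cl\<in>cubic_iso_classes X. real (card (S_set (SOME K. K \<in> cl) Y)))
             \<le> c * X powr (1/2 + \<epsilon>) * Y^2"
  proof (intro exI[of _ c] allI impI)
    fix X Y :: real assume XY: "X > 0" "Y > 0" "C * X powr (1/4) \<le> Y"
    let ?rep = "\<lambda>cl. SOME K. K \<in> (cl :: complex set set)"
    let ?CL = "cubic_iso_classes X"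
    have RHS: "0 \<le> c * X powr (1/2 + \<epsilon>) * Y^2" using \<open>c \<ge> 0\<close> by simp
    show "(\<Sum>cl\<in>?CL. real (card (S_set (?rep cl) Y))) \<le> c * X powr (1/2 + \<epsilon>) * Y^2"
    proof (cases "finite ?CL \<and> ?CL \<noteq> {}")
      case False
      \<comment> \<open>\<open>sum\<close> over an infinite set is 0 by convention, as it is over
        the empty set.\<close>
      then have "(\<Sum>cl\<in>?CL. real (card (S_set (?rep cl) Y))) = 0" by auto
      then show ?thesis using RHS by simp
    next
      case True
      note rep = cubic_iso_classes_representative
      obtain cl where cl: "cl \<in> ?CL" using True by blast
      \<comment> \<open>A class exists, and the discriminant of its member has absolute value at
        least 1 and at most \<open>X\<close>; this makes \<open>ln X\<close> nonnegative.\<close>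
      have X1: "X \<ge> 1"
        using discriminant_cubic_field_ge_1[OF rep(1)[OF cl] assms(2)[OF XY(1) rep(1,2)[OF cl]]] rep(2)[OF cl]
        by linarith
      have inj: "inj_on ?rep ?CL"
      proof (rule inj_onI)
        fix a b assume ab: "a \<in> ?CL" "b \<in> ?CL" "?rep a = ?rep b"
        show "a = b" using rep(3)[OF ab(1)] rep(3)[OF ab(2)] ab(3) by simp
      qed
      have "(\<Sum>cl\<in>?CL. real (card (S_set (?rep cl) Y))) = (\<Sum>K\<in>?rep ` ?CL. real (card (S_set K Y)))"
        by (simp add: sum.reindex[OF inj])
      also have "\<dots> \<le> 254803968 * C^4 * X powr (1/2) * Y^2 * (1 + ln (256 * C^3) + ln X)^2"
        by (rule sum_card_S_set) (use True rep assms X1 XY in auto)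
      also have "\<dots> \<le> 254803968 * C^4 * X powr (1/2) * Y^2 * ((B + 2 / \<epsilon>) * X powr (\<epsilon>/2))^2"
      proof (intro mult_left_mono power_mono)
        have "1 \<le> X powr (\<epsilon>/2)" using X1 \<epsilon> by (intro ge_one_powr_ge_zero) auto
        then have "B * 1 \<le> B * X powr (\<epsilon>/2)" using B by (rule mult_left_mono)
        moreover have "ln X \<le> X powr (\<epsilon>/2) / (\<epsilon>/2)" using X1 \<epsilon> by (intro ln_powr_bound) auto
        ultimately show "1 + ln (256 * C^3) + ln X \<le> (B + 2 / \<epsilon>) * X powr (\<epsilon>/2)"
          unfolding B_def[symmetric] by (simp add: algebra_simps)
        show "0 \<le> 1 + ln (256 * C^3) + ln X" unfolding B_def[symmetric] using B X1 by simp
      qed (use assms in simp)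
      also have "\<dots> = c * (X powr (1/2) * (X powr (\<epsilon>/2))^2) * Y^2"
        by (simp add: c_def power_mult_distrib)
      also have "X powr (1/2) * (X powr (\<epsilon>/2))^2 = X powr (1/2 + \<epsilon>)"
        using XY(1) by (simp add: powr_power powr_add)
      finally show ?thesis .
    qed
  qed
qed

end
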